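(* The variation matrix $V$ satisfies $\Delta(V^T)=V^T\otimes V^T$; that is, $\Delta(V_{v,w})=\sum_{u\in\mathbb Z^\infty_{\ge0}}V_{u,w}\otimes V_{v,u}$ for all $v,w\in\mathbb Z^\infty_{\ge0}$.
   Context: **The algebras.** Let $x_1,x_2,\dots$ be free variables and $x_{i\to j}=\prod_{r=i}^{j-1}x_r$ for $i<j$. $\overline{\mathbb H}^{\mathrm{symb}}$ is the free commutative graded $\mathbb Q$-algebra generated by: elements $[x_i]_0$, $i\ge1$, of weight $1$; regular symbols $[x_{i_1\to i_2},\dots,x_{i_d\to i_{d+1}}]_{n_1,\dots,n_d}$ ($d\ge1$, $1\le i_1<\dots<i_{d+1}$, $n_r\ge1$) of weight $n_1+\dots+n_d$; and inverted symbols $[x_{i_d\to i_{d+1}}^{-1},\dots,x_{i_1\to i_2}^{-1}]_{n_d,\dots,n_1}$ of weight $n_1+\dots+n_d$. $\mathbb H^{\mathrm{symb}}$ is the subalgebra generated by the $[x_i]_0$ and the regular symbols. Put $[x_{i\to j}]_0=-[x_{i\to j}^{-1}]_0=\sum_{r=i}^{j-1}[x_r]_0$, $[1]_0=0$. Generating series: $[y_1,\dots,y_d|t_1,\dots,t_d]=\sum_{n_i\ge1}[y_1,\dots,y_d]_{n_1,\dots,n_d}t_1^{n_1-1}\cdots t_d^{n_d-1}$, $[\emptyset|\emptyset]=1$, $\exp([y]_0t)=\sum_{n\ge0}[y]_0^nt^n/n!$; linear forms in the $t$'s may be substituted for the $t_i$. **Coproduct on $\overline{\mathbb H}^{\mathrm{symb}}$.**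 $\Delta_{\overline{\mathbb H}}$ is the algebra homomorphism with $\Delta([x_i]_0)=[x_i]_0\otimes1+1\otimes[x_i]_0$ and, for $(y_1,\dots,y_d)$ the argument of a regular or inverted symbol and $y_{i\to j}=\prod_{r=i}^{j-1}y_r$, $$\Delta[y_1,\dots,y_d|t_1,\dots,t_d]=\sum[y_{i_1\to i_2},\dots,y_{i_k\to i_{k+1}}|t_{j_1},\dots,t_{j_k}]\otimes[y_1,\dots,y_{i_1-1}|t_1,\dots,t_{i_1-1}]\prod_{\alpha=1}^k(-1)^{j_\alpha-i_\alpha}\exp([y_{i_\alpha\to i_{\alpha+1}}]_0t_{j_\alpha})\,[y_{j_\alpha-1}^{-1},\dots,y_{i_\alpha}^{-1}|t_{j_\alpha}-t_{j_\alpha-1},\dots,t_{j_\alpha}-t_{i_\alpha}]\,[y_{j_\alpha+1},\dots,y_{i_{\alpha+1}-1}|t_{j_\alpha+1}-t_{j_\alpha},\dots,t_{i_{\alpha+1}-1}-t_{j_\alpha}],$$ summed over $k\ge0$ and $1\le i_1\le j_1<i_2\le j_2<\dots<i_k\le j_k<i_{k+1}=d+1$. **Inversion.** $\mathrm{INV}\colon\overline{\mathbb H}^{\mathrm{symb}}\to\mathbb H^{\mathrm{symb}}$ is the algebra homomorphism fixing $[x_i]_0$ and the regular symbols and given on inverted symbols inductively (for $[y_1,\dots,y_d]$ regular) by $$\mathrm{INV}[y_d^{-1},\dots,y_1^{-1}|-t_d,\dots,-t_1]=\sum_{j=0}^{d-1}(-1)^{d-1+j}\,\mathrm{INV}[y_j^{-1},\dots,y_1^{-1}|-t_j,\dots,-t_1]\,[y_{j+1},\dots,y_d|t_{j+1},\dots,t_d]$$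 $$+\sum_{j=1}^d\tfrac{(-1)^{d-1+j}}{t_j}\mathrm{INV}[y_{j-1}^{-1},\dots,y_1^{-1}|-t_{j-1},\dots,-t_1]\,[y_{j+1},\dots,y_d|t_{j+1},\dots,t_d]$$ $$+\sum_{j=1}^d\tfrac{(-1)^{d+j}}{t_j}\mathrm{INV}[y_{j-1}^{-1},\dots,y_1^{-1}|t_j-t_{j-1},\dots,t_j-t_1]\exp([y_{1\to d+1}]_0t_j)\,[y_{j+1},\dots,y_d|t_{j+1}-t_j,\dots,t_d-t_j].$$ The coproduct on $\mathbb H^{\mathrm{symb}}$ is $\Delta=(\mathrm{INV}\otimes\mathrm{INV})\circ\Delta_{\overline{\mathbb H}}|_{\mathbb H^{\mathrm{symb}}}$; it makes $\mathbb H^{\mathrm{symb}}$ a connected graded commutative Hopf algebra. **Variation matrix.** $\mathbb Z^\infty_{\ge0}$ is the union of all $\mathbb Z^\ell_{\ge0}$ with all zero vectors identified. It is in bijection with the set consisting of $1$ and the regular symbols: $0\leftrightarrow1$ and $(0^{i_1-1},n_1,0^{i_2-i_1-1},n_2,\dots,n_d,0^{i_{d+1}-i_d-1})\leftrightarrow[x_{i_1\to i_2},\dots,x_{i_d\to i_{d+1}}]_{n_1,\dots,n_d}$; a vector is identified with its symbol. The variation matrix $V$ has rows and columns indexed by $\mathbb Z^\infty_{\ge0}$ and entries $V_{v,w}\in\mathbb H^{\mathrm{symb}}$ defined by $\Delta(v)=\sum_{w\in\mathbb Z^\infty_{\ge0}}w\otimes V_{v,w}$ (the left tensor factors in $\Delta(v)$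 are linear combinations of $1$ and regular symbols; the sum is finite). The coproduct of a matrix is entrywise, and the tensor product of matrices is given by the usual formula for matrix multiplication with $\otimes$ in place of products. *)

theory Defs
  imports Complex_Main "HOL-Library.Poly_Mapping" "HOL-Library.Product_Plus"
begin

section \<open>Formal power series in the variables $t_1, t_2, \dots$\<close>

typedef 'a mseries = "UNIV :: ((nat \<Rightarrow>\<^sub>0 nat) \<Rightarrow> 'a) set"
  morphisms coeff MSeries ..

setup_lifting type_definition_mseries

definition splits :: "(nat \<Rightarrow>\<^sub>0 nat) \<Rightarrow> ((nat \<Rightarrow>\<^sub>0 nat) \<times> (nat \<Rightarrow>\<^sub>0 nat)) set" where
  "splits m = {(a, b). a + b = m}"

lemma finite_splits: "finite (splits m)"
proof -
  define F where "F = {f :: nat \<Rightarrow> nat. \<forall>x.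
    (x \<in> Poly_Mapping.keys m \<longrightarrow> f x \<in> {0..Max (Poly_Mapping.lookup m ` Poly_Mapping.keys m)}) \<and>
    (x \<notin> Poly_Mapping.keys m \<longrightarrow> f x = 0)}"
  have fin: "finite F"
    unfolding F_def by (rule finite_set_of_finite_funs) simp_all
  have le: "Poly_Mapping.lookup a \<in> F" if "a + b = m" for a b
  proof -
    have le: "Poly_Mapping.lookup a x \<le> Poly_Mapping.lookup m x" for x
      using that by (metis le_add1 lookup_add)
    moreover have "Poly_Mapping.lookup m x \<le> Max (Poly_Mapping.lookup m ` Poly_Mapping.keys m)"
      if "x \<in> Poly_Mapping.keys m" for x
      using that by simp
    moreover have "Poly_Mapping.lookup a x = 0" if "x \<notin> Poly_Mapping.keys m" for x
      using le[of x] that by (simp add: in_keys_iff)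
    ultimately show ?thesis
      unfolding F_def by (simp add: order_trans[OF le])
  qed
  have "splits m \<subseteq> (\<lambda>(f, g). (Abs_poly_mapping f, Abs_poly_mapping g)) ` (F \<times> F)"
  proof
    fix z assume "z \<in> splits m"
    then obtain a b where z: "z = (a, b)" "a + b = m" by (auto simp: splits_def)
    moreover have "Poly_Mapping.lookup a \<in> F" "Poly_Mapping.lookup b \<in> F"
      using le z(2) by (metis add.commute)+
    ultimately show "z \<in> (\<lambda>(f, g). (Abs_poly_mapping f, Abs_poly_mapping g)) ` (F \<times> F)"
      by (auto intro!: image_eqI[where x = "(Poly_Mapping.lookup a, Poly_Mapping.lookup b)"])
  qed
  then show ?thesis
    by (rule finite_subset) (intro finite_imageI finite_cartesian_product fin)
qed

instantiation mseries :: (comm_ring_1) comm_ring_1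
begin

lift_definition zero_mseries :: "'a mseries" is "\<lambda>_. 0" .
lift_definition one_mseries :: "'a mseries" is "\<lambda>m. if m = 0 then 1 else 0" .
lift_definition plus_mseries :: "'a mseries \<Rightarrow> 'a mseries \<Rightarrow> 'a mseries"
  is "\<lambda>f g m. f m + g m" .
lift_definition minus_mseries :: "'a mseries \<Rightarrow> 'a mseries \<Rightarrow> 'a mseries"
  is "\<lambda>f g m. f m - g m" .
lift_definition uminus_mseries :: "'a mseries \<Rightarrow> 'a mseries"
  is "\<lambda>f m. - f m" .
lift_definition times_mseries :: "'a mseries \<Rightarrow> 'a mseries \<Rightarrow> 'a mseries"
  is "\<lambda>f g m. \<Sum>(a, b) \<in> splits m. f a * g b" .

instance
proof
  fix f g h :: "'a mseries"
  show "f * g * h = f * (g * h)"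
  proof transfer
    fix f g h :: "(nat \<Rightarrow>\<^sub>0 nat) \<Rightarrow> 'a"
    show "(\<lambda>m. \<Sum>(a, b) \<in> splits m. (\<Sum>(c, d) \<in> splits a. f c * g d) * h b) =
          (\<lambda>m. \<Sum>(a, b) \<in> splits m. f a * (\<Sum>(c, d) \<in> splits b. g c * h d))"
    proof
      fix m
      have "(\<Sum>(a, b) \<in> splits m. (\<Sum>(c, d) \<in> splits a. f c * g d) * h b) =
            (\<Sum>ab \<in> splits m. \<Sum>cd \<in> splits (fst ab). f (fst cd) * g (snd cd) * h (snd ab))"
        by (simp add: case_prod_unfold sum_distrib_right)
      also have "\<dots> = (\<Sum>(ab, cd) \<in> Sigma (splits m) (\<lambda>ab. splits (fst ab)). f (fst cd) * g (snd cd) * h (snd ab))"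
        by (rule sum.Sigma) (auto simp: finite_splits)
      also have "\<dots> = (\<Sum>(ab, cd) \<in> Sigma (splits m) (\<lambda>ab. splits (snd ab)). f (fst ab) * (g (fst cd) * h (snd cd)))"
        by (rule sum.reindex_bij_witness[where
              i = "\<lambda>((a, b), (c, d)). ((a + c, d), (a, c))" and
              j = "\<lambda>((a, b), (c, d)). ((c, d + b), (d, b))"])
           (auto simp: splits_def ac_simps)
      also have "\<dots> = (\<Sum>ab \<in> splits m. \<Sum>cd \<in> splits (snd ab). f (fst ab) * (g (fst cd) * h (snd cd)))"
        by (rule sum.Sigma[symmetric]) (auto simp: finite_splits)
      also have "\<dots> = (\<Sum>(a, b) \<in> splits m. f a * (\<Sum>(c, d) \<in> splits b. g c * h d))"
        by (simp add: case_prod_unfold sum_distrib_left)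
      finally show "(\<Sum>(a, b) \<in> splits m. (\<Sum>(c, d) \<in> splits a. f c * g d) * h b) =
          (\<Sum>(a, b) \<in> splits m. f a * (\<Sum>(c, d) \<in> splits b. g c * h d))" .
    qed
  qed
  show "f * g = g * f"
    by transfer
       (auto intro!: ext sum.reindex_bij_witness[where i = prod.swap and j = prod.swap]
             simp: splits_def ac_simps)
  show "1 * f = f"
  proof transfer
    fix f :: "(nat \<Rightarrow>\<^sub>0 nat) \<Rightarrow> 'a"
    show "(\<lambda>m. \<Sum>(a, b) \<in> splits m. (if a = 0 then 1 else 0) * f b) = f"
    proof
      fix m
      have "(\<Sum>(a, b) \<in> splits m. (if a = 0 then 1 else 0) * f b) =
            (\<Sum>(a, b) \<in> {(0 :: nat \<Rightarrow>\<^sub>0 nat, m)}. (if a = 0 then 1 else 0) * f b)"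
        by (intro sum.mono_neutral_right finite_splits) (auto simp: splits_def split: if_splits)
      then show "(\<Sum>(a, b) \<in> splits m. (if a = 0 then 1 else 0) * f b) = f m" by simp
    qed
  qed
  show "(f + g) * h = f * h + g * h"
    by transfer (simp add: case_prod_unfold distrib_right sum.distrib)
  show "(0 :: 'a mseries) \<noteq> 1"
    by transfer (metis zero_neq_one)
qed (transfer; simp add: ac_simps)+

end

lift_definition const_series :: "'a::zero \<Rightarrow> 'a mseries" is "\<lambda>a m. if m = 0 then a else 0" .

lift_definition tvar :: "nat \<Rightarrow> 'a::comm_ring_1 mseries"
  is "\<lambda>i m. if m = Poly_Mapping.single i 1 then 1 else 0" .

definition total_degree :: "(nat \<Rightarrow>\<^sub>0 nat) \<Rightarrow> nat" where
  "total_degree m = (\<Sum>i\<in>Poly_Mapping.keys m. Poly_Mapping.lookup m i)"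

text \<open>The quotient by $t_j$ of a series that is divisible by $t_j$.\<close>

lift_definition divide_t :: "nat \<Rightarrow> 'a mseries \<Rightarrow> 'a mseries"
  is "\<lambda>j f m. f (m + Poly_Mapping.single j 1)" .

lemma tvar_times_divide_t:
  fixes f :: "'a::comm_ring_1 mseries"
  assumes "\<And>m. Poly_Mapping.lookup m j = 0 \<Longrightarrow> coeff f m = 0"
  shows "tvar j * divide_t j f = f"
proof -
  let ?e = "Poly_Mapping.single j (1::nat)"
  have "coeff (tvar j * divide_t j f) m = coeff f m" for m
  proof (cases "Poly_Mapping.lookup m j = 0")
    case True
    have "a \<noteq> ?e" if "a + b = m" for a b
    proof
      assume "a = ?e"
      then have "Poly_Mapping.lookup m j = 1 + Poly_Mapping.lookup b j"
        using that by (auto simp: lookup_add)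
      then show False using True by simp
    qed
    then have "coeff (tvar j * divide_t j f) m = 0"
      by (auto simp: times_mseries.rep_eq tvar.rep_eq splits_def intro!: sum.neutral)
    then show ?thesis using assms[OF True] by simp
  next
    case False
    have m: "?e + (m - ?e) = m"
      using False by (intro poly_mapping_eqI) (auto simp: lookup_add lookup_minus lookup_single when_def)
    have "coeff (tvar j * divide_t j f) m =
        (\<Sum>(a, b)\<in>{(?e, m - ?e)}. coeff (tvar j) a * coeff (divide_t j f) b)"
      unfolding times_mseries.rep_eq
    proof (intro sum.mono_neutral_right finite_splits)
      show "{(?e, m - ?e)} \<subseteq> splits m" using m by (simp add: splits_def)
      have "b = m - ?e" if "?e + b = m" for b
        using that by auto
      then show "\<forall>i\<in>splits m - {(?e, m - ?e)}. (case i of (a, b) \<Rightarrow> coeff (tvar j) a * coeff (divide_t j f) b) = 0"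
        by (auto simp: splits_def tvar.rep_eq split: if_splits)
    qed
    also have "\<dots> = coeff f m"
      using m by (simp add: tvar.rep_eq divide_t.rep_eq add.commute)
    finally show ?thesis .
  qed
  then show ?thesis by (metis coeff_inject ext)
qed

text \<open>
  The series $\sum_{n_1,\dots,n_d \ge 1} c(n_1,\dots,n_d) L_1^{n_1-1}\cdots L_d^{n_d-1}$, where
  $L_1,\dots,L_d$ have no constant term: only the finitely many exponents of total degree at most
  that of \<open>m\<close> contribute to the coefficient of \<open>m\<close>.
\<close>

definition indices_upto :: "nat \<Rightarrow> nat \<Rightarrow> nat list set" where
  "indices_upto d N = {ns. length ns = d \<and> (\<forall>n\<in>set ns. 1 \<le> n) \<and> (\<Sum>n\<leftarrow>ns. n - 1) \<le> N}"

lemma finite_indices_upto: "finite (indices_upto d N)"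
proof -
  have "indices_upto d N \<subseteq> {ns. set ns \<subseteq> {0..Suc N} \<and> length ns = d}"
  proof
    fix ns assume ns: "ns \<in> indices_upto d N"
    have "n \<le> Suc N" if "n \<in> set ns" for n
    proof -
      have "n - 1 \<le> (\<Sum>n\<leftarrow>ns. n - 1)" using that by (intro member_le_sum_list) auto
      then show ?thesis using ns by (auto simp: indices_upto_def)
    qed
    then show "ns \<in> {ns. set ns \<subseteq> {0..Suc N} \<and> length ns = d}"
      using ns by (auto simp: indices_upto_def)
  qed
  then show ?thesis by (rule finite_subset) (rule finite_lists_length_eq, simp)
qed

definition gen_series :: "(nat list \<Rightarrow> 'a::comm_ring_1) \<Rightarrow> 'a mseries list \<Rightarrow> 'a mseries" where
  "gen_series c Ls = MSeries (\<lambda>m. \<Sum>ns\<in>indices_upto (length Ls) (total_degree m).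
     coeff (const_series (c ns) * (\<Prod>(L, n)\<leftarrow>zip Ls ns. L ^ (n - 1))) m)"

text \<open>The exponent of $t_1^{n_1-1}\cdots t_d^{n_d-1}$.\<close>

definition t_exponent :: "nat list \<Rightarrow> (nat \<Rightarrow>\<^sub>0 nat)" where
  "t_exponent ns = (\<Sum>i<length ns. Poly_Mapping.single (Suc i) (ns ! i - 1))"


section \<open>Polynomial algebras over the rationals and their tensor products\<close>

definition scalar :: "rat \<Rightarrow> ('m::zero \<Rightarrow>\<^sub>0 rat)" where
  "scalar c = Poly_Mapping.single 0 c"

text \<open>$\exp(aL)$ for a series \<open>L\<close> without constant term.\<close>

definition exp_series ::
  "('m::comm_monoid_add \<Rightarrow>\<^sub>0 rat) \<Rightarrow> ('m \<Rightarrow>\<^sub>0 rat) mseries \<Rightarrow> ('m \<Rightarrow>\<^sub>0 rat) mseries" where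
  "exp_series a L = MSeries (\<lambda>m. \<Sum>n\<le>total_degree m.
     coeff (const_series (scalar (1 / fact n) * a ^ n) * L ^ n) m)"

text \<open>
  \<open>('g \<Rightarrow>\<^sub>0 nat) \<Rightarrow>\<^sub>0 rat\<close> is the free commutative algebra on \<open>'g\<close>. The tensor product of the spaces
  with bases \<open>'m\<close> and \<open>'n\<close> is the space with basis \<open>'m \<times> 'n\<close>.
\<close>

definition tensor :: "('m \<Rightarrow>\<^sub>0 rat) \<Rightarrow> ('n \<Rightarrow>\<^sub>0 rat) \<Rightarrow> ('m \<times> 'n \<Rightarrow>\<^sub>0 rat)" (infixr \<open>\<otimes>\<close> 68) where
  "a \<otimes> b = (\<Sum>m\<in>Poly_Mapping.keys a. \<Sum>n\<in>Poly_Mapping.keys b. Poly_Mapping.single (m, n) (Poly_Mapping.lookup a m * Poly_Mapping.lookup b n))"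

definition tensor_map ::
  "(('m \<Rightarrow>\<^sub>0 rat) \<Rightarrow> ('k::comm_monoid_add \<Rightarrow>\<^sub>0 rat)) \<Rightarrow> (('n \<Rightarrow>\<^sub>0 rat) \<Rightarrow> ('l::comm_monoid_add \<Rightarrow>\<^sub>0 rat)) \<Rightarrow>
   ('m \<times> 'n \<Rightarrow>\<^sub>0 rat) \<Rightarrow> ('k \<times> 'l \<Rightarrow>\<^sub>0 rat)" where
  "tensor_map f g T = (\<Sum>(m, n)\<in>Poly_Mapping.keys T.
     scalar (Poly_Mapping.lookup T (m, n)) * (f (Poly_Mapping.single m 1) \<otimes> g (Poly_Mapping.single n 1)))"

definition tensor_series ::
  "('m \<Rightarrow>\<^sub>0 rat) mseries \<Rightarrow> ('n \<Rightarrow>\<^sub>0 rat) mseries \<Rightarrow> ('m \<times> 'n \<Rightarrow>\<^sub>0 rat) mseries" where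
  "tensor_series f g = MSeries (\<lambda>m. \<Sum>(a, b)\<in>splits m. coeff f a \<otimes> coeff g b)"

lemma lookup_tensor:
  "Poly_Mapping.lookup (a \<otimes> b) (m, n) = Poly_Mapping.lookup a m * Poly_Mapping.lookup b n"
proof -
  have "Poly_Mapping.lookup (a \<otimes> b) (m, n) =
     (\<Sum>m'\<in>Poly_Mapping.keys a. \<Sum>n'\<in>Poly_Mapping.keys b.
        (if m' = m then if n' = n then Poly_Mapping.lookup a m * Poly_Mapping.lookup b n else 0 else 0))"
    unfolding tensor_def lookup_sum
    by (intro sum.cong refl) (auto simp: lookup_single when_def)
  also have "\<dots> = (\<Sum>m'\<in>Poly_Mapping.keys a. if m' = m then \<Sum>n'\<in>Poly_Mapping.keys b.
         if n' = n then Poly_Mapping.lookup a m * Poly_Mapping.lookup b n else 0 else 0)"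
    by (intro sum.cong refl) auto
  also have "\<dots> = Poly_Mapping.lookup a m * Poly_Mapping.lookup b n"
    by (auto simp: sum.delta in_keys_iff)
  finally show ?thesis .
qed

lemma keys_tensor: "Poly_Mapping.keys (a \<otimes> b) \<subseteq> Poly_Mapping.keys a \<times> Poly_Mapping.keys b"
  by (auto simp: in_keys_iff lookup_tensor)

text \<open>The algebra homomorphism with prescribed values on the generators.\<close>

definition alg_hom ::
  "('g \<Rightarrow> ('m::comm_monoid_add \<Rightarrow>\<^sub>0 rat)) \<Rightarrow> (('g \<Rightarrow>\<^sub>0 nat) \<Rightarrow>\<^sub>0 rat) \<Rightarrow> ('m \<Rightarrow>\<^sub>0 rat)" where
  "alg_hom \<phi> a = (\<Sum>m\<in>Poly_Mapping.keys a. scalar (Poly_Mapping.lookup a m) * (\<Prod>g\<in>Poly_Mapping.keys m. \<phi> g ^ Poly_Mapping.lookup m g))"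


section \<open>The algebra of formal symbols\<close>

text \<open>
  Write $x_{a\to b} = x_{b\to a}^{-1}$ for $a > b$. Then regular and inverted symbols alike have the
  form $[x_{p_1\to p_2},\dots,x_{p_d\to p_{d+1}}]_{n_1,\dots,n_d}$, the sequence $p$ being strictly
  increasing for the regular and strictly decreasing for the inverted ones. This symbol is
  \<open>Symbol [p\<^sub>1, \<dots>, p\<^sub>d\<^sub>+\<^sub>1] [n\<^sub>1, \<dots>, n\<^sub>d]\<close>. Its arguments satisfy $y_{i\to j} = x_{p_i\to p_j}$ and
  $y_r^{-1} = x_{p_{r+1}\to p_r}$.
\<close>

datatype raw_generator = Log0 nat | Symbol "nat list" "nat list"

definition increasing :: "nat list \<Rightarrow> bool" where
  "increasing p \<longleftrightarrow> sorted_wrt (<) p"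

definition decreasing :: "nat list \<Rightarrow> bool" where
  "decreasing p \<longleftrightarrow> sorted_wrt (>) p"

fun valid_generator :: "raw_generator \<Rightarrow> bool" where
  "valid_generator (Log0 i) \<longleftrightarrow> 1 \<le> i"
| "valid_generator (Symbol p ns) \<longleftrightarrow>
     ns \<noteq> [] \<and> length p = length ns + 1 \<and> (\<forall>n\<in>set ns. 1 \<le> n) \<and> (\<forall>i\<in>set p. 1 \<le> i) \<and>
     (increasing p \<or> decreasing p)"

typedef generator = "{g. valid_generator g}"
  by (rule exI[of _ "Log0 1"]) simp

type_synonym monomial = "generator \<Rightarrow>\<^sub>0 nat"
type_synonym hbar = "monomial \<Rightarrow>\<^sub>0 rat"
type_synonym hbar2 = "monomial \<times> monomial \<Rightarrow>\<^sub>0 rat"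

definition gen :: "generator \<Rightarrow> hbar" where
  "gen g = Poly_Mapping.single (Poly_Mapping.single g 1) 1"

definition symbol_monomial :: "nat list \<Rightarrow> nat list \<Rightarrow> monomial" where
  "symbol_monomial p ns =
     (if ns = [] then 0 else Poly_Mapping.single (Abs_generator (Symbol p ns)) 1)"

definition symbol :: "nat list \<Rightarrow> nat list \<Rightarrow> hbar" where
  "symbol p ns = Poly_Mapping.single (symbol_monomial p ns) 1"

text \<open>$[x_{a\to b}]_0$\<close>

definition log0 :: "nat \<Rightarrow> nat \<Rightarrow> hbar" where
  "log0 a b = (if a \<le> b then \<Sum>r\<in>{a..<b}. gen (Abs_generator (Log0 r))
               else - (\<Sum>r\<in>{b..<a}. gen (Abs_generator (Log0 r))))"

text \<open>The subalgebra generated by the $[x_i]_0$ and the regular symbols.\<close>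

definition regular_generator :: "generator \<Rightarrow> bool" where
  "regular_generator g \<longleftrightarrow> (case Rep_generator g of Log0 i \<Rightarrow> True | Symbol p ns \<Rightarrow> increasing p)"

definition Hsymb :: "hbar set" where
  "Hsymb = {a. \<forall>m\<in>Poly_Mapping.keys a. \<forall>g\<in>Poly_Mapping.keys m. regular_generator g}"


section \<open>The coproduct on the algebra of all symbols\<close>

text \<open>
  The pairs of sequences $(i_1,\dots,i_k)$, $(j_1,\dots,j_k)$ with
  $1\le i_1\le j_1<i_2\le\dots<i_k\le j_k<i_{k+1}=d+1$.
\<close>

definition chains :: "nat \<Rightarrow> (nat list \<times> nat list) set" where
  "chains d = {(is, js). length js = length is \<and>
     (\<forall>\<alpha><length is. 1 \<le> is ! \<alpha> \<and> is ! \<alpha> \<le> js ! \<alpha> \<and> js ! \<alpha> < (is @ [d + 1]) ! Suc \<alpha>)}"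

lemma finite_chains: "finite (chains d)"
proof -
  have *: "set is \<subseteq> {0..d} \<and> set js \<subseteq> {0..d} \<and> length is \<le> d \<and> length js \<le> d"
    if "(is, js) \<in> chains d" for "is" js
  proof -
    have len: "length js = length is" and
      1: "1 \<le> is ! a" and 2: "is ! a \<le> js ! a" and 3: "js ! a < (is @ [d + 1]) ! Suc a"
      if "a < length is" for a
      using \<open>(is, js) \<in> chains d\<close> that by (auto simp: chains_def)
    have len: "length js = length is"
      using \<open>(is, js) \<in> chains d\<close> by (auto simp: chains_def)
    have up: "js ! a + (length is - a) \<le> d + 1 \<and> js ! a \<le> d" if "a < length is" for a
      using that
    proof (induction "length is - a" arbitrary: a)
      case (Suc k)
      show ?case
      proof (cases "Suc a < length is")
        case True
        have "js ! Suc a + (length is - Suc a) \<le> d + 1 \<and> js ! Suc a \<le> d"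
          using Suc True by auto
        moreover have "js ! a < is ! Suc a" using 3[OF Suc.prems] True by (simp add: nth_append)
        moreover have "is ! Suc a \<le> js ! Suc a" using 2[OF True] .
        ultimately show ?thesis using Suc.prems by auto
      next
        case False
        then have "Suc a = length is" using Suc.prems by simp
        moreover have "js ! a < d + 1" using 3[OF Suc.prems] \<open>Suc a = length is\<close> by (simp add: nth_append)
        ultimately show ?thesis by auto
      qed
    qed simp
    have "is ! a \<le> d \<and> js ! a \<le> d" if "a < length is" for a
      using up[OF that] 2[OF that] by auto
    then have "set is \<subseteq> {0..d}" "set js \<subseteq> {0..d}"
      using len by (auto simp: in_set_conv_nth)
    moreover have "length is \<le> d"
    proof (cases "is = []")
      case False
      then show ?thesis using up[of 0] 1[of 0] 2[of 0] by auto
    qed simp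
    ultimately show ?thesis using len by simp
  qed
  have "chains d \<subseteq> {xs. set xs \<subseteq> {0..d} \<and> length xs \<le> d} \<times> {xs. set xs \<subseteq> {0..d} \<and> length xs \<le> d}"
    using * by auto
  then show ?thesis
    by (rule finite_subset) (intro finite_cartesian_product finite_lists_length_le finite_atLeastAtMost)
qed

text \<open>
  $\Delta[y_1,\dots,y_d|t_1,\dots,t_d]$ for the arguments encoded by $p_1,\dots,p_{d+1}$. The list
  \<open>[p\<^sub>a, \<dots>, p\<^sub>b]\<close> encodes $y_a,\dots,y_{b-1}$, and its reverse encodes $y_{b-1}^{-1},\dots,y_a^{-1}$.
\<close>

definition coproduct_bar_series :: "nat list \<Rightarrow> hbar2 mseries" where
  "coproduct_bar_series ps = (let
     d = length ps - 1;
     p = (\<lambda>i. ps ! (i - 1)) in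
     \<Sum>(is, js)\<in>chains d. (let i = (\<lambda>\<alpha>. (is @ [d + 1]) ! (\<alpha> - 1)); j = (\<lambda>\<alpha>. js ! (\<alpha> - 1)) in
       tensor_series
         (gen_series (symbol (map p (is @ [d + 1]))) (map tvar js))
         (gen_series (symbol (map p [1..<i 1 + 1])) (map tvar [1..<i 1]) *
          (\<Prod>\<alpha> = 1..length is.
             (- 1) ^ (j \<alpha> - i \<alpha>) *
             exp_series (log0 (p (i \<alpha>)) (p (i (\<alpha> + 1)))) (tvar (j \<alpha>)) *
             gen_series (symbol (map p (rev [i \<alpha>..<j \<alpha> + 1])))
               (map (\<lambda>r. tvar (j \<alpha>) - tvar r) (rev [i \<alpha>..<j \<alpha>])) *
             gen_series (symbol (map p [j \<alpha> + 1..<i (\<alpha> + 1) + 1]))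
               (map (\<lambda>r. tvar r - tvar (j \<alpha>)) [j \<alpha> + 1..<i (\<alpha> + 1)])))))"

definition coproduct_bar :: "hbar \<Rightarrow> hbar2" where
  "coproduct_bar = alg_hom (\<lambda>g. case Rep_generator g of
       Log0 i \<Rightarrow> gen g \<otimes> 1 + 1 \<otimes> gen g
     | Symbol ps ns \<Rightarrow> coeff (coproduct_bar_series ps) (t_exponent ns))"


section \<open>Inversion\<close>

definition agree_at_0 :: "nat \<Rightarrow> 'a mseries \<Rightarrow> 'a mseries \<Rightarrow> bool" where
  "agree_at_0 j f g \<longleftrightarrow> (\<forall>m. Poly_Mapping.lookup m j = 0 \<longrightarrow> coeff f m = coeff g m)"

lemma agree_refl: "agree_at_0 j f f"
  by (simp add: agree_at_0_def)

lemma agree_times: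
  fixes f g :: "'a::comm_ring_1 mseries"
  assumes "agree_at_0 j f f'" "agree_at_0 j g g'" shows "agree_at_0 j (f * g) (f' * g')"
  using assms unfolding agree_at_0_def times_mseries.rep_eq
  by (auto simp: splits_def lookup_add intro!: sum.cong)

lemma agree_power:
  fixes f :: "'a::comm_ring_1 mseries"
  shows "agree_at_0 j f f' \<Longrightarrow> agree_at_0 j (f ^ n) (f' ^ n)"
  by (induction n) (auto intro: agree_times agree_refl)

lemma agree_tvar: "agree_at_0 j (tvar j) (0 :: 'a::comm_ring_1 mseries)"
  by (auto simp: agree_at_0_def tvar.rep_eq zero_mseries.rep_eq)

lemma agree_gen_series:
  fixes F G :: "nat \<Rightarrow> 'a::comm_ring_1 mseries"
  assumes "\<And>r. agree_at_0 j (F r) (G r)"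
  shows "agree_at_0 j (gen_series c (map F rs)) (gen_series c (map G rs))"
proof -
  have "agree_at_0 j (\<Prod>(L, n)\<leftarrow>zip (map F rs) ns. L ^ (n - 1)) (\<Prod>(L, n)\<leftarrow>zip (map G rs) ns. L ^ (n - 1))" for ns
  proof (induction rs arbitrary: ns)
    case (Cons r rs)
    then show ?case
      by (cases ns) (auto intro!: agree_times agree_power assms agree_refl)
  qed (simp add: agree_refl)
  then have "agree_at_0 j (const_series (c ns) * (\<Prod>(L, n)\<leftarrow>zip (map F rs) ns. L ^ (n - 1)))
      (const_series (c ns) * (\<Prod>(L, n)\<leftarrow>zip (map G rs) ns. L ^ (n - 1)))" for ns
    by (intro agree_times agree_refl)
  then show ?thesis
    unfolding agree_at_0_def gen_series_def by (simp add: MSeries_inverse)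
qed

lemma agree_exp_series:
  fixes a :: "'m::comm_monoid_add \<Rightarrow>\<^sub>0 rat"
  shows "agree_at_0 j (exp_series a (tvar j)) 1"
proof -
  have "agree_at_0 j (const_series (scalar (1 / fact n) * a ^ n) * tvar j ^ n) (if n = 0 then 1 else 0)" for n
  proof (cases "n = 0")
    case True
    have "const_series (scalar 1 :: 'm \<Rightarrow>\<^sub>0 rat) = 1"
      by (simp add: scalar_def const_series_def one_mseries_def id_def)
    then show ?thesis using True by (simp add: agree_refl)
  next
    case False
    have "agree_at_0 j (const_series (scalar (1 / fact n) * a ^ n) * tvar j ^ n)
        (const_series (scalar (1 / fact n) * a ^ n) * 0 ^ n)"
      by (intro agree_times agree_power agree_refl agree_tvar)
    then show ?thesis using False by (simp add: power_0_left)
  qed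
  moreover have "coeff (if n = 0 then 1 else 0 :: ('m \<Rightarrow>\<^sub>0 rat) mseries) m = (if n = 0 then coeff 1 m else 0)"
    for n :: nat and m
    by (simp add: zero_mseries.rep_eq)
  ultimately have "coeff (exp_series a (tvar j)) m = (\<Sum>n\<le>total_degree m. if n = 0 then coeff 1 m else 0)"
    if "Poly_Mapping.lookup m j = 0" for m
    using that unfolding agree_at_0_def exp_series_def
    by (simp add: MSeries_inverse)
  then show ?thesis by (simp add: agree_at_0_def)
qed

lemma inv_symbol_quotient:
  fixes c c' :: "nat list \<Rightarrow> hbar" and a :: hbar and j :: nat and rs rs' :: "nat list"
  defines "f \<equiv> gen_series c (map (\<lambda>r. - tvar r) rs) * gen_series c' (map tvar rs')
    - gen_series c (map (\<lambda>r. tvar j - tvar r) rs) * exp_series a (tvar j) *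
      gen_series c' (map (\<lambda>r. tvar r - tvar j) rs')"
  shows "tvar j * divide_t j f = f"
proof (rule tvar_times_divide_t)
  have "agree_at_0 j (- tvar r) (tvar j - tvar r :: hbar mseries)"
    "agree_at_0 j (tvar r) (tvar r - tvar j :: hbar mseries)" for r
    using agree_tvar[of j, where 'a = hbar]
    by (auto simp: agree_at_0_def minus_mseries.rep_eq uminus_mseries.rep_eq zero_mseries.rep_eq)
  then have "agree_at_0 j (gen_series c (map (\<lambda>r. - tvar r) rs) * 1 * gen_series c' (map tvar rs'))
    (gen_series c (map (\<lambda>r. tvar j - tvar r) rs) * exp_series a (tvar j) *
      gen_series c' (map (\<lambda>r. tvar r - tvar j) rs'))"
    using agree_exp_series[of j a]
    by (intro agree_times agree_gen_series) (auto simp: agree_at_0_def)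
  then show "coeff f m = 0" if "Poly_Mapping.lookup m j = 0" for m
    using that by (simp add: f_def agree_at_0_def minus_mseries.rep_eq)
qed

text \<open>
  Let $p_1<\dots<p_{d+1}$ encode the regular arguments $y_1,\dots,y_d$. Then
  \<open>inv_symbol ps ns\<close> is $\mathrm{INV}[y_d^{-1},\dots,y_1^{-1}]_{ns}$. The right-hand side of the
  inductive formula is the series of these in $-t_d,\dots,-t_1$, whence the sign and the reversal
  in the extraction of the coefficient. The two sums with denominators $t_j$ are taken together,
  since it is the difference of their $j$-th terms that is divisible by $t_j$, as is shown in
  \<open>inv_symbol_quotient\<close>.
\<close>

function inv_symbol :: "nat list \<Rightarrow> nat list \<Rightarrow> hbar" where
  "inv_symbol ps = (if length ps \<le> 1 then (\<lambda>ns. 1) else (let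
     d = length ps - 1;
     R = (\<Sum>j\<in>{0..d - 1}. (- 1) ^ (d - 1 + j) *
            gen_series (inv_symbol (take (j + 1) ps)) (map (\<lambda>r. - tvar r) (rev [1..<j + 1])) *
            gen_series (symbol (drop j ps)) (map tvar [j + 1..<d + 1])) +
         (\<Sum>j\<in>{1..d}. (- 1) ^ (d - 1 + j) * divide_t j
            (gen_series (inv_symbol (take j ps)) (map (\<lambda>r. - tvar r) (rev [1..<j])) *
             gen_series (symbol (drop j ps)) (map tvar [j + 1..<d + 1])
             - gen_series (inv_symbol (take j ps)) (map (\<lambda>r. tvar j - tvar r) (rev [1..<j])) *
               exp_series (log0 (hd ps) (last ps)) (tvar j) *
               gen_series (symbol (drop j ps)) (map (\<lambda>r. tvar r - tvar j) [j + 1..<d + 1])))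
     in (\<lambda>ns. (- 1) ^ (\<Sum>n\<leftarrow>ns. n - 1) * coeff R (t_exponent (rev ns)))))"
  by auto
termination by (relation "measure length") auto

declare inv_symbol.simps [simp del]

definition INV :: "hbar \<Rightarrow> hbar" where
  "INV = alg_hom (\<lambda>g. case Rep_generator g of
       Log0 i \<Rightarrow> gen g
     | Symbol ps ns \<Rightarrow> if increasing ps then gen g else inv_symbol (rev ps) ns)"

text \<open>Restricted to \<^const>\<open>Hsymb\<close>, this is the coproduct of that algebra.\<close>

definition coproduct :: "hbar \<Rightarrow> hbar2" where
  "coproduct a = tensor_map INV INV (coproduct_bar a)"


section \<open>The variation matrix\<close>

definition same_index :: "nat list \<Rightarrow> nat list \<Rightarrow> bool" where
  "same_index v w \<longleftrightarrow> v = w \<or> ((\<forall>n\<in>set v. n = 0) \<and> (\<forall>n\<in>set w. n = 0))"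

quotient_type vindex = "nat list" / same_index
  by (auto intro!: equivpI reflpI sympI transpI simp: same_index_def)

text \<open>The positions, counted from 1, of the nonzero entries.\<close>

definition support_positions :: "nat list \<Rightarrow> nat list" where
  "support_positions v = map Suc (filter (\<lambda>i. v ! i \<noteq> 0) [0..<length v])"

lift_definition index_monomial :: "vindex \<Rightarrow> monomial"
  is "\<lambda>v. symbol_monomial (support_positions v @ [length v + 1]) (filter (\<lambda>n. n \<noteq> 0) v)"
  by (auto simp: same_index_def symbol_monomial_def filter_empty_conv)

definition index_symbol :: "vindex \<Rightarrow> hbar" where
  "index_symbol v = Poly_Mapping.single (index_monomial v) 1"

text \<open>$V_{v,w}$ is the right tensor factor of \<open>w\<close> in the coproduct of \<open>v\<close>.\<close>

definition variation_matrix :: "vindex \<Rightarrow> vindex \<Rightarrow> hbar" where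
  "variation_matrix v w = Poly_Mapping.map_key (Pair (index_monomial w)) (coproduct (index_symbol v))"

lemma valid_index_generator:
  assumes "filter (\<lambda>n. n \<noteq> 0) v \<noteq> []"
  shows "valid_generator (Symbol (support_positions v @ [length v + 1]) (filter (\<lambda>n. n \<noteq> 0) v))"
proof -
  have "length (filter (\<lambda>i. v ! i \<noteq> 0) [0..<length v]) = length (filter (\<lambda>n. n \<noteq> 0) v)"
    by (metis (no_types, lifting) filter_map length_map map_nth comp_apply filter_cong)
  moreover have "increasing (support_positions v @ [length v + 1])"
    unfolding increasing_def support_positions_def
    by (auto simp: sorted_wrt_append sorted_wrt_map intro!: sorted_wrt_filter)
  ultimately show ?thesis
    using assms by (auto simp: support_positions_def)
qed

lemma filter_support:
  "filter (\<lambda>n. n \<noteq> 0) v = map (\<lambda>i. v ! (i - 1)) (support_positions v)"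
proof -
  have "filter (\<lambda>n. n \<noteq> 0) v = filter (\<lambda>n. n \<noteq> 0) (map (\<lambda>i. v ! i) [0..<length v])"
    by (simp add: map_nth)
  then show ?thesis by (simp add: filter_map support_positions_def o_def)
qed

lemma inj_index_monomial: "inj index_monomial"
proof
  fix v w :: vindex
  assume "index_monomial v = index_monomial w"
  then show "v = w"
  proof transfer
    fix v w :: "nat list"
    let ?nz = "filter (\<lambda>n. n \<noteq> (0::nat))"
    let ?p = "\<lambda>v. support_positions v @ [length v + 1]"
    assume eq: "symbol_monomial (?p v) (?nz v) = symbol_monomial (?p w) (?nz w)"
    show "same_index v w"
    proof (cases "?nz v = [] \<or> ?nz w = []")
      case True
      then have "?nz v = [] \<and> ?nz w = []"
        using eq by (auto simp: symbol_monomial_def split: if_splits simp del: filter_empty_conv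
            dest: arg_cong[where f = Poly_Mapping.keys])
      then show ?thesis by (auto simp: same_index_def filter_empty_conv)
    next
      case False
      then have "Abs_generator (Symbol (?p v) (?nz v)) = Abs_generator (Symbol (?p w) (?nz w))"
        using eq by (auto simp: symbol_monomial_def simp del: filter_empty_conv
            dest: arg_cong[where f = Poly_Mapping.keys])
      moreover have "valid_generator (Symbol (?p v) (?nz v))" "valid_generator (Symbol (?p w) (?nz w))"
        using False valid_index_generator by blast+
      ultimately have "Symbol (?p v) (?nz v) = Symbol (?p w) (?nz w)"
        using Abs_generator_inject by blast
      then have len: "length v = length w" and sup: "support_positions v = support_positions w"
        and nz: "?nz v = ?nz w" by auto
      have "v ! i = w ! i" if "i < length v" for i
      proof (cases "Suc i \<in> set (support_positions v)")
        case True
        then show ?thesis using nz sup unfolding filter_support by auto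
      next
        case False
        then have "Suc i \<notin> set (support_positions w)" using sup by simp
        then show ?thesis using that len False
          by (auto simp: support_positions_def image_iff)
      qed
      then show ?thesis using len by (simp add: same_index_def nth_equalityI)
    qed
  qed
qed

lemma finite_variation_matrix_row: "finite {w. variation_matrix v w \<noteq> 0}"
proof (rule finite_imageD)
  have "index_monomial w \<in> fst ` Poly_Mapping.keys (coproduct (index_symbol v))"
    if "variation_matrix v w \<noteq> 0" for w
  proof -
    from that obtain n where "Poly_Mapping.lookup (variation_matrix v w) n \<noteq> 0"
      by (metis lookup_zero poly_mapping_eqI)
    then show ?thesis
      by (auto simp: variation_matrix_def map_key.rep_eq inj_on_def in_keys_iff image_iff
          intro!: bexI[of _ "(index_monomial w, n)"])
  qed
  then show "finite (index_monomial ` {w. variation_matrix v w \<noteq> 0})"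
    by (intro finite_subset[OF _ finite_imageI[OF finite_keys]]) auto
  show "inj_on index_monomial {w. variation_matrix v w \<noteq> 0}"
    using inj_index_monomial by (rule inj_on_subset) simp
qed

text \<open>
  The next lemmas show that the entries lie in \<^const>\<open>Hsymb\<close> and satisfy
  $\Delta(v) = \sum_w w \otimes V_{v,w}$, where the sum is finite.
\<close>

definition closed_subring :: "'a::comm_ring_1 set \<Rightarrow> bool" where
  "closed_subring S \<longleftrightarrow> 0 \<in> S \<and> 1 \<in> S \<and> (\<forall>a\<in>S. - a \<in> S) \<and>
     (\<forall>a\<in>S. \<forall>b\<in>S. a + b \<in> S) \<and> (\<forall>a\<in>S. \<forall>b\<in>S. a * b \<in> S)"

lemma closed_subring_sum: "closed_subring S \<Longrightarrow> (\<And>x. x \<in> A \<Longrightarrow> f x \<in> S) \<Longrightarrow> sum f A \<in> S"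
  by (induction A rule: infinite_finite_induct) (auto simp: closed_subring_def)

lemma closed_subring_prod: "closed_subring S \<Longrightarrow> (\<And>x. x \<in> A \<Longrightarrow> f x \<in> S) \<Longrightarrow> prod f A \<in> S"
  by (induction A rule: infinite_finite_induct) (auto simp: closed_subring_def)

lemma closed_subring_prod_list: "closed_subring S \<Longrightarrow> set xs \<subseteq> S \<Longrightarrow> prod_list xs \<in> S"
  by (induction xs) (auto simp: closed_subring_def)

lemma closed_subring_power: "closed_subring S \<Longrightarrow> a \<in> S \<Longrightarrow> a ^ n \<in> S"
  by (induction n) (auto simp: closed_subring_def)

lemma closed_subring_minus: "closed_subring S \<Longrightarrow> a \<in> S \<Longrightarrow> b \<in> S \<Longrightarrow> a - b \<in> S"
  unfolding closed_subring_def by (metis diff_conv_add_uminus)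

lemma closed_subring_times: "closed_subring S \<Longrightarrow> a \<in> S \<Longrightarrow> b \<in> S \<Longrightarrow> a * b \<in> S"
  and closed_subring_plus: "closed_subring S \<Longrightarrow> a \<in> S \<Longrightarrow> b \<in> S \<Longrightarrow> a + b \<in> S"
  and closed_subring_uminus: "closed_subring S \<Longrightarrow> a \<in> S \<Longrightarrow> - a \<in> S"
  and closed_subring_0: "closed_subring S \<Longrightarrow> 0 \<in> S"
  and closed_subring_1: "closed_subring S \<Longrightarrow> 1 \<in> S"
  unfolding closed_subring_def by auto

definition series_over :: "'a::comm_ring_1 set \<Rightarrow> 'a mseries set" where
  "series_over S = {f. \<forall>m. coeff f m \<in> S}"

lemma closed_subring_series:
  assumes "closed_subring S" shows "closed_subring (series_over S)"
proof -
  have "f * g \<in> series_over S" if "f \<in> series_over S" "g \<in> series_over S" for f g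
    using that assms
    by (auto simp: series_over_def times_mseries.rep_eq case_prod_unfold
        intro!: closed_subring_sum closed_subring_times)
  then show ?thesis using assms unfolding closed_subring_def
    by (auto simp: series_over_def zero_mseries.rep_eq one_mseries.rep_eq
        uminus_mseries.rep_eq plus_mseries.rep_eq)
qed

lemma tvar_series_over: "closed_subring S \<Longrightarrow> tvar i \<in> series_over S"
  by (auto simp: series_over_def tvar.rep_eq closed_subring_def)

lemma const_series_over: "closed_subring S \<Longrightarrow> a \<in> S \<Longrightarrow> const_series a \<in> series_over S"
  by (auto simp: series_over_def const_series.rep_eq closed_subring_def)

lemma gen_series_over:
  assumes S: "closed_subring S" and L: "set Ls \<subseteq> series_over S"
    and c: "\<And>ns. length ns = length Ls \<Longrightarrow> \<forall>n\<in>set ns. 1 \<le> n \<Longrightarrow> c ns \<in> S"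
  shows "gen_series c Ls \<in> series_over S"
proof -
  have "(\<Prod>(L, n)\<leftarrow>zip Ls ns. L ^ (n - 1)) \<in> series_over S" for ns
    using L by (intro closed_subring_prod_list closed_subring_series S)
       (auto intro!: closed_subring_power closed_subring_series S dest: set_zip_leftD)
  then have "const_series (c ns) * (\<Prod>(L, n)\<leftarrow>zip Ls ns. L ^ (n - 1)) \<in> series_over S"
    if "ns \<in> indices_upto (length Ls) N" for ns N
    using that c
    by (intro closed_subring_times closed_subring_series const_series_over S) (auto simp: indices_upto_def)
  then show ?thesis
    unfolding gen_series_def series_over_def
    by (auto simp: MSeries_inverse intro!: closed_subring_sum S)
qed

lemma exp_series_over:
  assumes S: "closed_subring S" and "\<And>c. scalar c \<in> S" "a \<in> S" "L \<in> series_over S"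
  shows "exp_series a L \<in> series_over S"
proof -
  have "const_series (scalar (1 / fact n) * a ^ n) * L ^ n \<in> series_over S" for n
    using assms by (intro closed_subring_times closed_subring_power closed_subring_series const_series_over)
  then show ?thesis
    unfolding exp_series_def series_over_def
    by (auto simp: MSeries_inverse intro!: closed_subring_sum S)
qed

lemma divide_t_over: "f \<in> series_over S \<Longrightarrow> divide_t j f \<in> series_over S"
  by (simp add: series_over_def divide_t.rep_eq)

lemma closed_subring_Hsymb: "closed_subring Hsymb"
proof -
  have "a * b \<in> Hsymb" if "a \<in> Hsymb" "b \<in> Hsymb" for a b
    unfolding Hsymb_def
  proof (clarify)
    fix m g assume "m \<in> Poly_Mapping.keys (a * b)" "g \<in> Poly_Mapping.keys m"
    then obtain m1 m2 where "m1 \<in> Poly_Mapping.keys a" "m2 \<in> Poly_Mapping.keys b" "m = m1 + m2"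
      using keys_mult[of a b] by blast
    moreover from this have "g \<in> Poly_Mapping.keys m1 \<union> Poly_Mapping.keys m2"
      using \<open>g \<in> _\<close> Poly_Mapping.keys_add[of m1 m2] by blast
    ultimately show "regular_generator g" using that by (auto simp: Hsymb_def)
  qed
  moreover have "a + b \<in> Hsymb" if "a \<in> Hsymb" "b \<in> Hsymb" for a b
    using that Poly_Mapping.keys_add[of a b] by (auto simp: Hsymb_def)
  moreover have "- a \<in> Hsymb" if "a \<in> Hsymb" for a
    using that by (auto simp: Hsymb_def in_keys_iff)
  moreover have "0 \<in> Hsymb" "1 \<in> Hsymb" by (simp_all add: Hsymb_def)
  ultimately show ?thesis
    unfolding closed_subring_def by blast
qed

lemma scalar_Hsymb: "scalar c \<in> Hsymb"
  by (simp add: scalar_def Hsymb_def)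

lemma gen_Hsymb: "regular_generator g \<Longrightarrow> gen g \<in> Hsymb"
  by (simp add: gen_def Hsymb_def)

lemma symbol_Hsymb:
  assumes "increasing p" "length p = length ns + 1" "\<forall>n\<in>set ns. 1 \<le> n" "\<forall>i\<in>set p. 1 \<le> i"
  shows "symbol p ns \<in> Hsymb"
  using assms by (auto simp: symbol_def symbol_monomial_def Hsymb_def regular_generator_def Abs_generator_inverse)

lemma log0_Hsymb:
  assumes "1 \<le> a" "1 \<le> b" shows "log0 a b \<in> Hsymb"
proof -
  have "gen (Abs_generator (Log0 r)) \<in> Hsymb" if "1 \<le> r" for r
    using that by (intro gen_Hsymb) (simp add: regular_generator_def Abs_generator_inverse)
  then show ?thesis
    using assms unfolding log0_def
    by (auto intro!: closed_subring_sum closed_subring_uminus closed_subring_Hsymb)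
qed

lemma inv_symbol_Hsymb:
  assumes "increasing ps" "\<forall>i\<in>set ps. 1 \<le> i"
  shows "inv_symbol ps ns \<in> Hsymb"
  using assms
proof (induction ps arbitrary: ns rule: measure_induct_rule[of length])
  case (less ps)
  let ?S = "series_over Hsymb"
  note [simp] = closed_subring_Hsymb closed_subring_series[OF closed_subring_Hsymb]
  show ?case
  proof (cases "length ps \<le> 1")
    case True
    then show ?thesis by (subst inv_symbol.simps) (simp add: closed_subring_1)
  next
    case False
    define d where "d = length ps - 1"
    have inc: "increasing (take j ps)" "increasing (drop j ps)" for j
      using less.prems by (auto simp: increasing_def sorted_wrt_take sorted_wrt_drop)
    have I: "gen_series (inv_symbol (take j ps)) Ls \<in> ?S" if "j \<le> d" "set Ls \<subseteq> ?S" for j Ls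
      using that False less.prems inc
      by (intro gen_series_over less.IH) (auto simp: d_def dest: in_set_takeD)
    have Y: "gen_series (symbol (drop j ps)) Ls \<in> ?S" if "length Ls = d - j" "j \<le> d" "set Ls \<subseteq> ?S" for j Ls
      using that False less.prems inc
      by (intro gen_series_over symbol_Hsymb) (auto simp: d_def dest: in_set_dropD)
    have X: "exp_series (log0 (hd ps) (last ps)) (tvar j) \<in> ?S" for j
    proof -
      have "hd ps \<in> set ps" "last ps \<in> set ps" using False by (cases ps; simp)+
      then show ?thesis
        using less.prems by (intro exp_series_over log0_Hsymb scalar_Hsymb tvar_series_over) auto
    qed
    note rules = closed_subring_plus closed_subring_minus closed_subring_uminus closed_subring_times
      closed_subring_sum closed_subring_power closed_subring_1 divide_t_over tvar_series_over X
    have T: "set (map (\<lambda>r. - tvar r) rs) \<subseteq> ?S" "set (map tvar rs) \<subseteq> ?S"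
      "set (map (\<lambda>r. tvar j - tvar r) rs) \<subseteq> ?S" "set (map (\<lambda>r. tvar r - tvar j) rs) \<subseteq> ?S" for rs j
      by (auto intro!: rules)
    define R where "R =
         (\<Sum>j\<in>{0..d - 1}. (- 1) ^ (d - 1 + j) *
            gen_series (inv_symbol (take (j + 1) ps)) (map (\<lambda>r. - tvar r) (rev [1..<j + 1])) *
            gen_series (symbol (drop j ps)) (map tvar [j + 1..<d + 1])) +
         (\<Sum>j\<in>{1..d}. (- 1) ^ (d - 1 + j) * divide_t j
            (gen_series (inv_symbol (take j ps)) (map (\<lambda>r. - tvar r) (rev [1..<j])) *
             gen_series (symbol (drop j ps)) (map tvar [j + 1..<d + 1])
             - gen_series (inv_symbol (take j ps)) (map (\<lambda>r. tvar j - tvar r) (rev [1..<j])) *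
               exp_series (log0 (hd ps) (last ps)) (tvar j) *
               gen_series (symbol (drop j ps)) (map (\<lambda>r. tvar r - tvar j) [j + 1..<d + 1])))"
    have "d \<ge> 1" using False by (simp add: d_def)
    then have "R \<in> ?S"
      unfolding R_def by (intro rules I Y T) (auto simp: closed_subring_1)
    moreover have "inv_symbol ps ns = (- 1) ^ (\<Sum>n\<leftarrow>ns. n - 1) * coeff R (t_exponent (rev ns))"
      using False by (subst inv_symbol.simps) (simp add: Let_def R_def d_def)
    ultimately show ?thesis
      by (auto simp: series_over_def closed_subring_1 intro!: rules)
  qed
qed

lemma INV_Hsymb: "INV a \<in> Hsymb"
proof -
  have "(case Rep_generator g of Log0 i \<Rightarrow> gen g
     | Symbol ps ns \<Rightarrow> if increasing ps then gen g else inv_symbol (rev ps) ns) \<in> Hsymb" for g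
  proof (cases "Rep_generator g")
    case (Log0 i)
    then show ?thesis by (simp add: gen_Hsymb regular_generator_def)
  next
    case (Symbol ps ns)
    then have "valid_generator (Symbol ps ns)"
      using Rep_generator[of g] by simp
    then show ?thesis
      using Symbol by (auto simp: increasing_def decreasing_def sorted_wrt_rev regular_generator_def
          intro!: gen_Hsymb inv_symbol_Hsymb)
  qed
  then show ?thesis
    unfolding INV_def alg_hom_def
    by (intro closed_subring_sum closed_subring_times closed_subring_prod closed_subring_power
        closed_subring_Hsymb scalar_Hsymb)
qed

lemma gen_power: "gen g ^ k = Poly_Mapping.single (Poly_Mapping.single g k) 1"
  by (induction k) (simp_all add: gen_def mult_single single_add[symmetric])

lemma prod_single: "(\<Prod>g\<in>A. Poly_Mapping.single (f g) (1::rat)) = Poly_Mapping.single (\<Sum>g\<in>A. f g :: monomial) 1"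
  by (induction A rule: infinite_finite_induct) (simp_all add: mult_single)

lemma alg_hom_single:
  "alg_hom \<phi> (Poly_Mapping.single m 1) = (\<Prod>g\<in>Poly_Mapping.keys m. \<phi> g ^ Poly_Mapping.lookup m g)"
  by (simp add: alg_hom_def scalar_def)

lemma poly_mapping_sum_single:
  "(\<Sum>g\<in>Poly_Mapping.keys m. Poly_Mapping.single g (Poly_Mapping.lookup m g)) = (m :: monomial)"
proof (rule poly_mapping_eqI)
  fix k
  have "(\<Sum>g\<in>Poly_Mapping.keys m. Poly_Mapping.lookup m g when g = k) =
      (\<Sum>g\<in>Poly_Mapping.keys m. if g = k then Poly_Mapping.lookup m k else 0)"
    by (intro sum.cong refl) (auto simp: when_def)
  then show "Poly_Mapping.lookup (\<Sum>g\<in>Poly_Mapping.keys m. Poly_Mapping.single g (Poly_Mapping.lookup m g)) k =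
      Poly_Mapping.lookup m k"
    by (simp add: lookup_sum lookup_single in_keys_iff)
qed

lemma INV_single_regular:
  assumes "\<forall>g\<in>Poly_Mapping.keys m. regular_generator g"
  shows "INV (Poly_Mapping.single m 1) = Poly_Mapping.single m 1"
proof -
  have "(case Rep_generator g of Log0 i \<Rightarrow> gen g
     | Symbol ps ns \<Rightarrow> if increasing ps then gen g else inv_symbol (rev ps) ns) = gen g"
    if "g \<in> Poly_Mapping.keys m" for g
    using assms that by (auto simp: regular_generator_def split: raw_generator.splits)
  then have "INV (Poly_Mapping.single m 1) =
      Poly_Mapping.single (\<Sum>g\<in>Poly_Mapping.keys m. Poly_Mapping.single g (Poly_Mapping.lookup m g)) 1"
    unfolding INV_def alg_hom_single prod_single[symmetric] gen_power[symmetric]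
    by (intro prod.cong refl) simp
  also have "(\<Sum>g\<in>Poly_Mapping.keys m. Poly_Mapping.single g (Poly_Mapping.lookup m g)) = m"
    by (rule poly_mapping_sum_single)
  finally show ?thesis .
qed

lemma keys_scalar_times: "Poly_Mapping.keys (scalar c * T) \<subseteq> Poly_Mapping.keys T"
  using keys_mult[of "scalar c" T] by (auto simp: scalar_def split: if_splits)

lemma keys_coproduct:
  assumes "(m, n) \<in> Poly_Mapping.keys (coproduct a)"
  obtains m' n' where "(m', n') \<in> Poly_Mapping.keys (coproduct_bar a)"
    "m \<in> Poly_Mapping.keys (INV (Poly_Mapping.single m' 1))"
    "n \<in> Poly_Mapping.keys (INV (Poly_Mapping.single n' 1))"
proof -
  let ?T = "\<lambda>z. scalar (Poly_Mapping.lookup (coproduct_bar a) z) *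
      (INV (Poly_Mapping.single (fst z) 1) \<otimes> INV (Poly_Mapping.single (snd z) 1))"
  have "(m, n) \<in> (\<Union>z\<in>Poly_Mapping.keys (coproduct_bar a). Poly_Mapping.keys (?T z))"
    using assms Poly_Mapping.keys_sum[of ?T "Poly_Mapping.keys (coproduct_bar a)"]
    by (auto simp: coproduct_def tensor_map_def case_prod_unfold)
  then show ?thesis
    using keys_scalar_times keys_tensor that by fastforce
qed

lemma lookup_variation_matrix:
  "Poly_Mapping.lookup (variation_matrix v w) n =
   Poly_Mapping.lookup (coproduct (index_symbol v)) (index_monomial w, n)"
  by (simp add: variation_matrix_def map_key.rep_eq inj_on_def)

lemma variation_matrix_Hsymb: "variation_matrix v w \<in> Hsymb"
proof -
  have "n \<in> Poly_Mapping.keys (variation_matrix v w) \<Longrightarrow> \<exists>a\<in>Hsymb. n \<in> Poly_Mapping.keys a" for n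
    using keys_coproduct[of "index_monomial w" n "index_symbol v"] INV_Hsymb
    by (metis in_keys_iff lookup_variation_matrix)
  then show ?thesis by (auto simp: Hsymb_def)
qed

lemma coeff_const_times: "coeff (const_series a * f) m = a * coeff f m"
proof -
  have "coeff (const_series a * f) m = (\<Sum>(x, y)\<in>{(0 :: nat \<Rightarrow>\<^sub>0 nat, m)}. coeff (const_series a) x * coeff f y)"
    unfolding times_mseries.rep_eq
    by (intro sum.mono_neutral_right finite_splits)
       (auto simp: splits_def const_series.rep_eq split: if_splits)
  then show ?thesis by (simp add: const_series.rep_eq)
qed

lemma closed_subring_scalars: "closed_subring (range scalar :: ('m::comm_monoid_add \<Rightarrow>\<^sub>0 rat) set)"
proof -
  have "scalar a + scalar b \<in> (range scalar :: ('m \<Rightarrow>\<^sub>0 rat) set)" for a b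
    by (rule range_eqI[of _ _ "a + b"]) (simp add: scalar_def single_add)
  moreover have "scalar a * scalar b \<in> (range scalar :: ('m \<Rightarrow>\<^sub>0 rat) set)" for a b
    by (rule range_eqI[of _ _ "a * b"]) (simp add: scalar_def mult_single)
  moreover have "- scalar a \<in> (range scalar :: ('m \<Rightarrow>\<^sub>0 rat) set)" for a
    by (rule range_eqI[of _ _ "- a"]) (simp add: scalar_def single_uminus)
  moreover have "0 \<in> (range scalar :: ('m \<Rightarrow>\<^sub>0 rat) set)"
    by (rule range_eqI[of _ _ 0]) (simp add: scalar_def)
  moreover have "1 \<in> (range scalar :: ('m \<Rightarrow>\<^sub>0 rat) set)"
    by (rule range_eqI[of _ _ 1]) (simp add: scalar_def)
  ultimately show ?thesis
    unfolding closed_subring_def by blast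
qed

fun index_of_symbol :: "nat \<Rightarrow> nat list \<Rightarrow> nat list \<Rightarrow> nat list" where
  "index_of_symbol a (p # q) (n # ns) = replicate (p - a - 1) 0 @ n # index_of_symbol p q ns"
| "index_of_symbol a (p # q) [] = replicate (p - a - 1) 0"
| "index_of_symbol a [] ns = []"

lemma support_positions_append:
  "support_positions (u @ v) = support_positions u @ map ((+) (length u)) (support_positions v)"
proof -
  have "[0..<length (u @ v)] = [0..<length u] @ map ((+) (length u)) [0..<length v]"
    using upt_add_eq_append[of 0 "length u" "length v"] map_add_upt[of "length u" "length v"]
    by (simp add: add.commute[of "length u"] cong: map_cong)
  then show ?thesis
    unfolding support_positions_def
    by (auto simp: filter_map o_def nth_append intro!: filter_cong)
qed

lemma index_of_symbol:
  assumes "increasing (a # q)" "length q = length ns + 1" "\<forall>n\<in>set ns. 1 \<le> n"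
  shows "filter (\<lambda>n. n \<noteq> 0) (index_of_symbol a q ns) = ns \<and>
    map ((+) a) (support_positions (index_of_symbol a q ns) @ [length (index_of_symbol a q ns) + 1]) = q"
  using assms
proof (induction a q ns rule: index_of_symbol.induct)
  case (1 a p q n ns)
  let ?k = "p - a - 1" and ?w = "index_of_symbol p q ns"
  have z: "support_positions (replicate k 0) = []" for k
    by (auto simp: support_positions_def filter_empty_conv)
  have "support_positions [n] = [1]" using 1 by (simp add: support_positions_def)
  then have n: "support_positions (n # ?w) = 1 # map Suc (support_positions ?w)"
    using support_positions_append[of "[n]" ?w] by simp
  have p: "p = a + ?k + 1" and "increasing (p # q)" using 1(2) by (auto simp: increasing_def)
  then have IH: "filter (\<lambda>n. n \<noteq> 0) ?w = ns"
    "map ((+) p) (support_positions ?w @ [length ?w + 1]) = q"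
    using 1 by auto
  have "map ((+) a) (support_positions (index_of_symbol a (p # q) (n # ns)) @
      [length (index_of_symbol a (p # q) (n # ns)) + 1]) =
    (a + ?k + 1) # map ((+) (a + ?k + 1)) (support_positions ?w @ [length ?w + 1])"
    unfolding index_of_symbol.simps support_positions_append z n by (simp add: o_def add_ac)
  also have "\<dots> = p # q" using IH(2) p by metis
  finally show ?case using IH(1) 1 by simp
next
  case (2 a p q)
  then have "q = []" "a < p" by (auto simp: increasing_def)
  then show ?case by (simp add: support_positions_def filter_empty_conv)
qed simp

lemma symbol_monomial_index:
  assumes "increasing q" "length q = length ns + 1" "\<forall>n\<in>set ns. 1 \<le> n" "\<forall>i\<in>set q. 1 \<le> i"
  shows "symbol_monomial q ns \<in> range index_monomial"
proof -
  have "increasing (0 # q)" using assms by (auto simp: increasing_def)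
  from index_of_symbol[OF this assms(2,3)]
  have "index_monomial (abs_vindex (index_of_symbol 0 q ns)) = symbol_monomial q ns"
    by (simp add: index_monomial.abs_eq map_idI)
  then show ?thesis by (metis rangeI)
qed

lemma keys_gen_series_symbol:
  assumes "increasing q" "length q = length js + 1" "\<forall>i\<in>set q. 1 \<le> i"
  shows "Poly_Mapping.keys (coeff (gen_series (symbol q) (map tvar js)) m) \<subseteq> range index_monomial"
proof -
  have "Poly_Mapping.keys (coeff (const_series (symbol q ns) * (\<Prod>(L, n)\<leftarrow>zip (map tvar js) ns. L ^ (n - 1))) m)
      \<subseteq> range index_monomial" (is "Poly_Mapping.keys (coeff (_ * ?P) m) \<subseteq> _")
    if "ns \<in> indices_upto (length js) N" for ns N
  proof -
    have "?P \<in> series_over (range scalar)"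
      by (intro closed_subring_prod_list closed_subring_series closed_subring_scalars)
         (auto intro!: closed_subring_power closed_subring_series closed_subring_scalars
            tvar_series_over dest!: set_zip_leftD)
    then obtain c where "coeff ?P m = scalar c" by (auto simp: series_over_def)
    then have "Poly_Mapping.keys (coeff (const_series (symbol q ns) * ?P) m) \<subseteq> {symbol_monomial q ns}"
      unfolding coeff_const_times using keys_scalar_times[of c "symbol q ns"]
      by (simp add: mult.commute symbol_def)
    also have "\<dots> \<subseteq> range index_monomial"
      using assms that by (auto simp: indices_upto_def intro!: symbol_monomial_index)
    finally show ?thesis .
  qed
  then show ?thesis
    unfolding gen_series_def
    by (simp add: MSeries_inverse) (rule order_trans[OF Poly_Mapping.keys_sum], blast)
qed

lemma chains_increasing:
  assumes "(is, js) \<in> chains (length ps - 1)" "increasing ps" "\<forall>i\<in>set ps. 1 \<le> i" "ps \<noteq> []"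
  defines "q \<equiv> map (\<lambda>i. ps ! (i - 1)) (is @ [length ps - 1 + 1])"
  shows "increasing q" "length q = length js + 1" "\<forall>i\<in>set q. 1 \<le> i"
proof -
  let ?is = "is @ [length ps]"
  have ch: "1 \<le> ?is ! a" "?is ! a < ?is ! Suc a" if "a < length is" for a
    using assms(1,4) that by (fastforce simp: chains_def nth_append)+
  then have "sorted_wrt (<) ?is"
    by (subst sorted_wrt_iff_nth_Suc_transp) auto
  moreover have "\<forall>i\<in>set ?is. 1 \<le> i"
    using ch(1) \<open>ps \<noteq> []\<close> by (auto simp: in_set_conv_nth nth_append Suc_le_eq)
  ultimately have *: "sorted_wrt (<) ?is" "\<forall>i\<in>set ?is. 1 \<le> i \<and> i \<le> length ps"
    by (auto simp: sorted_wrt_append less_imp_le)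
  have "ps ! (i - 1) < ps ! (j - 1)" if "i \<in> set ?is" "j \<in> set ?is" "i < j" for i j
  proof -
    have "i - 1 < j - 1" "j - 1 < length ps" using that bspec[OF *(2)] by force+
    then show ?thesis using assms(2) by (simp add: increasing_def sorted_wrt_iff_nth_less)
  qed
  then have "sorted_wrt (\<lambda>i j. ps ! (i - 1) < ps ! (j - 1)) ?is"
    using *(1) by (intro sorted_wrt_mono_rel[OF _ *(1)]) auto
  then show "increasing q"
    using \<open>ps \<noteq> []\<close> unfolding q_def increasing_def sorted_wrt_map by simp
  show "length q = length js + 1" using assms(1) by (auto simp: q_def chains_def)
  have "ps ! (i - 1) \<in> set ps" if "i \<in> set ?is" for i
    using that *(2) \<open>ps \<noteq> []\<close> by (intro nth_mem) force
  then show "\<forall>i\<in>set q. 1 \<le> i" using assms(3,4) unfolding q_def by auto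
qed

lemma keys_tensor_series:
  assumes "\<And>a. Poly_Mapping.keys (coeff f a) \<subseteq> M"
  shows "Poly_Mapping.keys (coeff (tensor_series f g) m) \<subseteq> M \<times> UNIV"
proof -
  have "Poly_Mapping.keys (\<Sum>z\<in>splits m. coeff f (fst z) \<otimes> coeff g (snd z)) \<subseteq> M \<times> UNIV"
    using assms by (intro order_trans[OF Poly_Mapping.keys_sum] UN_least order_trans[OF keys_tensor]) auto
  then show ?thesis
    by (simp add: tensor_series_def MSeries_inverse case_prod_unfold)
qed

lemma coeff_sum: "coeff (sum f A) m = (\<Sum>x\<in>A. coeff (f x) m)"
  by (induction A rule: infinite_finite_induct) (auto simp: zero_mseries.rep_eq plus_mseries.rep_eq)

lemma keys_coproduct_bar_series:
  assumes "increasing ps" "\<forall>i\<in>set ps. 1 \<le> i" "ps \<noteq> []"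
  shows "Poly_Mapping.keys (coeff (coproduct_bar_series ps) m) \<subseteq> range index_monomial \<times> UNIV"
proof -
  have *: "Poly_Mapping.keys (coeff (case x of (is, js) \<Rightarrow> tensor_series
      (gen_series (symbol (map (\<lambda>i. ps ! (i - 1)) (is @ [length ps - 1 + 1]))) (map tvar js)) (G is js)) m)
      \<subseteq> range index_monomial \<times> UNIV"
    if "x \<in> chains (length ps - 1)" for x G
  proof (cases x)
    case (Pair "is" js)
    show ?thesis
      unfolding Pair prod.case
      by (intro keys_tensor_series keys_gen_series_symbol chains_increasing[OF _ assms])
         (use that Pair in simp_all)
  qed
  show ?thesis
    unfolding coproduct_bar_series_def Let_def coeff_sum
    by (rule order_trans[OF Poly_Mapping.keys_sum], rule UN_least, rule *)
qed

lemma keys_coproduct_bar_index_symbol: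
  "Poly_Mapping.keys (coproduct_bar (index_symbol v)) \<subseteq> range index_monomial \<times> UNIV"
proof -
  obtain u where u: "v = abs_vindex u"
    using vindex.abs_induct[of "\<lambda>v. \<exists>u. v = abs_vindex u" v] by blast
  let ?p = "support_positions u @ [length u + 1]" and ?ns = "filter (\<lambda>n. n \<noteq> 0) u"
  have im: "index_monomial v = symbol_monomial ?p ?ns"
    by (simp add: u index_monomial.abs_eq)
  show ?thesis
  proof (cases "?ns = []")
    case True
    then have v: "index_monomial v = 0" using im by (simp add: symbol_monomial_def)
    have "coproduct_bar (index_symbol v) = 1"
      unfolding coproduct_bar_def index_symbol_def alg_hom_single by (simp add: v)
    then show ?thesis
      using v[symmetric] by (auto simp: zero_prod_def intro: range_eqI[of _ _ v])
  next
    case False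
    then have "valid_generator (Symbol ?p ?ns)" by (rule valid_index_generator)
    moreover from this have "Rep_generator (Abs_generator (Symbol ?p ?ns)) = Symbol ?p ?ns"
      by (simp add: Abs_generator_inverse)
    moreover have "increasing ?p"
      by (auto simp: increasing_def support_positions_def sorted_wrt_append sorted_wrt_map intro!: sorted_wrt_filter)
    ultimately show ?thesis
      using False im keys_coproduct_bar_series[of ?p "t_exponent ?ns"]
      by (simp add: coproduct_bar_def index_symbol_def alg_hom_single symbol_monomial_def del: filter_empty_conv)
  qed
qed

lemma coproduct_index_symbol:
  "coproduct (index_symbol v) = Sum_any (\<lambda>w. index_symbol w \<otimes> variation_matrix v w)"
proof (rule poly_mapping_eqI, clarify)
  fix m n
  let ?A = "{w. variation_matrix v w \<noteq> 0}"
  have "{w. index_symbol w \<otimes> variation_matrix v w \<noteq> 0} \<subseteq> ?A"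
    by (auto simp: tensor_def)
  then have "Sum_any (\<lambda>w. index_symbol w \<otimes> variation_matrix v w) =
      (\<Sum>w\<in>?A. index_symbol w \<otimes> variation_matrix v w)"
    by (rule Sum_any.expand_superset[OF finite_variation_matrix_row])
  then have R: "Poly_Mapping.lookup (Sum_any (\<lambda>w. index_symbol w \<otimes> variation_matrix v w)) (m, n) =
      (\<Sum>w\<in>?A. if index_monomial w = m then Poly_Mapping.lookup (variation_matrix v w) n else 0)"
    unfolding lookup_sum
    by (auto simp: lookup_sum lookup_tensor index_symbol_def lookup_single when_def intro!: sum.cong)
  show "Poly_Mapping.lookup (coproduct (index_symbol v)) (m, n) =
      Poly_Mapping.lookup (Sum_any (\<lambda>w. index_symbol w \<otimes> variation_matrix v w)) (m, n)"
  proof (cases "m \<in> range index_monomial")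
    case True
    then obtain w where w: "m = index_monomial w" by blast
    have "(\<Sum>w\<in>?A. if index_monomial w = m then Poly_Mapping.lookup (variation_matrix v w) n else 0) =
        (\<Sum>w'\<in>?A. if w' = w then Poly_Mapping.lookup (variation_matrix v w) n else 0)"
      using w inj_index_monomial by (intro sum.cong refl) (auto simp: inj_eq)
    also have "\<dots> = Poly_Mapping.lookup (variation_matrix v w) n"
      using finite_variation_matrix_row by (simp add: sum.delta)
    finally show ?thesis unfolding R using w by (simp add: lookup_variation_matrix)
  next
    case False
    have reg: "\<forall>g\<in>Poly_Mapping.keys (index_monomial w). regular_generator g" for w
    proof transfer
      fix u
      show "\<forall>g\<in>Poly_Mapping.keys (symbol_monomial (support_positions u @ [length u + 1]) (filter (\<lambda>n. n \<noteq> 0) u)).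
          regular_generator g"
        using valid_index_generator[of u]
        by (auto simp: symbol_monomial_def regular_generator_def Abs_generator_inverse increasing_def
            support_positions_def sorted_wrt_append sorted_wrt_map simp del: filter_empty_conv intro!: sorted_wrt_filter)
    qed
    have "(m, n) \<notin> Poly_Mapping.keys (coproduct (index_symbol v))"
    proof
      assume "(m, n) \<in> Poly_Mapping.keys (coproduct (index_symbol v))"
      then obtain m' n' where "(m', n') \<in> Poly_Mapping.keys (coproduct_bar (index_symbol v))"
        and m: "m \<in> Poly_Mapping.keys (INV (Poly_Mapping.single m' 1))"
        by (rule keys_coproduct)
      then have "m' \<in> range index_monomial" using keys_coproduct_bar_index_symbol by blast
      then have "m = m'" using m reg by (auto simp: INV_single_regular)
      then show False using \<open>m' \<in> _\<close> False by simp
    qed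
    moreover have "(\<Sum>w\<in>?A. if index_monomial w = m then Poly_Mapping.lookup (variation_matrix v w) n else 0) = 0"
      using False by (intro sum.neutral) auto
    ultimately show ?thesis unfolding R by (simp add: in_keys_iff)
  qed
qed

definition transpose_matrix :: "(vindex \<Rightarrow> vindex \<Rightarrow> 'a) \<Rightarrow> vindex \<Rightarrow> vindex \<Rightarrow> 'a" where
  "transpose_matrix A v w = A w v"

definition coproduct_matrix :: "(vindex \<Rightarrow> vindex \<Rightarrow> hbar) \<Rightarrow> vindex \<Rightarrow> vindex \<Rightarrow> hbar2" where
  "coproduct_matrix A v w = coproduct (A v w)"

text \<open>
  The sums occurring here are finite by \<open>finite_variation_matrix_row\<close> when \<open>A\<close> and \<open>B\<close> are the
  transposed variation matrix.
\<close>

definition tensor_matrix ::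
  "(vindex \<Rightarrow> vindex \<Rightarrow> hbar) \<Rightarrow> (vindex \<Rightarrow> vindex \<Rightarrow> hbar) \<Rightarrow> vindex \<Rightarrow> vindex \<Rightarrow> hbar2" where
  "tensor_matrix A B v w = Sum_any (\<lambda>u. A v u \<otimes> B u w)"

end

theory Submission
  imports Defs
begin

text \<open>
  Comparing coefficients of \<open>w\<close>, the theorem amounts to
  $(\Delta\otimes\mathrm{id})\Delta(v) = (\mathrm{id}\otimes\Delta)\Delta(v)$, that is, to the associativity of
  the convolution of algebra homomorphisms on regular symbols.

  A symbol is an iterated integral in the letters $e_0$ and $e_p$. A homomorphism $\phi$ yields noncommutative
  series $A_P$, with coefficients $I(0; w; X_P)$ given by regular symbols, and $B_p$, with coefficients
  $I(X_p; w; 0)$ given by inverted ones; only words whose letters $e_p$ increase matter. The formula for the coproduct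
  says that the convolution of $g$ and $h$ has $A_P = \sigma(A^g_P)\,A^h_P$, where $\sigma$ is the substitution
  $e_p \mapsto A^h_p e_p B^h_p$. Once $B_p = B^h_p\,\sigma(B^g_p)$ is known as well, the substitution belonging to
  the convolution is a composite of substitutions, and associativity is immediate.

  The series $B_p$ of a homomorphism that is invariant under INV is determined by the $A_P$, since the recursion
  defining INV is a linear relation between $B_p e_0^{-1} A_P$ and the values of $B$ and $A$ at $e_0 = 0$. This
  relation is stable under $A_P = \sigma(A^g_P)\,A^h_P$, $B_p = B^h_p\,\sigma(B^g_p)$, which is an identity in a
  nonunital ring; by uniqueness the law for $B$ follows.
\<close>

section \<open>Series in noncommuting letters\<close>

text \<open>The law for B is not read off the coproduct of inverted symbols: a point invariant under
  INV sees these only through the recursion for INV. So B is characterized by a relation instead.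
  Let K be the coefficient of B_p e_0^{-1} A_P, with the denominators 1/t_j of the recursion cleared
  by a factor c; let R be K for A = B = 1; let 1 + a collect the words of A_P not starting with e_0,
  and 1 + d those of B_p not ending in e_0. With a unit adjoined, the recursion reads K - c = (1 +
  d)(R - c)(1 + a). A second pair (A_2, B_2) turns a kernel M into B_2 sigma(M) A_2. This map is
  multiplicative, sends R to K_2 and K_1 to K, and 1 + d, 1 + a factor accordingly, so the relation
  is inherited. Uniqueness goes by the length of the word: each length brings one new value of B,
  multiplied by c. Since c is a product of differences of slots, the slots are distinct variables at
  that point, which makes c cancellable. Words whose letters do not increase carry no symbol, so the
  identities have to be followed along the subwords of increasing words; this is the purpose of the
  many congruence lemmas.\<close>

text \<open>
  For a start slot $t_0$, the word $[(p_1,t_1),\dots,(p_d,t_d)]$ stands for all words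
  $e_0^{n_0}e_{p_1}e_0^{n_1}\cdots e_{p_d}e_0^{n_d}$ at once: a series is represented by the generating functions
  $\sum c(n_0,\dots,n_d)t_0^{n_0}\cdots t_d^{n_d}$ of its coefficients, evaluated at the slots. In a product the
  factors share the slot at which the word is cut.
\<close>

type_synonym ('l, 's) word = "('l \<times> 's) list"
type_synonym ('l, 's, 'a) family = "'l \<Rightarrow> 's \<Rightarrow> ('l, 's) word \<Rightarrow> 'a"
type_synonym ('l, 's, 'a) kernel = "'l \<Rightarrow> 's \<Rightarrow> ('l, 's) word \<Rightarrow> 'l \<Rightarrow> 'a"

fun end_slot :: "'s \<Rightarrow> ('l, 's) word \<Rightarrow> 's" where
  "end_slot t [] = t"
| "end_slot t (x # w) = end_slot (snd x) w"

text \<open>The recursion shifts letters into the left factor, which therefore is a bare function of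
  words with its start slot already fixed. Only the right factor takes a slot, since its start
  depends on the cut.\<close>

fun conv :: "(('l, 's) word \<Rightarrow> 'a::comm_ring_1) \<Rightarrow> ('s \<Rightarrow> ('l, 's) word \<Rightarrow> 'a) \<Rightarrow> 's \<Rightarrow> ('l, 's) word \<Rightarrow> 'a" where
  "conv f G t [] = f [] * G t []"
| "conv f G t (x # w) = f [] * G t (x # w) + conv (\<lambda>u. f (x # u)) G (snd x) w"

text \<open>\<open>mark f K\<close> is $\sum_p f_p e_p K_p$.\<close>

fun mark :: "('l \<Rightarrow> ('l, 's) word \<Rightarrow> 'a::comm_ring_1) \<Rightarrow> ('l, 's, 'a) family \<Rightarrow> ('l, 's) word \<Rightarrow> 'a" where
  "mark f K [] = 0"
| "mark f K (x # w) = f (fst x) [] * K (fst x) (snd x) w + mark (\<lambda>q u. f q (x # u)) K w"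

lemma mult_cong: "a = a' \<Longrightarrow> b = b' \<Longrightarrow> a * b = a' * b'"
  by simp

lemma end_slot_append [simp]: "end_slot t (u @ v) = end_slot (end_slot t u) v"
  by (induction u arbitrary: t) auto

lemma conv_cong:
  assumes "\<And>u v. w = u @ v \<Longrightarrow> f u * G (end_slot t u) v = f' u * G' (end_slot t u) v"
  shows "conv f G t w = conv f' G' t w"
  using assms
proof (induction w arbitrary: f f' t)
  case Nil
  then show ?case by simp
next
  case (Cons x w)
  have "f [] * G t (x # w) = f' [] * G' t (x # w)" using Cons.prems[of "[]" "x # w"] by simp
  moreover have "conv (\<lambda>u. f (x # u)) G (snd x) w = conv (\<lambda>u. f' (x # u)) G' (snd x) w"
    by (rule Cons.IH) (use Cons.prems[of "x # _"] in auto)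
  ultimately show ?case by simp
qed

lemma mark_cong:
  assumes "\<And>u p s v. w = u @ (p, s) # v \<Longrightarrow> f p u * K p s v = f' p u * K' p s v"
  shows "mark f K w = mark f' K' w"
  using assms
proof (induction w arbitrary: f f')
  case Nil
  then show ?case by simp
next
  case (Cons x w)
  have "f (fst x) [] * K (fst x) (snd x) w = f' (fst x) [] * K' (fst x) (snd x) w"
    using Cons.prems[of "[]" "fst x" "snd x" w] by simp
  moreover have "mark (\<lambda>q u. f q (x # u)) K w = mark (\<lambda>q u. f' q (x # u)) K' w"
    by (rule Cons.IH) (use Cons.prems[of "x # _"] in auto)
  ultimately show ?case by simp
qed

lemma conv_index:
  "conv f G t w = (\<Sum>j\<le>length w. f (take j w) * G (end_slot t (take j w)) (drop j w))"
proof (induction w arbitrary: f t)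
  case (Cons x w)
  show ?case by (simp add: Cons.IH sum.atMost_Suc_shift del: sum.atMost_Suc)
qed simp

lemma mark_index:
  "mark f K w = (\<Sum>i<length w. f (fst (w ! i)) (take i w) * K (fst (w ! i)) (snd (w ! i)) (drop (Suc i) w))"
proof (induction w arbitrary: f)
  case (Cons x w)
  show ?case by (simp add: Cons.IH sum.lessThan_Suc_shift del: sum.lessThan_Suc)
qed simp

lemma conv_add_left: "conv (\<lambda>u. f u + g u) G t = (\<lambda>w. conv f G t w + conv g G t w)"
proof
  fix w show "conv (\<lambda>u. f u + g u) G t w = conv f G t w + conv g G t w"
    by (induction w arbitrary: f g t) (auto simp: algebra_simps)
qed
lemma conv_add_right: "conv f (\<lambda>s v. G s v + H s v) t w = conv f G t w + conv f H t w"
  by (induction w arbitrary: f t) (auto simp: algebra_simps)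
lemma conv_scale_left: "conv (\<lambda>u. c * f u) G t = (\<lambda>w. c * conv f G t w)"
proof
  fix w show "conv (\<lambda>u. c * f u) G t w = c * conv f G t w"
    by (induction w arbitrary: f t) (auto simp: algebra_simps)
qed
lemma conv_scale_right: "conv f (\<lambda>s v. c * G s v) t w = c * conv f G t w"
  by (induction w arbitrary: f t) (auto simp: algebra_simps)
lemma conv_zero_left [simp]: "conv (\<lambda>u. 0) G t w = 0"
  by (induction w arbitrary: t) auto
lemma conv_unit_left: "conv (\<lambda>u. if u = [] then c else 0) G t = (\<lambda>w. c * G t w)"
proof
  fix w show "conv (\<lambda>u. if u = [] then c else 0) G t w = c * G t w" by (cases w) auto
qed
lemma mark_add_left: "mark (\<lambda>p u. f p u + g p u) K w = mark f K w + mark g K w"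
  by (induction w arbitrary: f g) (auto simp: algebra_simps)
lemma mark_add_right: "mark f (\<lambda>p s v. K p s v + H p s v) w = mark f K w + mark f H w"
  by (induction w arbitrary: f) (auto simp: algebra_simps)
lemma mark_scale_left: "mark (\<lambda>p u. c * f p u) K w = c * mark f K w"
  by (induction w arbitrary: f) (auto simp: algebra_simps)
lemma mark_scale_right: "mark f (\<lambda>p s v. c * K p s v) w = c * mark f K w"
  by (induction w arbitrary: f) (auto simp: algebra_simps)

lemma conv_zero_right [simp]: "conv f (\<lambda>s v. 0) t = (\<lambda>v. 0)"
proof
  fix w show "conv f (\<lambda>s v. 0) t w = 0" by (induction w arbitrary: f t) auto
qed
lemma mark_zero_right [simp]: "mark f (\<lambda>p s v. 0) w = 0"
  by (induction w arbitrary: f) auto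

lemma conv_assoc:
  "conv (conv f G t) H t = conv f (\<lambda>s. conv (G s) H s) t"
proof
  fix w show "conv (conv f G t) H t w = conv f (\<lambda>s. conv (G s) H s) t w"
    by (induction w arbitrary: f t) (auto simp: conv_add_left conv_scale_left algebra_simps)
qed

lemma conv_mark_left:
  "conv (mark a K) G t = mark a (\<lambda>p s. conv (K p s) G s)"
proof
  fix w show "conv (mark a K) G t w = mark a (\<lambda>p s. conv (K p s) G s) w"
  proof (induction w arbitrary: a t)
    case (Cons x w)
    show ?case by (simp add: Cons.IH conv_add_left conv_scale_left)
  qed simp
qed

lemma conv_mark_right:
  "conv f (\<lambda>s. mark (a s) K) t w = mark (\<lambda>p. conv f (\<lambda>s. a s p) t) K w"
proof (induction w arbitrary: f t)
  case (Cons x w)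
  have "mark (\<lambda>p u. f [] * a t p (x # u) + conv (\<lambda>u. f (x # u)) (\<lambda>s. a s p) (snd x) u) K w
     = f [] * mark (\<lambda>p u. a t p (x # u)) K w + conv (\<lambda>u. f (x # u)) (\<lambda>s. mark (a s) K) (snd x) w"
    by (simp add: mark_add_left mark_scale_left Cons.IH)
  then show ?case by (simp add: algebra_simps)
qed simp

text \<open>Both sides sum over two marked letters of the word, e_q before e_p. This becomes the
  associativity of \<open>letter_comp\<close>.\<close>

lemma mark_mark:
  "mark (\<lambda>p. mark a (\<lambda>q s. k q s p)) K w = mark a (\<lambda>q s. mark (k q s) K) w"
proof (induction w arbitrary: a)
  case (Cons x w)
  show ?case by (simp add: mark_add_left mark_scale_left Cons.IH)
qed simp

section \<open>Substitutions in noncommutative series\<close>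

text \<open>The substitution $e_0 \mapsto e_0$, $e_p \mapsto A_p e_p B_p$ applied to \<open>f\<close>.\<close>

function sigma :: "('l, 's, 'a::comm_ring_1) family \<Rightarrow> ('l, 's, 'a) family \<Rightarrow>
    (('l, 's) word \<Rightarrow> 'a) \<Rightarrow> 's \<Rightarrow> ('l, 's) word \<Rightarrow> 'a" where
  "sigma A B f t w = (if w = [] then f [] else 0) +
     (\<Sum>i<length w. A (fst (w ! i)) t (take i w) *
        (\<Sum>j<length w - i. B (fst (w ! i)) (snd (w ! i)) (take j (drop (Suc i) w)) *
           sigma A B (\<lambda>z. f ((fst (w ! i), snd (w ! (i + j))) # z)) (snd (w ! (i + j))) (drop (Suc (i + j)) w)))"
  by auto
termination by (relation "measure (\<lambda>(A, B, f, t, w). length w)") auto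

declare sigma.simps [simp del]

lemma end_slot_take: "j \<le> length w \<Longrightarrow> end_slot t (take j w) = (if j = 0 then t else snd (w ! (j - 1)))"
proof (induction w arbitrary: j t)
  case (Cons x w)
  then show ?case by (cases j) (auto simp: nth_Cons')
qed simp

text \<open>The definition spells out the cut positions so that the remaining word is visibly
  shorter; here they are hidden again. The letter e_p handed to \<open>f\<close> gets the slot
  \<open>e\<close> at which the word of B_p ends, because the powers of e_0 following e_p in
  \<open>f\<close> come after B_p.\<close>

lemma sigma_eq:
  "sigma A B f t w = (if w = [] then f [] else 0) +
     mark (\<lambda>p. A p t) (\<lambda>p s. conv (B p s) (\<lambda>e. sigma A B (\<lambda>z. f ((p, e) # z)) e) s) w"
proof -
  have *: "end_slot (snd (w ! i)) (take j (drop (Suc i) w)) = snd (w ! (i + j))"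
    if "i < length w" "j < length w - i" for i j
    using that by (subst end_slot_take) (auto simp: nth_append)
  show ?thesis
    unfolding mark_index conv_index
    by (subst sigma.simps, intro arg_cong2[where f = "(+)"] refl sum.cong mult_cong)
      (auto simp: * add.commute intro!: sum.cong)
qed

lemma sigma_fun_eq:
  "sigma A B f t = (\<lambda>w. (if w = [] then f [] else 0) +
     mark (\<lambda>p. A p t) (\<lambda>p s. conv (B p s) (\<lambda>e. sigma A B (\<lambda>z. f ((p, e) # z)) e) s) w)"
  by (rule ext, rule sigma_eq)

lemma sigma_unit: "sigma A B (\<lambda>u. if u = [] then c else 0) = (\<lambda>t w. if w = [] then c else 0)"
proof (intro ext)
  fix t w
  have zero: "sigma A B (\<lambda>u. 0) t w = 0" for t w
  proof (induction "length w" arbitrary: t w rule: less_induct)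
    case less
    have "mark (\<lambda>p. A p t) (\<lambda>p s. conv (B p s) (\<lambda>e. sigma A B (\<lambda>z. 0) e) s) w =
        mark (\<lambda>p. A p t) (\<lambda>p s. conv (B p s) (\<lambda>e v. 0) s) w"
      by (intro mark_cong conv_cong mult_cong refl less) simp
    then show ?case by (simp add: sigma_eq[of A B _ t w])
  qed
  then have "sigma A B (\<lambda>u. 0) = (\<lambda>t w. 0)" by (intro ext)
  then show "sigma A B (\<lambda>u. if u = [] then c else 0) t w = (if w = [] then c else 0)"
    by (simp add: sigma_eq[of A B _ t w])
qed

lemma sigma_linear:
  "sigma A B (\<lambda>u. c * f u + d * g u) t w = c * sigma A B f t w + d * sigma A B g t w"
proof (induction "length w" arbitrary: f g t w rule: less_induct)
  case less
  have "mark (\<lambda>p. A p t) (\<lambda>p s. conv (B p s) (\<lambda>e. sigma A B (\<lambda>z. c * f ((p, e) # z) + d * g ((p, e) # z)) e) s) w =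
    mark (\<lambda>p. A p t) (\<lambda>p s v. c * conv (B p s) (\<lambda>e. sigma A B (\<lambda>z. f ((p, e) # z)) e) s v +
       d * conv (B p s) (\<lambda>e. sigma A B (\<lambda>z. g ((p, e) # z)) e) s v) w"
    by (intro mark_cong mult_cong refl,
        unfold conv_add_right[symmetric] conv_scale_right[symmetric],
        intro conv_cong mult_cong refl less) simp
  then show ?case
    unfolding sigma_eq[of A B f t w] sigma_eq[of A B g t w] sigma_eq[of A B "\<lambda>u. c * f u + d * g u" t w]
    by (simp add: mark_add_right mark_scale_right algebra_simps)
qed

lemma sigma_scale: "sigma A B (\<lambda>u. c * f u) t = (\<lambda>w. c * sigma A B f t w)"
  using sigma_linear[of A B c f 0 f] by (intro ext) simp

lemma sigma_add: "sigma A B (\<lambda>u. f u + g u) t = (\<lambda>w. sigma A B f t w + sigma A B g t w)"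
  using sigma_linear[of A B 1 f 1 g] by (intro ext) simp

text \<open>A substitution is multiplicative. By induction on the word: the first letter substituted
  belongs to the right factor if the left one is taken at \<open>[]\<close>, and to the left factor
  otherwise, and then a shorter word remains.\<close>

lemma sigma_conv_aux:
  "sigma A B (conv f G t) t w = conv (sigma A B f t) (\<lambda>s. sigma A B (G s) s) t w"
proof (induction "length w" arbitrary: f t w rule: less_induct)
  case less
  let ?S = "sigma A B"
  have "mark (\<lambda>p. A p t) (\<lambda>p s. conv (B p s) (\<lambda>e. ?S (\<lambda>z. conv f G t ((p, e) # z)) e) s) w =
    mark (\<lambda>p. A p t) (\<lambda>p s v. f [] * conv (B p s) (\<lambda>e. ?S (\<lambda>z. G t ((p, e) # z)) e) s v +
       conv (B p s) (\<lambda>e. conv (?S (\<lambda>z. f ((p, e) # z)) e) (\<lambda>s. ?S (G s) s) e) s v) w"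
  proof (intro mark_cong mult_cong refl)
    fix u p s v assume w: "w = u @ (p, s) # v"
    have "conv (B p s) (\<lambda>e. ?S (\<lambda>z. conv f G t ((p, e) # z)) e) s v =
       conv (B p s) (\<lambda>e v'. f [] * ?S (\<lambda>z. G t ((p, e) # z)) e v' + conv (?S (\<lambda>z. f ((p, e) # z)) e) (\<lambda>s. ?S (G s) s) e v') s v"
    proof (intro conv_cong mult_cong refl)
      fix u' v' assume v: "v = u' @ v'"
      let ?e = "end_slot s u'"
      have "?S (\<lambda>z. conv f G t ((p, ?e) # z)) ?e v' = f [] * ?S (\<lambda>z. G t ((p, ?e) # z)) ?e v' +
         ?S (conv (\<lambda>z. f ((p, ?e) # z)) G ?e) ?e v'"
        by (simp add: sigma_add sigma_scale)
      also have "?S (conv (\<lambda>z. f ((p, ?e) # z)) G ?e) ?e v' = conv (?S (\<lambda>z. f ((p, ?e) # z)) ?e) (\<lambda>s. ?S (G s) s) ?e v'"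
        by (rule less) (simp add: w v)
      finally show "?S (\<lambda>z. conv f G t ((p, ?e) # z)) ?e v' = f [] * ?S (\<lambda>z. G t ((p, ?e) # z)) ?e v' +
         conv (?S (\<lambda>z. f ((p, ?e) # z)) ?e) (\<lambda>s. ?S (G s) s) ?e v'" .
    qed
    then show "conv (B p s) (\<lambda>e. ?S (\<lambda>z. conv f G t ((p, e) # z)) e) s v =
      f [] * conv (B p s) (\<lambda>e. ?S (\<lambda>z. G t ((p, e) # z)) e) s v +
       conv (B p s) (\<lambda>e. conv (?S (\<lambda>z. f ((p, e) # z)) e) (\<lambda>s. ?S (G s) s) e) s v"
      by (simp add: conv_add_right conv_scale_right)
  qed
  then have "?S (conv f G t) t w = (if w = [] then f [] * G t [] else 0) +
     mark (\<lambda>p. A p t) (\<lambda>p s v. f [] * conv (B p s) (\<lambda>e. ?S (\<lambda>z. G t ((p, e) # z)) e) s v +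
       conv (B p s) (\<lambda>e. conv (?S (\<lambda>z. f ((p, e) # z)) e) (\<lambda>s. ?S (G s) s) e) s v) w"
    by (subst sigma_eq) simp
  also have "\<dots> = f [] * ?S (G t) t w +
     mark (\<lambda>p. A p t) (\<lambda>p s. conv (B p s) (\<lambda>e. conv (?S (\<lambda>z. f ((p, e) # z)) e) (\<lambda>s. ?S (G s) s) e) s) w"
    unfolding sigma_eq[of A B "G t" t w] by (simp add: mark_add_right mark_scale_right algebra_simps)
  also have "\<dots> = conv (?S f t) (\<lambda>s. ?S (G s) s) t w"
    unfolding sigma_fun_eq[of A B f t] by (simp add: conv_add_left conv_unit_left conv_mark_left conv_assoc)
  finally show ?case .
qed

lemma sigma_conv: "sigma A B (conv f G t) t = conv (sigma A B f t) (\<lambda>s. sigma A B (G s) s) t"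
  by (rule ext) (rule sigma_conv_aux)

text \<open>An explicit letter e_p becomes A_p e_p B_p; its A_p is absorbed by the factor before the
  mark, its B_p by the factor after it.\<close>

lemma sigma_mark_aux:
  "sigma A B (mark a K) t w =
     mark (\<lambda>p. conv (sigma A B (a p) t) (A p) t) (\<lambda>p s. conv (B p s) (\<lambda>e. sigma A B (K p e) e) s) w"
proof (induction "length w" arbitrary: a t w rule: less_induct)
  case less
  let ?S = "sigma A B"
  let ?K = "\<lambda>p s. conv (B p s) (\<lambda>e. ?S (K p e) e) s"
  have "mark (\<lambda>p. A p t) (\<lambda>p s. conv (B p s) (\<lambda>e. ?S (\<lambda>z. mark a K ((p, e) # z)) e) s) w =
    mark (\<lambda>p. A p t) (\<lambda>p s v. a p [] * ?K p s v +
       conv (B p s) (\<lambda>e. mark (\<lambda>q. conv (?S (\<lambda>u. a q ((p, e) # u)) e) (A q) e) ?K) s v) w"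
  proof (intro mark_cong mult_cong refl)
    fix u p s v assume w: "w = u @ (p, s) # v"
    have "conv (B p s) (\<lambda>e. ?S (\<lambda>z. mark a K ((p, e) # z)) e) s v =
       conv (B p s) (\<lambda>e v'. a p [] * ?S (K p e) e v' + mark (\<lambda>q. conv (?S (\<lambda>u. a q ((p, e) # u)) e) (A q) e) ?K v') s v"
    proof (intro conv_cong mult_cong refl)
      fix u' v' assume v: "v = u' @ v'"
      let ?e = "end_slot s u'"
      have "?S (\<lambda>z. mark a K ((p, ?e) # z)) ?e v' = a p [] * ?S (K p ?e) ?e v' +
         ?S (mark (\<lambda>q u. a q ((p, ?e) # u)) K) ?e v'"
        by (simp add: sigma_add sigma_scale)
      also have "?S (mark (\<lambda>q u. a q ((p, ?e) # u)) K) ?e v' = mark (\<lambda>q. conv (?S (\<lambda>u. a q ((p, ?e) # u)) ?e) (A q) ?e) ?K v'"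
        by (rule less) (simp add: w v)
      finally show "?S (\<lambda>z. mark a K ((p, ?e) # z)) ?e v' = a p [] * ?S (K p ?e) ?e v' +
          mark (\<lambda>q. conv (?S (\<lambda>u. a q ((p, ?e) # u)) ?e) (A q) ?e) ?K v'" .
    qed
    then show "conv (B p s) (\<lambda>e. ?S (\<lambda>z. mark a K ((p, e) # z)) e) s v = a p [] * ?K p s v +
       conv (B p s) (\<lambda>e. mark (\<lambda>q. conv (?S (\<lambda>u. a q ((p, e) # u)) e) (A q) e) ?K) s v"
      by (simp add: conv_add_right conv_scale_right)
  qed
  then have 1: "?S (mark a K) t w = mark (\<lambda>p. A p t) (\<lambda>p s v. a p [] * ?K p s v +
       conv (B p s) (\<lambda>e. mark (\<lambda>q. conv (?S (\<lambda>u. a q ((p, e) # u)) e) (A q) e) ?K) s v) w"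
    unfolding sigma_eq[of A B "mark a K" t w] by simp
  have 2: "\<dots> = mark (\<lambda>p u. a p [] * A p t u) ?K w +
      mark (\<lambda>p. A p t) (\<lambda>p s. mark (\<lambda>q. conv (B p s) (\<lambda>e. conv (?S (\<lambda>u. a q ((p, e) # u)) e) (A q) e) s) ?K) w"
  proof -
    have "mark (\<lambda>p. A p t) (\<lambda>p s v. a p [] * ?K p s v) w = mark (\<lambda>p u. a p [] * A p t u) ?K w"
      by (intro mark_cong) (simp add: mult_ac)
    then show ?thesis by (simp add: mark_add_right conv_mark_right)
  qed
  have 3: "\<dots> = mark (\<lambda>p. conv (?S (a p) t) (A p) t) ?K w"
  proof -
    have "mark (\<lambda>p. A p t) (\<lambda>p s. mark (\<lambda>q. conv (B p s) (\<lambda>e. conv (?S (\<lambda>u. a q ((p, e) # u)) e) (A q) e) s) ?K) w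
      = mark (\<lambda>q. mark (\<lambda>p. A p t) (\<lambda>p s. conv (B p s) (\<lambda>e. conv (?S (\<lambda>u. a q ((p, e) # u)) e) (A q) e) s)) ?K w"
      by (rule mark_mark[symmetric])
    then show ?thesis
      unfolding sigma_fun_eq[of A B "a _" t]
      by (simp add: mark_add_left[symmetric] conv_add_left conv_unit_left conv_mark_left conv_assoc)
  qed
  show ?case unfolding 1 2 3 ..
qed

lemma sigma_mark:
  "sigma A B (mark a K) t =
     mark (\<lambda>p. conv (sigma A B (a p) t) (A p) t) (\<lambda>p s. conv (B p s) (\<lambda>e. sigma A B (K p e) e) s)"
  by (rule ext) (rule sigma_mark_aux)

text \<open>The inner substitution sends e_p to C_p e_p D_p, and the outer one sends this to
  sigma(C_p) A_p e_p B_p sigma(D_p).\<close>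

lemma sigma_sigma:
  assumes A': "\<And>p t. A' p t = conv (sigma A B (C p t) t) (A p) t"
    and B': "\<And>p t. B' p t = conv (B p t) (\<lambda>s. sigma A B (D p s) s) t"
  shows "sigma A B (sigma C D f t) t w = sigma A' B' f t w"
proof (induction "length w" arbitrary: f t w rule: less_induct)
  case less
  let ?S = "sigma A B" and ?K = "\<lambda>p s. conv (D p s) (\<lambda>e. sigma C D (\<lambda>z. f ((p, e) # z)) e) s"
  have "?S (sigma C D f t) t w = (if w = [] then f [] else 0) + ?S (mark (\<lambda>p. C p t) ?K) t w"
    unfolding sigma_fun_eq[of C D f t] by (simp add: sigma_add sigma_unit)
  also have "?S (mark (\<lambda>p. C p t) ?K) t w = mark (\<lambda>p. A' p t) (\<lambda>p s. conv (B p s) (\<lambda>e. ?S (?K p e) e) s) w"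
    by (simp add: sigma_mark A')
  also have "\<dots> = mark (\<lambda>p. A' p t) (\<lambda>p s. conv (B' p s) (\<lambda>e. sigma A' B' (\<lambda>z. f ((p, e) # z)) e) s) w"
  proof (intro mark_cong mult_cong refl)
    fix u p s v assume w: "w = u @ (p, s) # v"
    have "conv (B p s) (\<lambda>e. ?S (?K p e) e) s v =
      conv (B p s) (\<lambda>e. conv (?S (D p e) e) (\<lambda>e. sigma A' B' (\<lambda>z. f ((p, e) # z)) e) e) s v"
    proof (intro conv_cong mult_cong refl)
      fix u' v' assume v: "v = u' @ v'"
      let ?e = "end_slot s u'"
      show "?S (?K p ?e) ?e v' = conv (?S (D p ?e) ?e) (\<lambda>e. sigma A' B' (\<lambda>z. f ((p, e) # z)) e) ?e v'"
        unfolding sigma_conv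
        by (intro conv_cong mult_cong refl less) (simp add: w v)
    qed
    then show "conv (B p s) (\<lambda>e. ?S (?K p e) e) s v = conv (B' p s) (\<lambda>e. sigma A' B' (\<lambda>z. f ((p, e) # z)) e) s v"
      by (simp add: B'[of p s] conv_assoc)
  qed
  finally show ?case unfolding sigma_eq[of A' B' f t w] .
qed

text \<open>Only factors of \<open>w\<close> matter: A_p on a stretch that ends just before a letter
  e_p, and B_p on a stretch that begins just after one. Laws valid for increasing letters alone can
  thus be used inside a substitution.\<close>

lemma sigma_cong:
  assumes "\<And>u p s v x. w = x @ u @ (p, s) # v \<Longrightarrow> A p (end_slot t x) u = A' p (end_slot t x) u"
    and "\<And>p s u v x. w = x @ (p, s) # u @ v \<Longrightarrow> B p s u = B' p s u"
  shows "sigma A B f t w = sigma A' B' f t w"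
  using assms
proof (induction "length w" arbitrary: f t w rule: less_induct)
  case less
  have "mark (\<lambda>p. A p t) (\<lambda>p s. conv (B p s) (\<lambda>e. sigma A B (\<lambda>z. f ((p, e) # z)) e) s) w =
    mark (\<lambda>p. A' p t) (\<lambda>p s. conv (B' p s) (\<lambda>e. sigma A' B' (\<lambda>z. f ((p, e) # z)) e) s) w"
  proof (intro mark_cong conv_cong mult_cong)
    fix u p s v assume w: "w = u @ (p, s) # v"
    show "A p t u = A' p t u" using less.prems(1)[of "[]" u p s v] w by simp
    fix u' v' assume v: "v = u' @ v'"
    show "B p s u' = B' p s u'" using less.prems(2)[of u p s u' v'] w v by simp
    show "sigma A B (\<lambda>z. f ((p, end_slot s u') # z)) (end_slot s u') v' =
      sigma A' B' (\<lambda>z. f ((p, end_slot s u') # z)) (end_slot s u') v'"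
    proof (rule less.hyps)
      show "length v' < length w" by (simp add: w v)
      show "A pa (end_slot (end_slot s u') x) ua = A' pa (end_slot (end_slot s u') x) ua"
        if "v' = x @ ua @ (pa, sa) # va" for ua pa sa va x
        using less.prems(1)[of "u @ (p, s) # u' @ x" ua pa sa va] that w v by simp
      show "B pa sa ua = B' pa sa ua" if "v' = x @ (pa, sa) # ua @ va" for pa sa ua va x
        using less.prems(2)[of "u @ (p, s) # u' @ x" pa sa ua va] that w v by simp
    qed
  qed
  then show ?case
    unfolding sigma_eq[of A B f t w] sigma_eq[of A' B' f t w] by simp
qed

text \<open>The two scalars cancel in A_p e_p B_p. Hence the substitution does not depend on the
  base slot by which paths are normalized.\<close>

lemma sigma_rescale:
  assumes "\<And>p t u. A' p t u = c p * A p t u" "\<And>p t u. B' p t u = d p * B p t u" "\<And>p. c p * d p = 1"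
  shows "sigma A' B' f t w = sigma A B f t w"
proof (induction "length w" arbitrary: f t w rule: less_induct)
  case less
  have "mark (\<lambda>p. A' p t) (\<lambda>p s. conv (B' p s) (\<lambda>e. sigma A' B' (\<lambda>z. f ((p, e) # z)) e) s) w =
    mark (\<lambda>p. A p t) (\<lambda>p s. conv (B p s) (\<lambda>e. sigma A B (\<lambda>z. f ((p, e) # z)) e) s) w"
  proof (intro mark_cong)
    fix u p s v assume w: "w = u @ (p, s) # v"
    have "conv (B' p s) (\<lambda>e. sigma A' B' (\<lambda>z. f ((p, e) # z)) e) s v =
      d p * conv (B p s) (\<lambda>e. sigma A B (\<lambda>z. f ((p, e) # z)) e) s v"
    proof -
      have "conv (B' p s) (\<lambda>e. sigma A' B' (\<lambda>z. f ((p, e) # z)) e) s v =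
        conv (\<lambda>u. d p * B p s u) (\<lambda>e. sigma A B (\<lambda>z. f ((p, e) # z)) e) s v"
        by (intro conv_cong mult_cong less) (simp_all add: w assms)
      then show ?thesis by (simp add: conv_scale_left)
    qed
    then have "A' p t u * conv (B' p s) (\<lambda>e. sigma A' B' (\<lambda>z. f ((p, e) # z)) e) s v =
      (c p * d p) * (A p t u * conv (B p s) (\<lambda>e. sigma A B (\<lambda>z. f ((p, e) # z)) e) s v)"
      by (simp only: assms(1) mult_ac)
    then show "A' p t u * conv (B' p s) (\<lambda>e. sigma A' B' (\<lambda>z. f ((p, e) # z)) e) s v =
      A p t u * conv (B p s) (\<lambda>e. sigma A B (\<lambda>z. f ((p, e) # z)) e) s v"
      by (simp only: assms(3) mult_1)
  qed
  then show ?case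
    unfolding sigma_eq[of A B f t w] sigma_eq[of A' B' f t w] by simp
qed

lemma conv_snoc:
  "conv f G t (w @ [x]) = conv f (\<lambda>s v. G s (v @ [x])) t w + f (w @ [x]) * G (snd x) []"
  by (induction w arbitrary: f t) (auto simp: algebra_simps)

lemma mark_snoc:
  "mark f K (w @ [x]) = mark f (\<lambda>p s v. K p s (v @ [x])) w + f (fst x) w * K (fst x) (snd x) []"
  by (induction w arbitrary: f) (auto simp: algebra_simps)

text \<open>Here \<open>sigma_eq\<close> is turned into a recursion on the last letter; its slot \<open>b\<close> is where \<open>B\<close> is normalized.\<close>

lemma sigma_snoc:
  fixes A B :: "('l, 's, 'a::comm_ring_1) family"
  assumes B: "\<And>p. B p b [] = 1"
  shows "sigma A B f t (v @ [(q, b)]) = conv (sigma A B (\<lambda>z. f (z @ [(q, b)])) t) (A q) t v +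
    mark (\<lambda>p. conv (sigma A B (\<lambda>z. f (z @ [(p, b)])) t) (A p) t) (\<lambda>p s r. B p s (r @ [(q, b)])) v"
proof (induction "length v" arbitrary: f t v rule: less_induct)
  case less
  let ?S = "sigma A B" and ?x = "(q, b)"
  let ?b = "\<lambda>p s r. B p s (r @ [?x])"
  \<comment> \<open>\<open>P f q t v\<close> is the part in which the last letter of the word is the
    substituted last letter e_q of \<open>f\<close>, followed by an empty B-factor. Otherwise the
    last letter lies in the B-factor of the last letter of \<open>f\<close>, which is recorded by
    \<open>?b\<close>.\<close>
  define P where "P = (\<lambda>f q t. conv (?S (\<lambda>z. f (z @ [(q, b)])) t) (A q) t)"
  have P: "P f q t = (\<lambda>v. f [(q, b)] * A q t v +
      mark (\<lambda>p. A p t) (\<lambda>p s. conv (B p s) (\<lambda>e. P (\<lambda>z. f ((p, e) # z)) q e) s) v)" for f :: "('l, 's) word \<Rightarrow> 'a" and q t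
    unfolding P_def sigma_fun_eq[of A B "\<lambda>z. f (z @ [(q, b)])" t]
    by (simp add: conv_add_left conv_unit_left conv_mark_left conv_assoc)
  have IH: "?S (\<lambda>z. f ((p, e) # z)) e (r @ [?x]) = P (\<lambda>z. f ((p, e) # z)) q e r + mark (\<lambda>p'. P (\<lambda>z. f ((p, e) # z)) p' e) ?b r"
    if "length r < length v" for p e r
    using less[OF that] by (simp add: P_def)
  have "?S f t (v @ [?x]) = mark (\<lambda>p. A p t) (\<lambda>p s r. conv (B p s) (\<lambda>e. ?S (\<lambda>z. f ((p, e) # z)) e) s (r @ [?x])) v +
      A q t v * f [(q, b)]"
    unfolding sigma_eq[of A B f t "v @ [?x]"] by (simp add: mark_snoc sigma_eq[of A B _ _ "[]"] B)
  also have "mark (\<lambda>p. A p t) (\<lambda>p s r. conv (B p s) (\<lambda>e. ?S (\<lambda>z. f ((p, e) # z)) e) s (r @ [?x])) v =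
    mark (\<lambda>p. A p t) (\<lambda>p s r. conv (B p s) (\<lambda>e. P (\<lambda>z. f ((p, e) # z)) q e) s r +
       mark (\<lambda>p'. conv (B p s) (\<lambda>e. P (\<lambda>z. f ((p, e) # z)) p' e) s) ?b r + f [(p, b)] * ?b p s r) v"
  proof (intro mark_cong mult_cong refl)
    fix u p s r assume v: "v = u @ (p, s) # r"
    have "conv (B p s) (\<lambda>e r. ?S (\<lambda>z. f ((p, e) # z)) e (r @ [?x])) s r =
      conv (B p s) (\<lambda>e r. P (\<lambda>z. f ((p, e) # z)) q e r + mark (\<lambda>p'. P (\<lambda>z. f ((p, e) # z)) p' e) ?b r) s r"
      by (intro conv_cong mult_cong refl IH) (simp add: v)
    then show "conv (B p s) (\<lambda>e. ?S (\<lambda>z. f ((p, e) # z)) e) s (r @ [?x]) = conv (B p s) (\<lambda>e. P (\<lambda>z. f ((p, e) # z)) q e) s r +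
       mark (\<lambda>p'. conv (B p s) (\<lambda>e. P (\<lambda>z. f ((p, e) # z)) p' e) s) ?b r + f [(p, b)] * ?b p s r"
      by (simp add: conv_snoc conv_add_right conv_mark_right sigma_eq[of A B _ _ "[]"])
  qed
  also have "\<dots> = mark (\<lambda>p. A p t) (\<lambda>p s. conv (B p s) (\<lambda>e. P (\<lambda>z. f ((p, e) # z)) q e) s) v +
     mark (\<lambda>p. mark (\<lambda>p. A p t) (\<lambda>p' s. conv (B p' s) (\<lambda>e. P (\<lambda>z. f ((p', e) # z)) p e) s)) ?b v +
     mark (\<lambda>p r. f [(p, b)] * A p t r) ?b v"
  proof -
    have "mark (\<lambda>p. A p t) (\<lambda>p s r. f [(p, b)] * ?b p s r) v = mark (\<lambda>p r. f [(p, b)] * A p t r) ?b v"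
      by (intro mark_cong) simp
    then show ?thesis by (simp add: mark_add_right mark_mark)
  qed
  also have "\<dots> + A q t v * f [(q, b)] = P f q t v + mark (\<lambda>p. P f p t) ?b v"
    unfolding P[of f _ t] by (simp add: mark_add_left)
  finally show ?case by (simp add: P_def)
qed

section \<open>The nonunital algebra of kernels between two letters\<close>

definition letter_comp :: "('l, 's, 'a::comm_ring_1) kernel \<Rightarrow>
    ('l, 's, 'a) kernel \<Rightarrow> ('l, 's, 'a) kernel" where
  "letter_comp M N p s w P = mark (\<lambda>q u. M p s u q) (\<lambda>q s' v. N q s' v P) w"

text \<open>A product of kernels sums over an intermediate letter of the word and so vanishes on the
  empty word. There is no unit, which is why later identities appear expanded.\<close>

lemma letter_comp_assoc: "letter_comp (letter_comp M N) L = letter_comp M (letter_comp N L)"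
  unfolding letter_comp_def by (intro ext) (rule mark_mark)

lemma comp_add_left: "letter_comp (\<lambda>p s w P. M p s w P + N p s w P) L = (\<lambda>p s w P. letter_comp M L p s w P + letter_comp N L p s w P)"
  and comp_add_right: "letter_comp L (\<lambda>p s w P. M p s w P + N p s w P) = (\<lambda>p s w P. letter_comp L M p s w P + letter_comp L N p s w P)"
  and comp_scale_left: "letter_comp (\<lambda>p s w P. c * M p s w P) L = (\<lambda>p s w P. c * letter_comp M L p s w P)"
  and comp_scale_right: "letter_comp L (\<lambda>p s w P. c * M p s w P) = (\<lambda>p s w P. c * letter_comp L M p s w P)"
  unfolding letter_comp_def by (simp_all add: mark_add_left mark_add_right mark_scale_left mark_scale_right)

lemma comp_diff_left: "letter_comp (\<lambda>p s w P. M p s w P - N p s w P) L = (\<lambda>p s w P. letter_comp M L p s w P - letter_comp N L p s w P)"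
  using comp_add_left[of M "\<lambda>p s w P. - 1 * N p s w P" L] unfolding comp_scale_left by simp
lemma comp_diff_right: "letter_comp L (\<lambda>p s w P. M p s w P - N p s w P) = (\<lambda>p s w P. letter_comp L M p s w P - letter_comp L N p s w P)"
  using comp_add_right[of L M "\<lambda>p s w P. - 1 * N p s w P"] unfolding comp_scale_right by simp

text \<open>The range of validity of the relations: increasing letters strictly between e_p and e_P,
  with slots from \<open>D\<close>. It is inherited by both sides of a cut at a letter and by the
  words that a substitution hands to its argument, so the kernel calculus can be restricted to
  it.\<close>

definition ok_word :: "'l set \<Rightarrow> 's set \<Rightarrow> 'l::linorder \<Rightarrow> ('l, 's) word \<Rightarrow> 'l \<Rightarrow> bool" where
  "ok_word C D p w P \<longleftrightarrow> sorted_wrt (<) (p # map fst w @ [P]) \<and> set (p # map fst w @ [P]) \<subseteq> C \<and> snd ` set w \<subseteq> D"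

lemma ok_word_mark:
  assumes "ok_word C D p (u @ (q, s) # v) P"
  shows "ok_word C D p u q" "s \<in> D" "ok_word C D q v P" "p < q" "p \<in> C"
  using assms by (auto simp: ok_word_def sorted_wrt_append)

lemma ok_word_append:
  assumes "ok_word C D p (u @ v) P"
  shows "ok_word C D p u P" "ok_word C D p v P"
  using assms by (auto simp: ok_word_def sorted_wrt_append)

lemma ok_word_Cons: "ok_word C D q z P \<Longrightarrow> p < q \<Longrightarrow> p \<in> C \<Longrightarrow> s \<in> D \<Longrightarrow> ok_word C D p ((q, s) # z) P"
  by (auto simp: ok_word_def sorted_wrt_append)

lemma ok_word_end_slot: "ok_word C D p u P \<Longrightarrow> s \<in> D \<Longrightarrow> end_slot s u \<in> D"
  by (induction u arbitrary: s p) (auto simp: ok_word_def)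

lemma letter_comp_cong:
  assumes "ok_word C D p w P" "s \<in> D"
    and "\<And>p s w P. ok_word C D p w P \<Longrightarrow> s \<in> D \<Longrightarrow> M p s w P = M' p s w P"
    and "\<And>p s w P. ok_word C D p w P \<Longrightarrow> s \<in> D \<Longrightarrow> N p s w P = N' p s w P"
  shows "letter_comp M N p s w P = letter_comp M' N' p s w P"
  unfolding letter_comp_def
proof (intro mark_cong)
  fix u q s' v assume "w = u @ (q, s') # v"
  with assms(1) have "ok_word C D p (u @ (q, s') # v) P" by simp
  note ok_word_mark[OF this]
  then show "M p s u q * N q s' v P = M' p s u q * N' q s' v P" using assms by simp
qed

text \<open>The words at which \<open>f\<close> is evaluated have a subsequence of the letters of
  \<open>w\<close> and slots taken from \<open>w\<close>, hence remain admissible.\<close>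

lemma sigma_cong_fun:
  assumes "ok_word C D p w P" "\<And>z. ok_word C D p z P \<Longrightarrow> f z = g z"
  shows "sigma A B f t w = sigma A B g t w"
  using assms
proof (induction "length w" arbitrary: f g t w p rule: less_induct)
  case less
  have "mark (\<lambda>p. A p t) (\<lambda>p s. conv (B p s) (\<lambda>e. sigma A B (\<lambda>z. f ((p, e) # z)) e) s) w =
    mark (\<lambda>p. A p t) (\<lambda>p s. conv (B p s) (\<lambda>e. sigma A B (\<lambda>z. g ((p, e) # z)) e) s) w"
  proof (intro mark_cong conv_cong mult_cong refl)
    fix u q s v u' v' assume w: "w = u @ (q, s) # v" and v: "v = u' @ v'"
    from less.prems(1) have "ok_word C D p (u @ (q, s) # u' @ v') P" by (simp add: w v)
    note q = ok_word_mark[OF this]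
    have "end_slot s u' \<in> D" by (rule ok_word_end_slot[OF ok_word_append(1)[OF q(3)] q(2)])
    then show "sigma A B (\<lambda>z. f ((q, end_slot s u') # z)) (end_slot s u') v' =
        sigma A B (\<lambda>z. g ((q, end_slot s u') # z)) (end_slot s u') v'"
      using less.prems(2) q
      by (intro less.hyps[of _ q]) (auto simp: w v intro: ok_word_append ok_word_Cons)
  qed
  moreover have "f [] = g []" if "w = []" using less.prems that by simp
  ultimately show ?case unfolding sigma_eq[of A B f t w] sigma_eq[of A B g t w] by simp
qed

text \<open>
  For $p < P$ the letters next to a word, the functions of $(p, s, w, P)$ below are the coefficients of
  $e_p\,e_0^s\,w\,e_P$, the exponent of $e_0$ after $e_p$ being encoded by \<open>s\<close>.
\<close>

definition head_coeff :: "('l, 's, 'a) family \<Rightarrow> 's \<Rightarrow> ('l, 's, 'a) kernel" where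
  "head_coeff A b = (\<lambda>q s r P. A P b ((q, s) # r))"

definition last_coeff :: "('l, 's, 'a) family \<Rightarrow> 's \<Rightarrow> ('l, 's, 'a) kernel" where
  "last_coeff B b = (\<lambda>p s u q. B p s (u @ [(q, b)]))"

definition slot_weight :: "('s \<Rightarrow> 'a::comm_ring_1) \<Rightarrow> ('l, 's, 'a) kernel" where
  "slot_weight \<rho> = (\<lambda>p s w P. if w = [] then \<rho> s else 0)"

text \<open>
  The coefficient of $B_p e_0^{-1} A_P$, with denominators cleared: in the applications
  \<open>\<rho> s = c / (s - b)\<close>, so that the slot \<open>b\<close> plays the role of $e_0 = 0$.
\<close>

definition through :: "('s \<Rightarrow> 'a) \<Rightarrow> ('l, 's, 'a) family \<Rightarrow> ('l, 's, 'a::comm_ring_1) family \<Rightarrow>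
    ('l, 's, 'a) kernel" where
  "through \<rho> A B = (\<lambda>p s w P. conv (B p s) (\<lambda>s' r. \<rho> s' * A P s' r) s w)"

text \<open>With a unit adjoined this is c + (1 + d)(R - c)(1 + a), multiplied out; the two
  occurrences of c times the unit cancel.\<close>

definition through_rhs :: "('s \<Rightarrow> 'a) \<Rightarrow> 'a \<Rightarrow> 's \<Rightarrow> ('l, 's, 'a) family \<Rightarrow> ('l, 's, 'a::comm_ring_1) family \<Rightarrow>
    ('l, 's, 'a) kernel" where
  "through_rhs \<rho> c b A B = (let R = slot_weight \<rho>; a = head_coeff A b; d = last_coeff B b in
     (\<lambda>p s w P. R p s w P + letter_comp d R p s w P + letter_comp R a p s w P + letter_comp d (letter_comp R a) p s w P
       - c * (a p s w P + d p s w P + letter_comp d a p s w P)))"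

section \<open>Inheritance of the relation under composition\<close>

locale composition =
  fixes A1 B1 A2 B2 A B :: "('l::linorder, 's, 'a::comm_ring_1) family"
  assumes A: "\<And>p t. A p t = conv (sigma A2 B2 (A1 p t) t) (A2 p) t"
    and B: "\<And>p t. B p t = conv (B2 p t) (\<lambda>s. sigma A2 B2 (B1 p s) s) t"
begin

text \<open>The substitution takes e_p M e_P to A_p e_p B_p sigma(M) A_P e_P B_P. Stripping the
  outermost A_p and B_P leaves this kernel, and the factors stripped are exactly those that meet at
  an intermediate letter in a product, whence multiplicativity.\<close>

definition lift :: "('l, 's, 'a) kernel \<Rightarrow> ('l, 's, 'a) kernel" where
  "lift M p s w P = conv (B2 p s) (\<lambda>e. conv (sigma A2 B2 (\<lambda>z. M p e z P) e) (A2 P) e) s w"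

lemma lift_comp: "lift (letter_comp M N) = letter_comp (lift M) (lift N)"
proof (intro ext)
  fix p s w P
  show "lift (letter_comp M N) p s w P = letter_comp (lift M) (lift N) p s w P"
    unfolding lift_def letter_comp_def
    by (simp add: sigma_mark conv_mark_left conv_mark_right conv_assoc)
qed

text \<open>\<open>slot_weight\<close> stands for e_0^{-1} between two letters. The substitution
  leaves it alone, and the outer factors turn it into B e_0^{-1} A for the second pair.\<close>

lemma lift_slot_weight: "lift (slot_weight \<rho>) = through \<rho> A2 B2"
  unfolding lift_def[abs_def] through_def slot_weight_def by (simp add: sigma_unit conv_unit_left)

lemma lift_through: "lift (through \<rho> A1 B1) = through \<rho> A B"
proof (intro ext)
  fix p s w P
  have "lift (through \<rho> A1 B1) p s w P =
      conv (B2 p s) (\<lambda>e. conv (sigma A2 B2 (conv (B1 p e) (\<lambda>s' r. \<rho> s' * A1 P s' r) e) e) (A2 P) e) s w"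
    by (simp add: lift_def through_def)
  also have "\<dots> = conv (B2 p s) (\<lambda>e. conv (sigma A2 B2 (B1 p e) e) (\<lambda>s' r. \<rho> s' * A P s' r) e) s w"
    by (simp add: sigma_conv sigma_scale conv_assoc conv_scale_left A)
  also have "\<dots> = through \<rho> A B p s w P"
    by (simp add: through_def B conv_assoc)
  finally show "lift (through \<rho> A1 B1) p s w P = through \<rho> A B p s w P" .
qed

lemma lift_add: "lift (\<lambda>p s w P. M p s w P + N p s w P) = (\<lambda>p s w P. lift M p s w P + lift N p s w P)"
  and lift_diff: "lift (\<lambda>p s w P. M p s w P - N p s w P) = (\<lambda>p s w P. lift M p s w P - lift N p s w P)"
  and lift_scale: "lift (\<lambda>p s w P. c * M p s w P) = (\<lambda>p s w P. c * lift M p s w P)"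
proof -
  show *: "lift (\<lambda>p s w P. M p s w P + N p s w P) = (\<lambda>p s w P. lift M p s w P + lift N p s w P)" for M N
    by (intro ext) (simp add: lift_def sigma_add conv_add_left conv_add_right)
  show **: "lift (\<lambda>p s w P. c * M p s w P) = (\<lambda>p s w P. c * lift M p s w P)" for M c
    by (intro ext) (simp add: lift_def sigma_scale conv_scale_left conv_scale_right)
  show "lift (\<lambda>p s w P. M p s w P - N p s w P) = (\<lambda>p s w P. lift M p s w P - lift N p s w P)"
    using *[of M "\<lambda>p s w P. - 1 * N p s w P"] unfolding ** by simp
qed

lemma lift_cong:
  assumes "ok_word C D p w P" "s \<in> D"
    and "\<And>p s w P. ok_word C D p w P \<Longrightarrow> s \<in> D \<Longrightarrow> M p s w P = N p s w P"
  shows "lift M p s w P = lift N p s w P"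
  unfolding lift_def
proof (intro conv_cong mult_cong refl)
  fix u v u' v' assume w: "w = u @ v" "v = u' @ v'"
  let ?e = "end_slot s u"
  have "ok_word C D p (u @ u' @ v') P" using assms(1) w by simp
  then have "ok_word C D p u P" "ok_word C D p u' P" by (auto dest: ok_word_append)
  moreover from this have "?e \<in> D" using assms(2) by (intro ok_word_end_slot)
  ultimately show "sigma A2 B2 (\<lambda>z. M p ?e z P) ?e u' = sigma A2 B2 (\<lambda>z. N p ?e z P) ?e u'"
    using assms(3) by (intro sigma_cong_fun) auto
qed

text \<open>With a unit adjoined: 1 + a = (1 + a_2)(1 + lift a_1). When sigma(A_1) is expanded along
  its first substituted letter, the A_2 in front of that letter is either empty or contributes
  a_2.\<close>

lemma head_coeff_composition:
  assumes "\<And>p. A1 p b [] = 1" "\<And>p. A2 p b [] = 1"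
  shows "head_coeff A b = (\<lambda>p s w P. head_coeff A2 b p s w P + lift (head_coeff A1 b) p s w P +
    letter_comp (head_coeff A2 b) (lift (head_coeff A1 b)) p s w P)"
proof (intro ext)
  fix q s r P
  show "head_coeff A b q s r P = head_coeff A2 b q s r P + lift (head_coeff A1 b) q s r P +
    letter_comp (head_coeff A2 b) (lift (head_coeff A1 b)) q s r P"
    unfolding head_coeff_def letter_comp_def lift_def A
    unfolding sigma_fun_eq[of A2 B2 "A1 P b" b]
    by (simp add: assms conv_add_left conv_mark_left conv_assoc)
qed

text \<open>With a unit adjoined: 1 + d = (1 + lift d_1)(1 + d_2). This is the mirror image of the
  preceding factorization, with the expansion along the last letter supplied by
  \<open>sigma_snoc\<close>.\<close>

lemma last_coeff_composition:
  assumes "\<And>p. B1 p b [] = 1" "\<And>p. B2 p b [] = 1"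
  shows "last_coeff B b = (\<lambda>p s w P. last_coeff B2 b p s w P + lift (last_coeff B1 b) p s w P +
    letter_comp (lift (last_coeff B1 b)) (last_coeff B2 b) p s w P)"
proof (intro ext)
  fix p s w q
  show "last_coeff B b p s w q = last_coeff B2 b p s w q + lift (last_coeff B1 b) p s w q +
    letter_comp (lift (last_coeff B1 b)) (last_coeff B2 b) p s w q"
    unfolding last_coeff_def letter_comp_def lift_def B
    by (simp add: conv_snoc sigma_snoc[where b = b] assms sigma_eq[of A2 B2 _ _ "[]"]
        conv_add_right conv_mark_right)
qed

text \<open>Applying \<open>lift\<close> to the relation of the first pair replaces R by the kernel
  \<open>?K\<close> of the second pair; the relation of the second pair is then inserted for
  \<open>?K\<close>, and the outer factors merge by the two factorizations above.\<close>

lemma through_composition: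
  assumes 1: "\<And>p s w P. ok_word C D p w P \<Longrightarrow> s \<in> D \<Longrightarrow> through \<rho> A1 B1 p s w P = through_rhs \<rho> c b A1 B1 p s w P"
    and 2: "\<And>p s w P. ok_word C D p w P \<Longrightarrow> s \<in> D \<Longrightarrow> through \<rho> A2 B2 p s w P = through_rhs \<rho> c b A2 B2 p s w P"
    and unit: "\<And>p. A1 p b [] = 1" "\<And>p. B1 p b [] = 1" "\<And>p. A2 p b [] = 1" "\<And>p. B2 p b [] = 1"
    and ok: "ok_word C D p w P" "s \<in> D"
  shows "through \<rho> A B p s w P = through_rhs \<rho> c b A B p s w P"
proof -
  let ?C = "lift (last_coeff B1 b)" and ?D = "lift (head_coeff A1 b)"
  let ?K = "through \<rho> A2 B2" and ?E = "through_rhs \<rho> c b A2 B2"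
  have "through \<rho> A B p s w P = lift (through_rhs \<rho> c b A1 B1) p s w P"
    unfolding lift_through[symmetric] using 1 by (intro lift_cong[OF ok])
  also have "\<dots> = ?K p s w P + letter_comp ?C ?K p s w P + letter_comp ?K ?D p s w P + letter_comp ?C (letter_comp ?K ?D) p s w P
      - c * (?D p s w P + ?C p s w P + letter_comp ?C ?D p s w P)"
    by (simp add: through_rhs_def Let_def lift_add lift_diff lift_scale lift_comp lift_slot_weight)
  also have "?K p s w P = ?E p s w P" using 2 ok by simp
  also have "letter_comp ?C ?K p s w P = letter_comp ?C ?E p s w P" using 2 by (intro letter_comp_cong[OF ok]) auto
  also have "letter_comp ?K ?D p s w P = letter_comp ?E ?D p s w P" using 2 by (intro letter_comp_cong[OF ok]) auto
  also have "letter_comp ?C (letter_comp ?K ?D) p s w P = letter_comp ?C (letter_comp ?E ?D) p s w P"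
    using 2 by (intro letter_comp_cong[OF ok] refl letter_comp_cong) auto
  also have "?E p s w P + letter_comp ?C ?E p s w P + letter_comp ?E ?D p s w P + letter_comp ?C (letter_comp ?E ?D) p s w P
      - c * (?D p s w P + ?C p s w P + letter_comp ?C ?D p s w P) = through_rhs \<rho> c b A B p s w P"
    unfolding through_rhs_def Let_def head_coeff_composition[OF unit(1,3)] last_coeff_composition[OF unit(2,4)]
    by (simp add: comp_add_left comp_add_right comp_diff_left comp_diff_right comp_scale_left
        comp_scale_right letter_comp_assoc algebra_simps)
  finally show ?thesis .
qed

end

section \<open>Graded sums and substitution\<close>

lemma mseries_eqI: "(\<And>m. coeff f m = coeff g m) \<Longrightarrow> f = g"
  by (metis coeff_inject ext)

lemmas coeff_simps = zero_mseries.rep_eq one_mseries.rep_eq plus_mseries.rep_eq minus_mseries.rep_eq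
  uminus_mseries.rep_eq const_series.rep_eq tvar.rep_eq MSeries_inverse[OF UNIV_I]

lemma total_degree_superset: "finite A \<Longrightarrow> Poly_Mapping.keys m \<subseteq> A \<Longrightarrow> total_degree m = (\<Sum>i\<in>A. Poly_Mapping.lookup m i)"
  unfolding total_degree_def by (intro sum.mono_neutral_left) (auto simp: in_keys_iff)

lemma total_degree_add: "total_degree (a + b) = total_degree a + total_degree b"
proof -
  let ?A = "Poly_Mapping.keys a \<union> Poly_Mapping.keys b"
  have "Poly_Mapping.keys (a + b) \<subseteq> ?A" by (rule Poly_Mapping.keys_add)
  then show ?thesis
    by (simp add: total_degree_superset[of ?A] lookup_add sum.distrib)
qed

lemma total_degree_zero [simp]: "total_degree 0 = 0"
  by (simp add: total_degree_def)

lemma total_degree_eq_0: "total_degree m = 0 \<Longrightarrow> m = 0"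
  unfolding total_degree_def by (intro poly_mapping_eqI) (auto simp: in_keys_iff)

lemma total_degree_single [simp]: "total_degree (Poly_Mapping.single i n) = n"
  by (cases "n = 0") (simp_all add: total_degree_def)

lemma lookup_le_total_degree: "Poly_Mapping.lookup m i \<le> total_degree m"
proof (cases "i \<in> Poly_Mapping.keys m")
  case True
  then show ?thesis unfolding total_degree_def by (intro member_le_sum) auto
qed (simp add: in_keys_iff)

definition order_ge :: "nat \<Rightarrow> 'a::comm_ring_1 mseries \<Rightarrow> bool" where
  "order_ge N f \<longleftrightarrow> (\<forall>m. total_degree m < N \<longrightarrow> coeff f m = 0)"

definition small :: "'a::comm_ring_1 mseries \<Rightarrow> bool" where
  "small f \<longleftrightarrow> coeff f 0 = 0"

lemma order_ge_1: "small f \<Longrightarrow> order_ge 1 f"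
  using total_degree_eq_0 by (auto simp: order_ge_def small_def)

lemma order_ge_times:
  assumes "order_ge M f" "order_ge N g" shows "order_ge (M + N) (f * g)"
  unfolding order_ge_def
proof (intro allI impI)
  fix m assume m: "total_degree m < M + N"
  have "coeff f a * coeff g b = 0" if "a + b = m" for a b
  proof -
    have "total_degree a < M \<or> total_degree b < N" using m that total_degree_add[of a b] by force
    then show ?thesis using assms by (auto simp: order_ge_def)
  qed
  then show "coeff (f * g) m = 0"
    by (auto simp: times_mseries.rep_eq splits_def intro!: sum.neutral)
qed

lemma order_ge_0 [simp]: "order_ge 0 f"
  by (simp add: order_ge_def)

lemma order_ge_power: "small f \<Longrightarrow> order_ge n (f ^ n)"
  by (induction n) (use order_ge_times[OF order_ge_1] in \<open>auto\<close>)

lemma order_ge_const_times: "order_ge N f \<Longrightarrow> order_ge N (const_series a * f)"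
  using order_ge_times[of 0 "const_series a" N f] by simp

lemma order_ge_prod: "(\<And>x. x \<in> A \<Longrightarrow> order_ge (d x) (f x)) \<Longrightarrow> order_ge (sum d A) (prod f A)"
  by (induction A rule: infinite_finite_induct) (auto intro: order_ge_times)

lemma small_diff: "small f \<Longrightarrow> small g \<Longrightarrow> small (f - g)"
  and small_uminus: "small f \<Longrightarrow> small (- f)"
  and small_tvar [simp]: "small (tvar i)"
  and small_zero [simp]: "small 0"
  by (auto simp: small_def coeff_simps dest: arg_cong[where f = "\<lambda>m. Poly_Mapping.lookup m i"])

text \<open>Summability in the topology given by total degree: finitely many members up to each
  degree, the i-th one vanishing below order \<open>d i\<close>.\<close>

definition graded :: "'i set \<Rightarrow> ('i \<Rightarrow> nat) \<Rightarrow> ('i \<Rightarrow> 'a::comm_ring_1 mseries) \<Rightarrow> bool" where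
  "graded I d F \<longleftrightarrow> (\<forall>N. finite {i \<in> I. d i \<le> N}) \<and> (\<forall>i\<in>I. order_ge (d i) (F i))"

definition gsum :: "'i set \<Rightarrow> ('i \<Rightarrow> nat) \<Rightarrow> ('i \<Rightarrow> 'a::comm_ring_1 mseries) \<Rightarrow> 'a mseries" where
  "gsum I d F = MSeries (\<lambda>m. \<Sum>i\<in>{i \<in> I. d i \<le> total_degree m}. coeff (F i) m)"

text \<open>The freedom in \<open>N\<close> permits one common truncation for all factors of a
  monomial, as products require.\<close>

lemma coeff_gsum:
  assumes "graded I d F" "total_degree m \<le> N"
  shows "coeff (gsum I d F) m = (\<Sum>i\<in>{i \<in> I. d i \<le> N}. coeff (F i) m)"
  unfolding gsum_def coeff_simps
proof (intro sum.mono_neutral_left ballI)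
  show "coeff (F i) m = 0" if "i \<in> {i \<in> I. d i \<le> N} - {i \<in> I. d i \<le> total_degree m}" for i
  proof -
    have "total_degree m < d i" "i \<in> I" using that by auto
    then show ?thesis using assms(1) by (auto simp: graded_def order_ge_def)
  qed
qed (use assms in \<open>auto simp: graded_def\<close>)

lemma gsum_cong: "(\<And>i. i \<in> I \<Longrightarrow> F i = G i) \<Longrightarrow> gsum I d F = gsum I d G"
  unfolding gsum_def by (intro arg_cong[where f = MSeries] ext sum.cong) auto

lemma graded_times:
  assumes "graded I d F" "graded J e G"
  shows "graded (I \<times> J) (\<lambda>(i, j). d i + e j) (\<lambda>(i, j). F i * G j)"
  unfolding graded_def
proof (intro conjI allI ballI)
  fix N
  have "{x \<in> I \<times> J. (case x of (i, j) \<Rightarrow> d i + e j) \<le> N} \<subseteq> {i \<in> I. d i \<le> N} \<times> {j \<in> J. e j \<le> N}" by auto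
  then show "finite {x \<in> I \<times> J. (case x of (i, j) \<Rightarrow> d i + e j) \<le> N}"
    by (rule finite_subset) (use assms in \<open>auto simp: graded_def\<close>)
qed (use assms in \<open>auto simp: graded_def intro: order_ge_times\<close>)

lemma coeff_sum_times_sum:
  "(\<Sum>(a, b)\<in>splits m. (\<Sum>i\<in>A. coeff (F i) a) * (\<Sum>j\<in>B. coeff (G j) b)) = (\<Sum>i\<in>A. \<Sum>j\<in>B. coeff (F i * G j) m)"
proof -
  have "(\<Sum>i\<in>A. \<Sum>j\<in>B. coeff (F i * G j) m) = coeff (sum F A * sum G B) m"
    by (simp add: coeff_sum sum_product)
  then show ?thesis by (simp add: times_mseries.rep_eq coeff_sum)
qed

lemma gsum_times:
  assumes F: "graded I d F" and G: "graded J e G"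
  shows "gsum I d F * gsum J e G = gsum (I \<times> J) (\<lambda>(i, j). d i + e j) (\<lambda>(i, j). F i * G j)"
proof (rule mseries_eqI)
  fix m
  let ?N = "total_degree m" and ?D = "\<lambda>(i, j). d i + e j" and ?H = "\<lambda>(i, j). F i * G j"
  let ?A = "{i \<in> I. d i \<le> ?N}" and ?B = "{j \<in> J. e j \<le> ?N}"
  have "coeff (gsum I d F * gsum J e G) m =
      (\<Sum>(a, b)\<in>splits m. (\<Sum>i\<in>?A. coeff (F i) a) * (\<Sum>j\<in>?B. coeff (G j) b))"
    unfolding times_mseries.rep_eq
  proof (intro sum.cong refl, clarify)
    fix a b assume "(a, b) \<in> splits m"
    then have "total_degree a \<le> ?N" "total_degree b \<le> ?N" by (auto simp: splits_def total_degree_add)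
    then show "coeff (gsum I d F) a * coeff (gsum J e G) b = (\<Sum>i\<in>?A. coeff (F i) a) * (\<Sum>j\<in>?B. coeff (G j) b)"
      by (simp add: coeff_gsum[OF F] coeff_gsum[OF G])
  qed
  also have "\<dots> = (\<Sum>x\<in>?A \<times> ?B. coeff (?H x) m)"
    unfolding coeff_sum_times_sum by (simp add: sum.cartesian_product case_prod_unfold)
  also have "\<dots> = (\<Sum>x\<in>{x \<in> I \<times> J. ?D x \<le> ?N}. coeff (?H x) m)"
  proof (intro sum.mono_neutral_right ballI)
    fix x assume x: "x \<in> ?A \<times> ?B - {x \<in> I \<times> J. ?D x \<le> ?N}"
    then have "order_ge (?D x) (?H x)" using graded_times[OF F G] unfolding graded_def by blast
    moreover have "?N < ?D x" using x by auto
    ultimately show "coeff (?H x) m = 0" by (auto simp: order_ge_def)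
  qed (use F G in \<open>auto simp: graded_def\<close>)
  finally show "coeff (gsum I d F * gsum J e G) m = coeff (gsum (I \<times> J) ?D ?H) m"
    using coeff_gsum[OF graded_times[OF F G] order_refl] by simp
qed

text \<open>Collects the double sum of a Cauchy product along addition of degrees or
  exponents.\<close>

lemma gsum_fibres:
  assumes F: "graded K d F" and J: "\<And>k. k \<in> K \<Longrightarrow> \<pi> k \<in> J \<and> e (\<pi> k) = d k"
    and fin: "\<And>N. finite {j \<in> J. e j \<le> N}"
  shows "gsum K d F = gsum J e (\<lambda>j. \<Sum>k\<in>{k \<in> K. \<pi> k = j}. F k)"
proof (rule mseries_eqI)
  fix m
  let ?N = "total_degree m"
  have "(\<Sum>k\<in>{k \<in> K. d k \<le> ?N}. coeff (F k) m) =
      (\<Sum>j\<in>{j \<in> J. e j \<le> ?N}. \<Sum>k\<in>{k \<in> {k \<in> K. d k \<le> ?N}. \<pi> k = j}. coeff (F k) m)"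
    using F J fin by (intro sum.group[symmetric]) (auto simp: graded_def)
  also have "\<dots> = (\<Sum>j\<in>{j \<in> J. e j \<le> ?N}. coeff (\<Sum>k\<in>{k \<in> K. \<pi> k = j}. F k) m)"
    unfolding coeff_sum using J by (intro sum.cong refl) auto
  finally show "coeff (gsum K d F) m = coeff (gsum J e (\<lambda>j. \<Sum>k\<in>{k \<in> K. \<pi> k = j}. F k)) m"
    unfolding gsum_def coeff_simps .
qed

lemma gsum_reindex:
  assumes "graded K d F" "bij_betw \<pi> K J" "\<And>k. k \<in> K \<Longrightarrow> e (\<pi> k) = d k" "\<And>k. k \<in> K \<Longrightarrow> G (\<pi> k) = F k"
  shows "gsum K d F = gsum J e G"
proof (rule mseries_eqI)
  fix m
  have "bij_betw \<pi> {k \<in> K. d k \<le> total_degree m} {j \<in> J. e j \<le> total_degree m}"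
    using assms(2,3) unfolding bij_betw_def by (auto intro: inj_on_subset)
  then have "(\<Sum>j\<in>{j \<in> J. e j \<le> total_degree m}. coeff (G j) m) = (\<Sum>k\<in>{k \<in> K. d k \<le> total_degree m}. coeff (G (\<pi> k)) m)"
    by (rule sum.reindex_bij_betw[symmetric])
  then show "coeff (gsum K d F) m = coeff (gsum J e G) m"
    unfolding gsum_def coeff_simps using assms(4) by simp
qed

section \<open>Exponentials and substitution of series\<close>

type_synonym 'm series = "('m \<Rightarrow>\<^sub>0 rat) mseries"
type_synonym 'k point = "hbar \<Rightarrow> ('k \<Rightarrow>\<^sub>0 rat)"

definition mseries_exp :: "'m::comm_monoid_add series \<Rightarrow> 'm series" where
  "mseries_exp z = gsum UNIV (\<lambda>n. n) (\<lambda>n. const_series (scalar (1 / fact n)) * z ^ n)"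

lemma graded_exp: "small z \<Longrightarrow> graded UNIV (\<lambda>n. n) (\<lambda>n. const_series (scalar (1 / fact n)) * z ^ n)"
  by (auto simp: graded_def intro: order_ge_const_times order_ge_power)

lemma const_series_add: "const_series (a + b) = const_series a + const_series b"
  by (rule mseries_eqI) (simp add: coeff_simps)
lemma const_series_times: "const_series (a * b) = const_series a * const_series (b :: 'a::comm_ring_1)"
  by (rule mseries_eqI) (auto simp: coeff_const_times coeff_simps)
lemma const_series_power: "const_series (a ^ n) = const_series (a :: 'a::comm_ring_1) ^ n"
  by (induction n) (simp_all add: const_series_times, simp add: const_series_def one_mseries_def id_def)
lemma const_series_1 [simp]: "const_series 1 = (1 :: 'a::comm_ring_1 mseries)"
  by (simp add: const_series_def one_mseries_def id_def)
lemma const_series_0 [simp]: "const_series 0 = (0 :: 'a::comm_ring_1 mseries)"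
  by (rule mseries_eqI) (simp add: coeff_simps)

lemma scalar_1 [simp]: "scalar 1 = 1"
  by (simp add: scalar_def)
lemma scalar_times: "scalar (a * b) = scalar a * scalar b"
  by (simp add: scalar_def mult_single)
lemma scalar_add: "scalar (a + b) = scalar a + scalar b"
  by (simp add: scalar_def single_add)
lemma scalar_0 [simp]: "scalar 0 = 0"
  by (simp add: scalar_def)
lemma scalar_of_nat: "scalar (of_nat n) = of_nat n"
  by (induction n) (simp_all add: scalar_add)
lemma const_series_of_nat: "const_series (of_nat n) = (of_nat n :: 'a::comm_ring_1 mseries)"
  by (induction n) (simp_all add: const_series_add)

lemma mseries_exp_add:
  assumes x: "small x" and y: "small y"
  shows "mseries_exp (x + y) = mseries_exp x * mseries_exp y"
proof -
  let ?c = "\<lambda>n. const_series (scalar (1 / fact n))"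
  let ?F = "\<lambda>(i, j). (?c i * x ^ i) * (?c j * y ^ j)" and ?d = "\<lambda>(i, j). i + j :: nat"
  have c: "?c (i + j) * of_nat ((i + j) choose i) = ?c i * ?c j" for i j
  proof -
    have "scalar (1 / fact (i + j)) * scalar (of_nat ((i + j) choose i)) = (scalar (1 / fact i) * scalar (1 / fact j))"
      unfolding scalar_times[symmetric]
      by (intro arg_cong[where f = scalar]) (simp add: binomial_fact)
    then show ?thesis
      by (metis const_series_of_nat const_series_times scalar_of_nat)
  qed
  have "mseries_exp x * mseries_exp y = gsum (UNIV \<times> UNIV) ?d ?F"
    unfolding mseries_exp_def using gsum_times[OF graded_exp[OF x] graded_exp[OF y]] by simp
  also have "\<dots> = gsum UNIV (\<lambda>n. n) (\<lambda>n. \<Sum>k\<in>{k \<in> UNIV \<times> UNIV. ?d k = n}. ?F k)"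
    using graded_times[OF graded_exp[OF x] graded_exp[OF y]] by (intro gsum_fibres) auto
  also have "\<dots> = mseries_exp (x + y)"
    unfolding mseries_exp_def
  proof (intro gsum_cong)
    fix n :: nat
    have "?c n * (x + y) ^ n = (\<Sum>i\<le>n. ?F (i, n - i))"
      unfolding binomial_ring sum_distrib_left
    proof (intro sum.cong refl)
      fix i assume "i \<in> {..n}"
      then have "?c n * of_nat (n choose i) = ?c i * ?c (n - i)"
        using c[of i "n - i"] by simp
      moreover have "?c n * (of_nat (n choose i) * x ^ i * y ^ (n - i)) = (?c n * of_nat (n choose i)) * (x ^ i * y ^ (n - i))"
        by (simp only: mult_ac)
      ultimately have "?c n * (of_nat (n choose i) * x ^ i * y ^ (n - i)) = (?c i * ?c (n - i)) * (x ^ i * y ^ (n - i))"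
        by metis
      then show "?c n * (of_nat (n choose i) * x ^ i * y ^ (n - i)) = ?F (i, n - i)"
        by (simp only: mult_ac prod.case)
    qed
    also have "\<dots> = (\<Sum>k\<in>{k \<in> UNIV \<times> UNIV. ?d k = n}. ?F k)"
      by (rule sum.reindex_bij_witness[where i = fst and j = "\<lambda>i. (i, n - i)"]) auto
    finally show "(\<Sum>k\<in>{k \<in> UNIV \<times> UNIV. ?d k = n}. ?F k) = ?c n * (x + y) ^ n" by simp
  qed
  finally show ?thesis by simp
qed

lemma mseries_exp_0 [simp]: "mseries_exp 0 = 1"
proof (rule mseries_eqI)
  fix m
  have "coeff (mseries_exp 0) m = (\<Sum>n\<in>{n. n \<le> total_degree m}. if n = 0 then coeff 1 m else 0)"
    unfolding mseries_exp_def gsum_def coeff_simps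
    by (intro sum.cong) (auto simp: power_0_left coeff_simps)
  then show "coeff (mseries_exp 0) m = coeff 1 m" by simp
qed

lemma exp_series_eq: "exp_series a L = mseries_exp (const_series a * L)"
  unfolding exp_series_def mseries_exp_def gsum_def
  by (simp add: const_series_times const_series_power power_mult_distrib mult_ac atMost_def)

lemma small_const_times: "small L \<Longrightarrow> small (const_series a * L)"
  by (simp add: small_def coeff_const_times)

lemma exp_series_add_left: "small L \<Longrightarrow> exp_series (a + b) L = exp_series a L * exp_series b L"
  and exp_series_add_right: "small L \<Longrightarrow> small M \<Longrightarrow> exp_series a (L + M) = exp_series a L * exp_series a M"
  by (simp_all add: exp_series_eq const_series_add distrib_left distrib_right mseries_exp_add small_const_times)

lemma exp_series_0 [simp]: "exp_series a 0 = 1" "exp_series 0 L = 1"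
  by (simp_all add: exp_series_eq)

definition monomial_value :: "(nat \<Rightarrow> 'a::comm_ring_1 mseries) \<Rightarrow> (nat \<Rightarrow>\<^sub>0 nat) \<Rightarrow> 'a mseries" where
  "monomial_value \<sigma> m = (\<Prod>i\<in>Poly_Mapping.keys m. \<sigma> i ^ Poly_Mapping.lookup m i)"

lemma monomial_value_superset:
  "finite A \<Longrightarrow> Poly_Mapping.keys m \<subseteq> A \<Longrightarrow> monomial_value \<sigma> m = (\<Prod>i\<in>A. \<sigma> i ^ Poly_Mapping.lookup m i)"
  unfolding monomial_value_def by (intro prod.mono_neutral_left) (auto simp: in_keys_iff)

lemma monomial_value_add: "monomial_value \<sigma> (a + b) = monomial_value \<sigma> a * monomial_value \<sigma> b"
proof -
  let ?A = "Poly_Mapping.keys a \<union> Poly_Mapping.keys b"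
  have "Poly_Mapping.keys (a + b) \<subseteq> ?A" by (rule Poly_Mapping.keys_add)
  then show ?thesis
    by (simp add: monomial_value_superset[of ?A] lookup_add power_add prod.distrib)
qed

lemma monomial_value_0 [simp]: "monomial_value \<sigma> 0 = 1"
  by (simp add: monomial_value_def)

lemma monomial_value_single [simp]: "monomial_value \<sigma> (Poly_Mapping.single i n) = \<sigma> i ^ n"
  by (cases "n = 0") (simp_all add: monomial_value_def)

lemma order_ge_monomial_value:
  assumes "\<And>i. i \<in> Poly_Mapping.keys m \<Longrightarrow> small (\<sigma> i)"
  shows "order_ge (total_degree m) (monomial_value \<sigma> m)"
  unfolding total_degree_def monomial_value_def
  using assms by (intro order_ge_prod order_ge_power) auto

lemma finite_bounded_exponents:
  assumes "finite V" shows "finite {m. Poly_Mapping.keys m \<subseteq> V \<and> total_degree m \<le> N}"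
proof -
  \<comment> \<open>Each of these exponents is a summand of the exponent that equals
    \<open>N\<close> on all of \<open>V\<close>, so the finiteness of \<open>splits M\<close>
    suffices.\<close>
  define M :: "nat \<Rightarrow>\<^sub>0 nat" where "M = (\<Sum>i\<in>V. Poly_Mapping.single i N)"
  have M: "Poly_Mapping.lookup M i = (if i \<in> V then N else 0)" for i
    using assms by (auto simp: M_def lookup_sum lookup_single when_def sum.delta)
  have "m \<in> fst ` splits M" if "Poly_Mapping.keys m \<subseteq> V" "total_degree m \<le> N" for m
  proof -
    have "Poly_Mapping.lookup m i \<le> Poly_Mapping.lookup M i" for i
      using that lookup_le_total_degree[of m i] by (auto simp: M in_keys_iff)
    then have "m + (M - m) = M"
      by (intro poly_mapping_eqI) (simp add: lookup_add lookup_minus)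
    then show ?thesis by (intro image_eqI[of _ _ "(m, M - m)"]) (auto simp: splits_def)
  qed
  then show ?thesis
    by (intro finite_subset[OF _ finite_imageI[OF finite_splits[of M], of fst]]) blast
qed

text \<open>Substitution of \<open>\<sigma> i\<close> for $t_i$ when \<open>i \<in> V\<close>, and of \<open>0\<close> otherwise.\<close>

definition subst :: "nat set \<Rightarrow> (nat \<Rightarrow> 'a::comm_ring_1 mseries) \<Rightarrow> 'a mseries \<Rightarrow> 'a mseries" where
  "subst V \<sigma> f = gsum {m. Poly_Mapping.keys m \<subseteq> V} total_degree (\<lambda>m. const_series (coeff f m) * monomial_value \<sigma> m)"

lemma gsum_add: "gsum I d (\<lambda>i. F i + G i) = gsum I d F + gsum I d G"
  by (rule mseries_eqI) (simp add: gsum_def coeff_simps sum.distrib)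

lemma gsum_single:
  assumes "i \<in> I" "order_ge (d i) (F i)" "\<And>j. j \<in> I \<Longrightarrow> j \<noteq> i \<Longrightarrow> F j = 0" "\<And>N. finite {i \<in> I. d i \<le> N}"
  shows "gsum I d F = F i"
proof (rule mseries_eqI)
  fix m
  have "(\<Sum>j\<in>{j \<in> I. d j \<le> total_degree m}. coeff (F j) m) =
      (\<Sum>j\<in>{j \<in> I. d j \<le> total_degree m}. if j = i then coeff (F i) m else 0)"
    using assms(3) by (intro sum.cong refl) (auto simp: coeff_simps)
  also have "\<dots> = coeff (F i) m"
    using assms(1,2,4) by (auto simp: sum.delta order_ge_def)
  finally show "coeff (gsum I d F) m = coeff (F i) m" by (simp add: gsum_def coeff_simps)
qed

locale substitution =
  fixes V :: "nat set" and \<sigma> :: "nat \<Rightarrow> 'a::comm_ring_1 mseries"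
  assumes finite_V: "finite V" and small: "\<And>i. i \<in> V \<Longrightarrow> small (\<sigma> i)"
begin

lemma graded_subst:
  "graded {m. Poly_Mapping.keys m \<subseteq> V} total_degree (\<lambda>m. const_series (coeff f m) * monomial_value \<sigma> m)"
  using finite_bounded_exponents[OF finite_V] small
  by (auto simp: graded_def intro!: order_ge_const_times order_ge_monomial_value)

lemma subst_add: "subst V \<sigma> (f + g) = subst V \<sigma> f + subst V \<sigma> g"
  by (simp add: subst_def gsum_add[symmetric] coeff_simps const_series_add distrib_right)

lemma subst_const: "subst V \<sigma> (const_series a) = const_series a"
  using graded_subst[of "const_series a"] unfolding subst_def graded_def
  by (subst gsum_single[where i = 0]) (auto simp: coeff_simps)

lemma subst_0: "subst V \<sigma> 0 = 0" and subst_1: "subst V \<sigma> 1 = 1"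
  using subst_const[of 0] subst_const[of 1] by simp_all

lemma subst_uminus: "subst V \<sigma> (- f) = - subst V \<sigma> f"
  using subst_add[of f "- f"] by (simp add: subst_0 eq_neg_iff_add_eq_0 add.commute)

lemma subst_diff: "subst V \<sigma> (f - g) = subst V \<sigma> f - subst V \<sigma> g"
  using subst_add[of f "- g"] by (simp add: subst_uminus)

lemma subst_tvar: "i \<in> V \<Longrightarrow> subst V \<sigma> (tvar i) = \<sigma> i"
  using graded_subst[of "tvar i"] order_ge_1[OF small, of i] unfolding subst_def graded_def
  by (subst gsum_single[where i = "Poly_Mapping.single i 1"]) (auto simp: coeff_simps)

lemma subst_times: "subst V \<sigma> (f * g) = subst V \<sigma> f * subst V \<sigma> g"
proof -
  let ?I = "{m :: nat \<Rightarrow>\<^sub>0 nat. Poly_Mapping.keys m \<subseteq> V}"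
  let ?F = "\<lambda>f m. const_series (coeff f m) * monomial_value \<sigma> m"
  let ?H = "\<lambda>(i, j). ?F f i * ?F g j"
  have "subst V \<sigma> f * subst V \<sigma> g = gsum (?I \<times> ?I) (\<lambda>(i, j). total_degree i + total_degree j) ?H"
    unfolding subst_def by (rule gsum_times[OF graded_subst graded_subst])
  also have "\<dots> = gsum ?I total_degree (\<lambda>j. \<Sum>k\<in>{k \<in> ?I \<times> ?I. (\<lambda>(a, b). a + b) k = j}. ?H k)"
    using finite_bounded_exponents[OF finite_V] Poly_Mapping.keys_add
    by (intro gsum_fibres[OF graded_times[OF graded_subst graded_subst]])
       (fastforce simp: total_degree_add)+
  also have "\<dots> = subst V \<sigma> (f * g)"
    unfolding subst_def
  proof (rule gsum_cong)
    fix m assume m: "m \<in> ?I"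
    have "Poly_Mapping.keys a \<subseteq> V \<and> Poly_Mapping.keys b \<subseteq> V" if "(a, b) \<in> splits m" for a b
    proof -
      have "Poly_Mapping.keys a \<subseteq> Poly_Mapping.keys m" "Poly_Mapping.keys b \<subseteq> Poly_Mapping.keys m"
        using that by (auto simp: splits_def in_keys_iff lookup_add)
      then show ?thesis using m by auto
    qed
    then have "{k \<in> ?I \<times> ?I. (\<lambda>(a, b). a + b) k = m} = splits m"
      by (fastforce simp: splits_def)
    then have "(\<Sum>k\<in>{k \<in> ?I \<times> ?I. (\<lambda>(a, b). a + b) k = m}. ?H k) =
        (\<Sum>(a, b)\<in>splits m. const_series (coeff f a * coeff g b) * monomial_value \<sigma> m)"
      by (intro sum.cong) (auto simp: splits_def monomial_value_add const_series_times mult_ac)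
    also have "\<dots> = const_series (coeff (f * g) m) * monomial_value \<sigma> m"
    proof -
      have "const_series (sum h A) = (\<Sum>x\<in>A. const_series (h x) :: 'a mseries)" for h :: "(nat \<Rightarrow>\<^sub>0 nat) \<times> (nat \<Rightarrow>\<^sub>0 nat) \<Rightarrow> 'a" and A
        by (induction A rule: infinite_finite_induct) (simp_all add: const_series_add)
      then show ?thesis
        by (simp add: times_mseries.rep_eq case_prod_unfold sum_distrib_right)
    qed
    finally show "(\<Sum>k\<in>{k \<in> ?I \<times> ?I. (\<lambda>(a, b). a + b) k = m}. ?H k) = const_series (coeff (f * g) m) * monomial_value \<sigma> m" .
  qed
  finally show ?thesis by simp
qed

lemma subst_power: "subst V \<sigma> (f ^ n) = subst V \<sigma> f ^ n"
  by (induction n) (simp_all add: subst_1 subst_times)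

lemma subst_prod: "subst V \<sigma> (prod f A) = (\<Prod>x\<in>A. subst V \<sigma> (f x))"
  by (induction A rule: infinite_finite_induct) (simp_all add: subst_1 subst_times)

lemma subst_sum: "subst V \<sigma> (sum f A) = (\<Sum>x\<in>A. subst V \<sigma> (f x))"
  by (induction A rule: infinite_finite_induct) (simp_all add: subst_0 subst_add)

text \<open>A fixed coefficient involves finitely many exponents and finitely many indices, so
  continuity of the substitution is an exchange of finite sums.\<close>

lemma subst_gsum:
  assumes F: "graded I d F"
  shows "subst V \<sigma> (gsum I d F) = gsum I d (\<lambda>i. subst V \<sigma> (F i))"
proof (rule mseries_eqI)
  fix n
  let ?N = "total_degree n"
  let ?A = "{m \<in> {m. Poly_Mapping.keys m \<subseteq> V}. total_degree m \<le> ?N}" and ?B = "{i \<in> I. d i \<le> ?N}"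
  have s: "coeff (subst V \<sigma> f) n = (\<Sum>m\<in>?A. coeff f m * coeff (monomial_value \<sigma> m) n)" for f
    by (simp add: subst_def gsum_def coeff_simps coeff_const_times)
  have "coeff (subst V \<sigma> (gsum I d F)) n = (\<Sum>m\<in>?A. \<Sum>i\<in>?B. coeff (F i) m * coeff (monomial_value \<sigma> m) n)"
    unfolding s by (intro sum.cong refl) (simp add: coeff_gsum[OF F, where N = ?N] sum_distrib_right)
  also have "\<dots> = (\<Sum>i\<in>?B. coeff (subst V \<sigma> (F i)) n)"
    unfolding s by (rule sum.swap)
  finally show "coeff (subst V \<sigma> (gsum I d F)) n = coeff (gsum I d (\<lambda>i. subst V \<sigma> (F i))) n"
    by (simp add: gsum_def coeff_simps)
qed

end

section \<open>Generating series and coefficient extraction\<close>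

definition gen_indices :: "nat \<Rightarrow> nat list set" where
  "gen_indices d = {ns. length ns = d \<and> (\<forall>n\<in>set ns. 1 \<le> n)}"

lemma finite_gen_indices: "finite {ns \<in> gen_indices d. (\<Sum>n\<leftarrow>ns. n - 1) \<le> N}"
  using finite_indices_upto[of d N] by (rule rev_finite_subset) (auto simp: gen_indices_def indices_upto_def)

lemma gen_series_gsum:
  "gen_series c Ls = gsum (gen_indices (length Ls)) (\<lambda>ns. \<Sum>n\<leftarrow>ns. n - 1)
     (\<lambda>ns. const_series (c ns) * (\<Prod>(L, n)\<leftarrow>zip Ls ns. L ^ (n - 1)))"
proof -
  have "indices_upto d N = {ns \<in> gen_indices d. (\<Sum>n\<leftarrow>ns. n - 1) \<le> N}" for d N
    by (auto simp: indices_upto_def gen_indices_def)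
  then show ?thesis unfolding gen_series_def gsum_def by simp
qed

lemma order_ge_gen_term:
  assumes "length ns = length Ls" "\<And>L. L \<in> set Ls \<Longrightarrow> small L"
  shows "order_ge (\<Sum>n\<leftarrow>ns. n - 1) (\<Prod>(L, n)\<leftarrow>zip Ls ns. L ^ (n - 1))"
  using assms
proof (induction ns Ls rule: list_induct2)
  case (Cons n ns L Ls)
  then show ?case by (simp add: order_ge_times order_ge_power)
qed simp

lemma graded_gen_series:
  assumes "\<And>L. L \<in> set Ls \<Longrightarrow> small L"
  shows "graded (gen_indices (length Ls)) (\<lambda>ns. \<Sum>n\<leftarrow>ns. n - 1)
     (\<lambda>ns. const_series (c ns) * (\<Prod>(L, n)\<leftarrow>zip Ls ns. L ^ (n - 1)))"
  using assms finite_gen_indices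
  by (auto simp: graded_def gen_indices_def simp del: One_nat_def intro!: order_ge_const_times order_ge_gen_term)

lemma gen_series_cong:
  "(\<And>ns. ns \<in> gen_indices (length Ls) \<Longrightarrow> c ns = c' ns) \<Longrightarrow> gen_series c Ls = gen_series c' Ls"
  unfolding gen_series_gsum by (intro gsum_cong) simp

lemma gen_series_Nil: "gen_series c [] = const_series (c [])"
  unfolding gen_series_gsum using finite_gen_indices[of 0]
  by (subst gsum_single[where i = "[]"]) (auto simp: gen_indices_def)

context substitution
begin

lemma subst_gen_series:
  assumes "\<And>L. L \<in> set Ls \<Longrightarrow> small L"
  shows "subst V \<sigma> (gen_series c Ls) = gen_series c (map (subst V \<sigma>) Ls)"
proof -
  have "(\<Prod>(L, n)\<leftarrow>zip (map (subst V \<sigma>) Ls) ns. L ^ (n - 1)) = subst V \<sigma> (\<Prod>(L, n)\<leftarrow>zip Ls ns. L ^ (n - 1))" for ns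
    by (induction Ls ns rule: list_induct2') (simp_all add: subst_1 subst_times subst_power)
  then show ?thesis
    unfolding gen_series_gsum by (simp add: subst_gsum[OF graded_gen_series[OF assms]] subst_times subst_const del: One_nat_def)
qed

end

lemma subst_exp_series:
  fixes \<sigma> :: "nat \<Rightarrow> 'm::comm_monoid_add series"
  assumes "substitution V \<sigma>" "small L"
  shows "subst V \<sigma> (exp_series a L) = exp_series a (subst V \<sigma> L)"
proof -
  interpret substitution V \<sigma> by (rule assms)
  show ?thesis
    unfolding exp_series_eq mseries_exp_def subst_gsum[OF graded_exp[OF small_const_times[OF assms(2)]]]
    by (simp add: subst_times subst_const subst_power)
qed

lemma lookup_t_exponent:
  "Poly_Mapping.lookup (t_exponent ns) k = (if 1 \<le> k \<and> k \<le> length ns then ns ! (k - 1) - 1 else 0)"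
proof -
  have "Poly_Mapping.lookup (t_exponent ns) k = (\<Sum>i<length ns. if i = k - 1 then (if 1 \<le> k then ns ! (k - 1) - 1 else 0) else 0)"
    unfolding t_exponent_def lookup_sum by (intro sum.cong refl) (auto simp: lookup_single when_def)
  then show ?thesis by (auto simp: sum.delta)
qed

lemma bij_betw_t_exponent: "bij_betw t_exponent (gen_indices d) {m. Poly_Mapping.keys m \<subseteq> {1..d}}"
proof (rule bij_betw_byWitness[where f' = "\<lambda>m. map (\<lambda>i. Poly_Mapping.lookup m (Suc i) + 1) [0..<d]"])
  show "\<forall>ns\<in>gen_indices d. map (\<lambda>i. Poly_Mapping.lookup (t_exponent ns) (Suc i) + 1) [0..<d] = ns"
    by (auto simp: gen_indices_def lookup_t_exponent Suc_diff_1 Suc_le_eq intro!: nth_equalityI)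
  show "\<forall>m\<in>{m. Poly_Mapping.keys m \<subseteq> {1..d}}. t_exponent (map (\<lambda>i. Poly_Mapping.lookup m (Suc i) + 1) [0..<d]) = m"
  proof clarify
    fix m :: "nat \<Rightarrow>\<^sub>0 nat" assume "Poly_Mapping.keys m \<subseteq> {1..d}"
    then have "Poly_Mapping.lookup m k = 0" if "k \<notin> {1..d}" for k using that by (metis in_keys_iff subsetD)
    then show "t_exponent (map (\<lambda>i. Poly_Mapping.lookup m (Suc i) + 1) [0..<d]) = m"
      by (intro poly_mapping_eqI) (auto simp: lookup_t_exponent)
  qed
  show "t_exponent ` gen_indices d \<subseteq> {m. Poly_Mapping.keys m \<subseteq> {1..d}}"
    by (auto simp: in_keys_iff lookup_t_exponent gen_indices_def split: if_splits)
  show "(\<lambda>m. map (\<lambda>i. Poly_Mapping.lookup m (Suc i) + 1) [0..<d]) ` {m. Poly_Mapping.keys m \<subseteq> {1..d}} \<subseteq> gen_indices d"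
    by (auto simp: gen_indices_def)
qed

lemma total_degree_t_exponent: "total_degree (t_exponent ns) = (\<Sum>n\<leftarrow>ns. n - 1)"
proof -
  have "total_degree (sum f A) = (\<Sum>x\<in>A. total_degree (f x))" for f :: "nat \<Rightarrow> _" and A
    by (induction A rule: infinite_finite_induct) (simp_all add: total_degree_add)
  then show ?thesis
    by (simp add: t_exponent_def sum_list_sum_nth atLeast0LessThan)
qed

lemma monomial_value_t_exponent:
  fixes Ls :: "'a::comm_ring_1 mseries list"
  assumes "length ns = length Ls"
  shows "monomial_value (\<lambda>i. Ls ! (i - 1)) (t_exponent ns) = (\<Prod>(L, n)\<leftarrow>zip Ls ns. L ^ (n - 1))"
proof -
  have "monomial_value \<sigma> (sum f A) = (\<Prod>x\<in>A. monomial_value \<sigma> (f x))" 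
    for \<sigma> :: "nat \<Rightarrow> 'a mseries" and f :: "nat \<Rightarrow> _" and A
    by (induction A rule: infinite_finite_induct) (simp_all add: monomial_value_add)
  then have "monomial_value (\<lambda>i. Ls ! (i - 1)) (t_exponent ns) = (\<Prod>i<length ns. (Ls ! i) ^ (ns ! i - 1))"
    by (simp add: t_exponent_def del: One_nat_def)
  then show ?thesis
    using assms by (simp add: prod.list_conv_set_nth atLeast0LessThan case_prod_unfold)
qed

text \<open>The coproduct and INV are given on symbols by coefficients of explicit series.
  Reassembling such coefficients at slots \<open>Ls\<close> amounts to substituting the slots into
  the series, by the correspondence of indices and exponents.\<close>

lemma gen_series_coeff:
  assumes "\<And>L. L \<in> set Ls \<Longrightarrow> small L"
  shows "gen_series (\<lambda>ns. coeff f (t_exponent ns)) Ls = subst {1..length Ls} (\<lambda>i. Ls ! (i - 1)) f"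
  unfolding gen_series_gsum subst_def
  by (rule gsum_reindex[OF graded_gen_series bij_betw_t_exponent])
     (auto simp: assms total_degree_t_exponent monomial_value_t_exponent gen_indices_def simp del: One_nat_def)

lemma gen_series_rev:
  assumes "\<And>L. L \<in> set Ls \<Longrightarrow> small L"
  shows "gen_series (\<lambda>ns. c (rev ns)) Ls = gen_series c (rev Ls)"
  unfolding gen_series_gsum
proof (rule gsum_reindex[OF graded_gen_series, where \<pi> = rev])
  show "bij_betw rev (gen_indices (length Ls)) (gen_indices (length (rev Ls)))"
    by (rule bij_betw_byWitness[where f' = rev]) (auto simp: gen_indices_def)
  fix ns assume "ns \<in> gen_indices (length Ls)"
  then have "length ns = length Ls" by (simp add: gen_indices_def)
  then show "const_series (c (rev ns)) * (\<Prod>(L, n)\<leftarrow>zip (rev Ls) (rev ns). L ^ (n - 1)) =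
      const_series (c (rev ns)) * (\<Prod>(L, n)\<leftarrow>zip Ls ns. L ^ (n - 1))"
    by (simp add: zip_rev rev_map[symmetric] prod_list.rev)
qed (auto simp: assms rev_map[symmetric])

text \<open>Together with \<open>gen_series_rev\<close> this undoes the sign and the reversal in
  \<open>inv_symbol\<close>, whose defining series has the arguments -t_d, ..., -t_1.\<close>

lemma gen_series_sign:
  "gen_series (\<lambda>ns. (- 1) ^ (\<Sum>n\<leftarrow>ns. n - 1) * c ns) Ls = gen_series c (map uminus Ls)"
proof -
  have "const_series (- 1) = (- 1 :: 'a mseries)"
    by (rule mseries_eqI) (simp add: coeff_simps)
  then have sign: "const_series ((- 1) ^ k * a) = (- 1) ^ k * const_series (a :: 'a)" for k a
    by (simp add: const_series_times const_series_power)
  have "(- 1) ^ (\<Sum>n\<leftarrow>ns. n - 1) * (\<Prod>(L, n)\<leftarrow>zip Ls ns. L ^ (n - 1)) =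
      (\<Prod>(L, n)\<leftarrow>zip (map uminus Ls) ns. L ^ (n - 1))" if "length ns = length Ls" for ns
    using that
  proof (induction ns Ls rule: list_induct2)
    case (Cons n ns L Ls)
    then show ?case
      by (simp only: list.map zip_Cons_Cons prod_list.Cons sum_list.Cons prod.case power_add
          power_minus[of L] Cons.IH[symmetric] mult_ac)
  qed simp
  then have "const_series (c ns) * ((- 1) ^ (\<Sum>n\<leftarrow>ns. n - 1) * (\<Prod>(L, n)\<leftarrow>zip Ls ns. L ^ (n - 1))) =
      const_series (c ns) * (\<Prod>(L, n)\<leftarrow>zip (map uminus Ls) ns. L ^ (n - 1))" if "length ns = length Ls" for ns
    using that by (simp only:)
  then have "const_series ((- 1) ^ (\<Sum>n\<leftarrow>ns. n - 1) * c ns) * (\<Prod>(L, n)\<leftarrow>zip Ls ns. L ^ (n - 1)) =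
      const_series (c ns) * (\<Prod>(L, n)\<leftarrow>zip (map uminus Ls) ns. L ^ (n - 1))" if "length ns = length Ls" for ns
    using that unfolding sign by (simp only: mult_ac)
  then show ?thesis
    unfolding gen_series_gsum length_map by (intro gsum_cong) (simp add: gen_indices_def)
qed

section \<open>Algebra homomorphisms and convolution\<close>

lemma poly_mapping_add_induct [case_names single sum]:
  assumes single: "\<And>k v. P (Poly_Mapping.single k v)" and sum: "\<And>f g. P f \<Longrightarrow> P g \<Longrightarrow> P (f + g)"
  shows "P (f :: 'k \<Rightarrow>\<^sub>0 'v::comm_monoid_add)"
proof (induction f rule: update_induct)
  case const
  then show ?case using single[of undefined 0] by simp
next
  case (update f a b)
  have "Poly_Mapping.update a b f = f + Poly_Mapping.single a b"
    using update(1) by (intro poly_mapping_eqI) (auto simp: lookup_update lookup_add lookup_single when_def in_keys_iff)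
  then show ?case using update(3) sum single by simp
qed

definition linear_extension :: "('k \<Rightarrow> ('m::comm_monoid_add \<Rightarrow>\<^sub>0 rat)) \<Rightarrow> ('k \<Rightarrow>\<^sub>0 rat) \<Rightarrow> ('m \<Rightarrow>\<^sub>0 rat)" where
  "linear_extension F T = (\<Sum>k\<in>Poly_Mapping.keys T. scalar (Poly_Mapping.lookup T k) * F k)"

lemma linear_extension_superset:
  assumes "finite A" "Poly_Mapping.keys T \<subseteq> A"
  shows "linear_extension F T = (\<Sum>k\<in>A. scalar (Poly_Mapping.lookup T k) * F k)"
  unfolding linear_extension_def using assms
  by (intro sum.mono_neutral_left) (auto simp: in_keys_iff)

lemma linear_extension_add: "linear_extension F (S + T) = linear_extension F S + linear_extension F T"
proof -
  let ?A = "Poly_Mapping.keys S \<union> Poly_Mapping.keys T"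
  have "Poly_Mapping.keys (S + T) \<subseteq> ?A" by (rule Poly_Mapping.keys_add)
  then show ?thesis
    by (simp add: linear_extension_superset[of ?A] lookup_add scalar_add distrib_right sum.distrib)
qed

lemma linear_extension_single: "linear_extension F (Poly_Mapping.single k c) = scalar c * F k"
  by (cases "c = 0") (simp_all add: linear_extension_def)

lemma linear_extension_times:
  fixes F :: "'k::comm_monoid_add \<Rightarrow> ('m::comm_monoid_add \<Rightarrow>\<^sub>0 rat)"
  assumes F: "\<And>k l. F (k + l) = F k * F l"
  shows "linear_extension F (S * T) = linear_extension F S * linear_extension F T"
proof (induction S rule: poly_mapping_add_induct)
  case (single k v)
  show ?case
  proof (induction T rule: poly_mapping_add_induct)
    case (single l w)
    show ?case by (simp add: mult_single linear_extension_single F scalar_times mult_ac)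
  next
    case (sum f g)
    then show ?case by (simp add: distrib_left linear_extension_add)
  qed
next
  case (sum f g)
  then show ?case by (simp add: distrib_right linear_extension_add)
qed

text \<open>Compatibility with \<open>scalar\<close> makes the map linear over the rationals, so
  that it is determined by its values on monomials.\<close>

locale alg_morphism =
  fixes \<phi> :: "('k::comm_monoid_add \<Rightarrow>\<^sub>0 rat) \<Rightarrow> ('m::comm_monoid_add \<Rightarrow>\<^sub>0 rat)"
  assumes add: "\<phi> (a + b) = \<phi> a + \<phi> b" and times: "\<phi> (a * b) = \<phi> a * \<phi> b"
    and scalar: "\<phi> (scalar c) = scalar c"
begin

lemma zero [simp]: "\<phi> 0 = 0" and one [simp]: "\<phi> 1 = 1"
  using scalar[of 0] scalar[of 1] by simp_all

lemma uminus: "\<phi> (- a) = - \<phi> a"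
  using add[of a "- a"] by (simp add: eq_neg_iff_add_eq_0 add.commute)

lemma diff: "\<phi> (a - b) = \<phi> a - \<phi> b"
  using add[of a "- b"] by (simp add: uminus)

lemma sum: "\<phi> (sum f A) = (\<Sum>x\<in>A. \<phi> (f x))"
  by (induction A rule: infinite_finite_induct) (simp_all add: add)

lemma power: "\<phi> (a ^ n) = \<phi> a ^ n"
  by (induction n) (simp_all add: times)

lemma expand: "\<phi> T = linear_extension (\<lambda>k. \<phi> (Poly_Mapping.single k 1)) T"
proof (induction T rule: poly_mapping_add_induct)
  case (single k v)
  have "\<phi> (Poly_Mapping.single k v) = \<phi> (Defs.scalar v * Poly_Mapping.single k 1)"
    by (simp add: scalar_def mult_single)
  then show ?case by (simp add: linear_extension_single times scalar)
next
  case (sum f g)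
  then show ?case by (simp add: add linear_extension_add)
qed

end

lemma alg_morphism_eqI:
  assumes "alg_morphism \<phi>" "alg_morphism \<psi>" "\<And>k. \<phi> (Poly_Mapping.single k 1) = \<psi> (Poly_Mapping.single k 1)"
  shows "\<phi> = \<psi>"
proof
  fix T show "\<phi> T = \<psi> T"
    by (simp only: alg_morphism.expand[OF assms(1), of T] alg_morphism.expand[OF assms(2), of T] assms(3))
qed

lemma alg_morphism_compose: "alg_morphism \<phi> \<Longrightarrow> alg_morphism \<psi> \<Longrightarrow> alg_morphism (\<phi> \<circ> \<psi>)"
  by (simp add: alg_morphism_def)

lemma alg_morphism_linear_extension:
  assumes "\<And>k l. F (k + l) = F k * F l" "F 0 = 1"
  shows "alg_morphism (linear_extension F)"
proof
  show "linear_extension F (scalar c) = scalar c" for c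
    by (simp add: scalar_def[of c, where 'm = 'a] linear_extension_single assms)
qed (simp_all add: linear_extension_add linear_extension_times assms)

lemma alg_hom_eq: "alg_hom \<phi> = linear_extension (\<lambda>m. \<Prod>g\<in>Poly_Mapping.keys m. \<phi> g ^ Poly_Mapping.lookup m g)"
  by (intro ext) (simp add: alg_hom_def linear_extension_def)

lemma alg_morphism_alg_hom: "alg_morphism (alg_hom (\<phi> :: 'g \<Rightarrow> 'm::comm_monoid_add \<Rightarrow>\<^sub>0 rat))"
  unfolding alg_hom_eq
proof (rule alg_morphism_linear_extension)
  fix k l :: "'g \<Rightarrow>\<^sub>0 nat"
  let ?A = "Poly_Mapping.keys k \<union> Poly_Mapping.keys l"
  have *: "(\<Prod>g\<in>Poly_Mapping.keys m. \<phi> g ^ Poly_Mapping.lookup m g) = (\<Prod>g\<in>?A. \<phi> g ^ Poly_Mapping.lookup m g)"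
    if "Poly_Mapping.keys m \<subseteq> ?A" for m
    using that by (intro prod.mono_neutral_left) (auto simp: in_keys_iff)
  show "(\<Prod>g\<in>Poly_Mapping.keys (k + l). \<phi> g ^ Poly_Mapping.lookup (k + l) g) =
      (\<Prod>g\<in>Poly_Mapping.keys k. \<phi> g ^ Poly_Mapping.lookup k g) * (\<Prod>g\<in>Poly_Mapping.keys l. \<phi> g ^ Poly_Mapping.lookup l g)"
    unfolding *[OF Poly_Mapping.keys_add] *[OF Un_upper1] *[OF Un_upper2]
    by (simp add: lookup_add power_add prod.distrib)
qed simp

lemma alg_hom_gen: "alg_hom \<phi> (Poly_Mapping.single (Poly_Mapping.single g 1) 1) = \<phi> g"
  by (simp add: alg_hom_single)

section \<open>Points with values in commutative algebras and their convolution\<close>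

definition pairing :: "(('m \<Rightarrow>\<^sub>0 rat) \<Rightarrow> ('k::comm_monoid_add \<Rightarrow>\<^sub>0 rat)) \<Rightarrow> (('n \<Rightarrow>\<^sub>0 rat) \<Rightarrow> ('k \<Rightarrow>\<^sub>0 rat)) \<Rightarrow>
    ('m \<times> 'n \<Rightarrow>\<^sub>0 rat) \<Rightarrow> ('k \<Rightarrow>\<^sub>0 rat)" where
  "pairing g h = linear_extension (\<lambda>(m, n). g (Poly_Mapping.single m 1) * h (Poly_Mapping.single n 1))"

lemma linear_extension_sum: "linear_extension F (sum f A) = (\<Sum>x\<in>A. linear_extension F (f x))"
proof -
  have "linear_extension F 0 = 0" by (simp add: linear_extension_def)
  then show ?thesis
    by (induction A rule: infinite_finite_induct) (simp_all add: linear_extension_add)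
qed

text \<open>\<open>pairing g h\<close> is the tensor product of \<open>g\<close> and
  \<open>h\<close> followed by multiplication in the common target; as the target is commutative, it
  is again a homomorphism.\<close>

lemma pairing_tensor:
  assumes "alg_morphism g" "alg_morphism h"
  shows "pairing g h (a \<otimes> b) = g a * h b"
  unfolding pairing_def tensor_def linear_extension_sum linear_extension_single
    alg_morphism.expand[OF assms(1), of a] alg_morphism.expand[OF assms(2), of b]
  unfolding linear_extension_def sum_product
  by (intro sum.cong refl) (simp add: scalar_times mult_ac)

lemma alg_morphism_pairing:
  assumes "alg_morphism g" "alg_morphism h"
  shows "alg_morphism (pairing g h)"
  unfolding pairing_def
proof (rule alg_morphism_linear_extension)
  have s: "Poly_Mapping.single (k + l) (1 :: rat) = Poly_Mapping.single k 1 * Poly_Mapping.single l 1" for k l :: "'x::comm_monoid_add"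
    by (simp add: mult_single)
  show "(case k + l of (m, n) \<Rightarrow> g (Poly_Mapping.single m 1) * h (Poly_Mapping.single n 1)) =
     (case k of (m, n) \<Rightarrow> g (Poly_Mapping.single m 1) * h (Poly_Mapping.single n 1)) *
     (case l of (m, n) \<Rightarrow> g (Poly_Mapping.single m 1) * h (Poly_Mapping.single n 1))" for k l
    by (cases k; cases l) (simp add: s alg_morphism.times[OF assms(1)] alg_morphism.times[OF assms(2)] mult_ac)
  show "(case 0 of (m, n) \<Rightarrow> g (Poly_Mapping.single m 1) * h (Poly_Mapping.single n 1)) = 1"
    using alg_morphism.one[OF assms(1)] alg_morphism.one[OF assms(2)] by (simp add: zero_prod_def)
qed

text \<open>With the embeddings a to a \<otimes> 1 and b to 1 \<otimes> b, maps into tensor products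
  become points of one commutative algebra.\<close>

definition left_factor :: "('m::comm_monoid_add \<Rightarrow>\<^sub>0 rat) \<Rightarrow> ('m \<times> 'n::comm_monoid_add \<Rightarrow>\<^sub>0 rat)" where
  "left_factor = linear_extension (\<lambda>m. Poly_Mapping.single (m, 0) 1)"
definition right_factor :: "('n::comm_monoid_add \<Rightarrow>\<^sub>0 rat) \<Rightarrow> ('m::comm_monoid_add \<times> 'n \<Rightarrow>\<^sub>0 rat)" where
  "right_factor = linear_extension (\<lambda>n. Poly_Mapping.single (0, n) 1)"

lemma alg_morphism_left_factor: "alg_morphism left_factor"
  unfolding left_factor_def by (rule alg_morphism_linear_extension) (simp_all add: mult_single zero_prod_def[symmetric])

lemma alg_morphism_right_factor: "alg_morphism right_factor"
  unfolding right_factor_def by (rule alg_morphism_linear_extension) (simp_all add: mult_single zero_prod_def[symmetric])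

lemma tensor_eq: "a \<otimes> b = left_factor a * right_factor b"
  unfolding tensor_def left_factor_def right_factor_def linear_extension_def sum_product
  by (intro sum.cong refl) (simp add: scalar_def mult_single zero_prod_def)

lemma tensor_map_eq: "tensor_map f g = pairing (left_factor \<circ> f) (right_factor \<circ> g)"
  unfolding tensor_map_def pairing_def linear_extension_def by (intro ext) (simp add: tensor_eq case_prod_unfold)

text \<open>Formed with the coproduct of all symbols; INV enters separately, by composing points
  with it.\<close>

definition convolution ::
  "'k::comm_monoid_add point \<Rightarrow> 'k point \<Rightarrow> 'k point" where
  "convolution g h = pairing g h \<circ> coproduct_bar"

lemma alg_morphism_coproduct_bar: "alg_morphism coproduct_bar"
  unfolding coproduct_bar_def by (rule alg_morphism_alg_hom)

lemma alg_morphism_convolution: "alg_morphism g \<Longrightarrow> alg_morphism h \<Longrightarrow> alg_morphism (convolution g h)"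
  unfolding convolution_def by (intro alg_morphism_compose alg_morphism_pairing alg_morphism_coproduct_bar)

lemma alg_morphism_INV: "alg_morphism INV"
  unfolding INV_def by (rule alg_morphism_alg_hom)

lemma INV_id:
  assumes "a \<in> Hsymb" shows "INV a = a"
proof -
  have "INV a = linear_extension (\<lambda>m. Poly_Mapping.single m 1) a"
    unfolding alg_morphism.expand[OF alg_morphism_INV, of a] linear_extension_def
    using assms by (intro sum.cong refl) (auto simp: Hsymb_def INV_single_regular)
  also have "\<dots> = a"
    using alg_morphism.expand[of "\<lambda>a. a" a] by (simp add: alg_morphism_def)
  finally show ?thesis .
qed

text \<open>The coproduct is itself the convolution of two universal points. Its coassociativity is
  therefore a case of associativity for points.\<close>

lemma coproduct_eq: "coproduct = convolution (left_factor \<circ> INV) (right_factor \<circ> INV)"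
  by (intro ext) (simp add: coproduct_def convolution_def tensor_map_eq)

section \<open>Evaluating series at a point and at given slots\<close>

definition map_series :: "('a::comm_ring_1 \<Rightarrow> 'b::comm_ring_1) \<Rightarrow> 'a mseries \<Rightarrow> 'b mseries" where
  "map_series \<phi> f = MSeries (\<lambda>m. \<phi> (coeff f m))"

lemma coeff_map_series: "coeff (map_series \<phi> f) m = \<phi> (coeff f m)"
  by (simp add: map_series_def coeff_simps)

context alg_morphism
begin

lemma map_series_add: "map_series \<phi> (f + g) = map_series \<phi> f + map_series \<phi> g"
  and map_series_diff: "map_series \<phi> (f - g) = map_series \<phi> f - map_series \<phi> g"
  and map_series_uminus: "map_series \<phi> (- f) = - map_series \<phi> f"
  and map_series_const: "map_series \<phi> (const_series a) = const_series (\<phi> a)"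
  and map_series_tvar: "map_series \<phi> (tvar i) = tvar i"
  and map_series_0: "map_series \<phi> 0 = 0"
  and map_series_1: "map_series \<phi> 1 = 1"
  and map_series_times: "map_series \<phi> (f * g) = map_series \<phi> f * map_series \<phi> g"
  by (rule mseries_eqI; simp add: coeff_map_series coeff_simps times_mseries.rep_eq add diff uminus sum times case_prod_unfold)+

lemma map_series_power: "map_series \<phi> (f ^ n) = map_series \<phi> f ^ n"
  by (induction n) (simp_all add: map_series_1 map_series_times)

lemma map_series_sum: "map_series \<phi> (Groups_Big.sum f A) = (\<Sum>x\<in>A. map_series \<phi> (f x))"
  by (induction A rule: infinite_finite_induct) (simp_all add: map_series_0 map_series_add)

lemma map_series_prod: "map_series \<phi> (prod f A) = (\<Prod>x\<in>A. map_series \<phi> (f x))"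
  by (induction A rule: infinite_finite_induct) (simp_all add: map_series_1 map_series_times)

lemma map_series_gsum: "map_series \<phi> (gsum I d F) = gsum I d (\<lambda>i. map_series \<phi> (F i))"
  by (rule mseries_eqI) (simp add: coeff_map_series gsum_def coeff_simps sum)

lemma map_series_gen_series: "map_series \<phi> (gen_series c Ls) = gen_series (\<lambda>ns. \<phi> (c ns)) (map (map_series \<phi>) Ls)"
proof -
  have "(\<Prod>(L, n)\<leftarrow>zip (map (map_series \<phi>) Ls) ns. L ^ (n - 1)) = map_series \<phi> (\<Prod>(L, n)\<leftarrow>zip Ls ns. L ^ (n - 1))" for ns
    by (induction Ls ns rule: list_induct2') (simp_all add: map_series_1 map_series_times map_series_power)
  then show ?thesis
    unfolding gen_series_gsum by (simp add: map_series_gsum map_series_times map_series_const del: One_nat_def)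
qed

lemma map_series_exp_series: "map_series \<phi> (exp_series a L) = exp_series (\<phi> a) (map_series \<phi> L)"
  unfolding exp_series_eq mseries_exp_def map_series_gsum
  by (simp add: map_series_times map_series_const map_series_power scalar)

end

lemma map_series_tensor_series:
  assumes "alg_morphism g" "alg_morphism h"
  shows "map_series (pairing g h) (tensor_series f f') = map_series g f * map_series h f'"
  by (rule mseries_eqI)
     (simp add: coeff_map_series tensor_series_def coeff_simps times_mseries.rep_eq case_prod_unfold
        alg_morphism.sum[OF alg_morphism_pairing[OF assms]] pairing_tensor[OF assms])

lemma map_series_small: "alg_morphism \<phi> \<Longrightarrow> small f \<Longrightarrow> small (map_series \<phi> f)"
  by (simp add: small_def coeff_map_series alg_morphism.zero)

text \<open>The homomorphism acts on the coefficients and the slots replace the variables. Since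
  both are compatible with generating series and exponentials, a generic formula can be evaluated
  term by term.\<close>

locale evaluation = substitution V \<sigma> + alg_morphism \<phi>
  for V and \<sigma> :: "nat \<Rightarrow> 'm::comm_monoid_add series" and \<phi> :: "('k::comm_monoid_add \<Rightarrow>\<^sub>0 rat) \<Rightarrow> 'm \<Rightarrow>\<^sub>0 rat"
begin

definition ev :: "'k series \<Rightarrow> 'm series" where
  "ev f = subst V \<sigma> (map_series \<phi> f)"

lemma ev_add: "ev (f + g) = ev f + ev g"
  and ev_diff: "ev (f - g) = ev f - ev g"
  and ev_uminus: "ev (- f) = - ev f"
  and ev_times: "ev (f * g) = ev f * ev g"
  and ev_power: "ev (f ^ n) = ev f ^ n"
  and ev_1: "ev 1 = 1"
  and ev_sum: "ev (sum F A) = (\<Sum>x\<in>A. ev (F x))"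
  and ev_prod: "ev (prod F A) = (\<Prod>x\<in>A. ev (F x))"
  and ev_tvar: "i \<in> V \<Longrightarrow> ev (tvar i) = \<sigma> i"
  by (simp_all add: ev_def map_series_add map_series_diff map_series_uminus map_series_times map_series_power
      map_series_1 map_series_sum map_series_prod map_series_tvar
      subst_add subst_diff subst_uminus subst_times subst_power subst_1 subst_sum subst_prod subst_tvar)

lemma ev_gen_series:
  assumes "\<And>L. L \<in> set Ls \<Longrightarrow> small L"
  shows "ev (gen_series c Ls) = gen_series (\<lambda>ns. \<phi> (c ns)) (map ev Ls)"
  using assms map_series_small[OF alg_morphism_axioms]
  by (simp add: ev_def[abs_def] map_series_gen_series, subst subst_gen_series) (auto simp: o_def)

lemma ev_exp_series: "small L \<Longrightarrow> ev (exp_series a L) = exp_series (\<phi> a) (ev L)"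
  using map_series_small[OF alg_morphism_axioms]
  by (simp add: ev_def map_series_exp_series subst_exp_series[OF substitution_axioms])

end

definition symbol_series :: "'k::comm_monoid_add point \<Rightarrow> nat list \<Rightarrow> 'k series list \<Rightarrow> 'k series" where
  "symbol_series \<phi> ps Ls = gen_series (\<lambda>ns. \<phi> (symbol ps ns)) Ls"

lemma symbol_series_Nil: "alg_morphism \<phi> \<Longrightarrow> symbol_series \<phi> ps [] = 1"
  by (simp add: symbol_series_def gen_series_Nil symbol_def symbol_monomial_def alg_morphism.one)

text \<open>
  $A_P$ and $B_p$. The base slot \<open>b\<close> rescales $A_P$ by $\exp(-[x_{1\to P}]_0 b)$ and $B_p$ inversely, which does not
  affect $A_p e_p B_p$ and makes both equal to $1$ on the empty word at \<open>b\<close>.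
\<close>

definition path_in :: "'k::comm_monoid_add point \<Rightarrow> 'k series \<Rightarrow>
    nat \<Rightarrow> 'k series \<Rightarrow> (nat, 'k series) word \<Rightarrow> 'k series" where
  "path_in \<phi> b P t u = exp_series (\<phi> (log0 1 P)) (t - b) *
     symbol_series \<phi> (map fst u @ [P]) (map (\<lambda>x. snd x - t) u)"

definition path_out :: "'k::comm_monoid_add point \<Rightarrow> 'k series \<Rightarrow>
    nat \<Rightarrow> 'k series \<Rightarrow> (nat, 'k series) word \<Rightarrow> 'k series" where
  "path_out \<phi> b p t u = (- 1) ^ length u * exp_series (- \<phi> (log0 1 p)) (end_slot t u - b) *
     symbol_series \<phi> (rev (map fst u) @ [p]) (map (\<lambda>s. end_slot t u - s) (rev (butlast (t # map snd u))))"

section \<open>The coproduct as a substitution\<close>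

text \<open>The tail of a chain behind a pair (i, j) is again a chain, but one that starts above j;
  the parameter \<open>a\<close> makes this recursive, and a = 0 gives all chains.\<close>

fun is_chain :: "nat \<Rightarrow> nat \<Rightarrow> nat list \<Rightarrow> nat list \<Rightarrow> bool" where
  "is_chain d a [] [] \<longleftrightarrow> a \<le> d"
| "is_chain d a (i # is) (j # js) \<longleftrightarrow> a < i \<and> i \<le> j \<and> is_chain d j is js"
| "is_chain d a _ _ \<longleftrightarrow> False"

lemma is_chain_length: "is_chain d a is js \<Longrightarrow> length js = length is"
  by (induction d a "is" js rule: is_chain.induct) auto

lemma is_chain_iff:
  "length is = length js \<Longrightarrow> is_chain d a is js \<longleftrightarrow> a < (is @ [d + 1]) ! 0 \<and>
     (\<forall>\<alpha><length is. is ! \<alpha> \<le> js ! \<alpha> \<and> js ! \<alpha> < (is @ [d + 1]) ! Suc \<alpha>)"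
  by (induction "is" js arbitrary: a rule: list_induct2) (auto simp: All_less_Suc2)

lemma is_chain_bounds: "is_chain d a is js \<Longrightarrow> (\<forall>i\<in>set is. a < i \<and> i \<le> d) \<and> (\<forall>j\<in>set js. a < j \<and> j \<le> d) \<and> a \<le> d"
proof (induction d a "is" js rule: is_chain.induct)
  case (2 d a i "is" j js)
  then show ?case by fastforce
qed auto

lemma chains_eq: "chains d = {(is, js). is_chain d 0 is js}"
proof -
  have "(is, js) \<in> chains d \<longleftrightarrow> is_chain d 0 is js" for "is" js
  proof
    assume a: "(is, js) \<in> chains d"
    then have "length is = length js" by (simp add: chains_def)
    moreover have "0 < (is @ [d + 1]) ! 0" using a by (cases "is") (auto simp: chains_def)
    ultimately show "is_chain d 0 is js" using a by (auto simp: is_chain_iff chains_def)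
  next
    assume a: "is_chain d 0 is js"
    then have "length js = length is" by (rule is_chain_length)
    moreover have "1 \<le> is ! \<alpha>" if "\<alpha> < length is" for \<alpha>
      using is_chain_bounds[OF a] nth_mem[OF that] by auto
    ultimately show "(is, js) \<in> chains d" using a by (auto simp: is_chain_iff chains_def)
  qed
  then show ?thesis by auto
qed

lemma finite_is_chain: "finite {(is, js). is_chain d a is js}"
proof (rule finite_subset[OF _ finite_chains[of d]])
  have "is_chain d 0 is js" if "is_chain d a is js" for "is" js
    using that by (cases "is"; cases js) auto
  then show "{(is, js). is_chain d a is js} \<subseteq> chains d" by (auto simp: chains_eq)
qed

lemma sum_is_chain:
  assumes "a \<le> d"
  shows "(\<Sum>(is, js)\<in>{(is, js). is_chain d a is js}. F is js) =
    F [] [] + (\<Sum>i\<in>{a<..d}. \<Sum>j\<in>{i..d}. \<Sum>(is, js)\<in>{(is, js). is_chain d j is js}. F (i # is) (j # js))"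
proof -
  let ?C = "\<lambda>a. {(is, js). is_chain d a is js}"
  let ?S = "Sigma {a<..d} (\<lambda>i. Sigma {i..d} ?C)"
  have C: "?C a = insert ([], []) ((\<lambda>(i, j, is, js). (i # is, j # js)) ` ?S)"
  proof (intro set_eqI iffI)
    fix z assume z: "z \<in> ?C a"
    obtain "is" js where [simp]: "z = (is, js)" by (cases z)
    show "z \<in> insert ([], []) ((\<lambda>(i, j, is, js). (i # is, j # js)) ` ?S)"
    proof (cases "is"; cases js)
      fix i is' j js' assume [simp]: "is = i # is'" "js = j # js'"
      have ch: "a < i" "i \<le> j" "is_chain d j is' js'" using z by auto
      moreover have "j \<le> d" using is_chain_bounds[OF ch(3)] by simp
      ultimately have "(i, j, is', js') \<in> ?S" by auto
      then show ?thesis by (intro insertI2 image_eqI[of _ _ "(i, j, is', js')"]) auto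
    qed (use z in auto)
  qed (use assms in auto)
  have "finite ?S" using finite_is_chain by auto
  moreover have "inj_on (\<lambda>(i, j, is, js). (i # is, j # js)) ?S" by (auto simp: inj_on_def)
  ultimately have "(\<Sum>(is, js)\<in>?C a. F is js) = F [] [] + (\<Sum>(i, j, is, js)\<in>?S. F (i # is) (j # js))"
    unfolding C by (subst sum.insert) (auto simp: sum.reindex case_prod_unfold o_def)
  also have "(\<Sum>(i, j, is, js)\<in>?S. F (i # is) (j # js)) =
      (\<Sum>i\<in>{a<..d}. \<Sum>j\<in>{i..d}. \<Sum>(is, js)\<in>?C j. F (i # is) (j # js))"
    using finite_is_chain by (subst sum.Sigma[symmetric]; auto intro!: sum.cong simp: sum.Sigma case_prod_unfold)
  finally show ?thesis .
qed

definition segment :: "(nat \<Rightarrow> 'l) \<Rightarrow> (nat \<Rightarrow> 's) \<Rightarrow> nat \<Rightarrow> nat \<Rightarrow> ('l, 's) word" where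
  "segment p x i j = map (\<lambda>r. (p r, x r)) [i..<j]"

lemma length_segment [simp]: "length (segment p x i j) = j - i"
  and take_segment: "i + k \<le> j \<Longrightarrow> take k (segment p x i j) = segment p x i (i + k)"
  and drop_segment: "drop k (segment p x i j) = segment p x (i + k) j"
  by (simp_all add: segment_def take_map drop_map take_upt del: upt_Suc)

lemma nth_segment: "i + k < j \<Longrightarrow> segment p x i j ! k = (p (i + k), x (i + k))"
  using nth_map_upt[of k j i "\<lambda>r. (p r, x r)"] by (simp add: segment_def)

lemma end_slot_segment: "i \<le> j \<Longrightarrow> end_slot (x i) (segment p x (Suc i) (Suc j)) = x j"
  by (induction j) (auto simp: segment_def le_Suc_eq)

text \<open>\<open>a\<close> is the position whose slot is current. A pair (i, j) says that the
  letter at i is substituted and that its B-factor extends to j; the letter handed to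
  \<open>f\<close> accordingly carries the slot at j.\<close>

fun chain_weight where
  "chain_weight A B P p x d f a [] js = f [] * A P (x a) (segment p x (Suc a) (Suc d))"
| "chain_weight A B P p x d f a (i # is) js = A (p i) (x a) (segment p x (Suc a) i) *
     B (p i) (x i) (segment p x (Suc i) (Suc (hd js))) * chain_weight A B P p x d (\<lambda>z. f ((p i, x (hd js)) # z)) (hd js) is (tl js)"

text \<open>A chain is precisely a way of cutting the word when sigma(f) A_P is expanded: A up to
  i_1, the letter at i_1, B up to j_1, and so on, the final A_P taking what lies behind the last j.
  This matches the index set of the coproduct formula.\<close>

lemma sigma_chains:
  fixes A B :: "('l, 's, 'a::comm_ring_1) family"
  assumes "a \<le> d"
  shows "conv (sigma A B f (x a)) (A P) (x a) (segment p x (Suc a) (Suc d)) =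
    (\<Sum>(is, js)\<in>{(is, js). is_chain d a is js}. chain_weight A B P p x d f a is js)"
  using assms
proof (induction "d - a" arbitrary: a f rule: less_induct)
  case less
  let ?w = "segment p x (Suc a) (Suc d)"
  let ?S = "\<lambda>f e. conv (sigma A B f e) (A P) e"
  have "?S f (x a) ?w = f [] * A P (x a) ?w +
      mark (\<lambda>p. A p (x a)) (\<lambda>p s. conv (B p s) (\<lambda>e. ?S (\<lambda>z. f ((p, e) # z)) e) s) ?w"
    unfolding sigma_fun_eq[of A B f "x a"]
    by (simp add: conv_add_left conv_unit_left conv_mark_left conv_assoc)
  also have "mark (\<lambda>p. A p (x a)) (\<lambda>p s. conv (B p s) (\<lambda>e. ?S (\<lambda>z. f ((p, e) # z)) e) s) ?w =
     (\<Sum>i'<d - a. A (p (Suc (a + i'))) (x a) (segment p x (Suc a) (Suc (a + i'))) *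
        conv (B (p (Suc (a + i'))) (x (Suc (a + i')))) (\<lambda>e. ?S (\<lambda>z. f ((p (Suc (a + i')), e) # z)) e)
          (x (Suc (a + i'))) (segment p x (Suc (Suc (a + i'))) (Suc d)))"
    unfolding mark_index
    by (intro sum.cong) (auto simp: nth_segment take_segment drop_segment)
  also have "\<dots> = (\<Sum>i\<in>{a<..d}. A (p i) (x a) (segment p x (Suc a) i) *
        conv (B (p i) (x i)) (\<lambda>e. ?S (\<lambda>z. f ((p i, e) # z)) e) (x i) (segment p x (Suc i) (Suc d)))"
    by (rule sum.reindex_bij_witness[where i = "\<lambda>i. i - a - 1" and j = "\<lambda>i'. Suc (a + i')"]) auto
  also have "\<dots> = (\<Sum>i\<in>{a<..d}. \<Sum>j\<in>{i..d}. \<Sum>(is, js)\<in>{(is, js). is_chain d j is js}. chain_weight A B P p x d f a (i # is) (j # js))"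
  proof (rule sum.cong[OF refl])
    fix i assume i: "i \<in> {a<..d}"
    have "conv (B (p i) (x i)) (\<lambda>e. ?S (\<lambda>z. f ((p i, e) # z)) e) (x i) (segment p x (Suc i) (Suc d)) =
       (\<Sum>j'\<le>d - i. B (p i) (x i) (segment p x (Suc i) (Suc (i + j'))) *
          ?S (\<lambda>z. f ((p i, x (i + j')) # z)) (x (i + j')) (segment p x (Suc (i + j')) (Suc d)))"
      unfolding conv_index[of "B (p i) (x i)"]
    proof (intro sum.cong)
      fix j' assume j': "j' \<in> {..d - i}"
      have "take j' (segment p x (Suc i) (Suc d)) = segment p x (Suc i) (Suc (i + j'))"
        "drop j' (segment p x (Suc i) (Suc d)) = segment p x (Suc (i + j')) (Suc d)"
        using i j' by (auto simp: take_segment drop_segment)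
      then show "B (p i) (x i) (take j' (segment p x (Suc i) (Suc d))) *
          ?S (\<lambda>z. f ((p i, end_slot (x i) (take j' (segment p x (Suc i) (Suc d)))) # z))
            (end_slot (x i) (take j' (segment p x (Suc i) (Suc d)))) (drop j' (segment p x (Suc i) (Suc d))) =
          B (p i) (x i) (segment p x (Suc i) (Suc (i + j'))) *
          ?S (\<lambda>z. f ((p i, x (i + j')) # z)) (x (i + j')) (segment p x (Suc (i + j')) (Suc d))"
        by (simp only: end_slot_segment[OF le_add1])
    qed (use i in auto)
    also have "\<dots> = (\<Sum>j\<in>{i..d}. B (p i) (x i) (segment p x (Suc i) (Suc j)) *
          ?S (\<lambda>z. f ((p i, x j) # z)) (x j) (segment p x (Suc j) (Suc d)))"
      by (rule sum.reindex_bij_witness[where i = "\<lambda>j. j - i" and j = "\<lambda>j'. i + j'"]) (use i in auto)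
    also have "\<dots> = (\<Sum>j\<in>{i..d}. B (p i) (x i) (segment p x (Suc i) (Suc j)) *
          (\<Sum>(is, js)\<in>{(is, js). is_chain d j is js}. chain_weight A B P p x d (\<lambda>z. f ((p i, x j) # z)) j is js))"
      by (intro sum.cong refl mult_cong less) (use i in auto)
    finally show "A (p i) (x a) (segment p x (Suc a) i) *
        conv (B (p i) (x i)) (\<lambda>e. ?S (\<lambda>z. f ((p i, e) # z)) e) (x i) (segment p x (Suc i) (Suc d)) =
        (\<Sum>j\<in>{i..d}. \<Sum>(is, js)\<in>{(is, js). is_chain d j is js}. chain_weight A B P p x d f a (i # is) (j # js))"
      by (simp add: sum_distrib_left case_prod_unfold mult_ac)
  qed
  finally show ?case unfolding sum_is_chain[OF less.prems] by simp
qed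


text \<open>One factor of the product over \<alpha> in the coproduct formula, with k for
  i_{\<alpha>+1}. It combines a B-factor on i, ..., j with the A-factor on j, ..., k that
  follows.\<close>

definition chain_term ::
  "'k::comm_monoid_add point \<Rightarrow> (nat \<Rightarrow> nat) \<Rightarrow> (nat \<Rightarrow> 'k series) \<Rightarrow> nat \<Rightarrow> nat \<Rightarrow> nat \<Rightarrow> 'k series" where
  "chain_term h p x i j k = (- 1) ^ (j - i) * exp_series (h (log0 (p i) (p k))) (x j) *
     symbol_series h (map p (rev [i..<j + 1])) (map (\<lambda>r. x j - x r) (rev [i..<j])) *
     symbol_series h (map p [j + 1..<k + 1]) (map (\<lambda>r. x r - x j) [j + 1..<k])"

abbreviation (input) chain_product where
  "chain_product h p x d is js \<equiv>
    \<Prod>\<alpha> = 1..length is. chain_term h p x ((is @ [d + 1]) ! (\<alpha> - 1)) (js ! (\<alpha> - 1)) ((is @ [d + 1]) ! \<alpha>)"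

lemma eval_coproduct_bar_series:
  fixes g h :: "'k::comm_monoid_add point" and ps :: "nat list"
  defines "d \<equiv> length ps - 1" and "p \<equiv> \<lambda>i. ps ! (i - 1)"
  assumes g: "alg_morphism g" and h: "alg_morphism h" and x: "\<And>i. i \<in> {1..d} \<Longrightarrow> small (x i)"
  shows "subst {1..d} x (map_series (pairing g h) (coproduct_bar_series ps)) =
    (\<Sum>(is, js)\<in>chains d. symbol_series g (map p (is @ [d + 1])) (map x js) *
       (symbol_series h (map p [1..<(is @ [d + 1]) ! 0 + 1]) (map x [1..<(is @ [d + 1]) ! 0]) *
        chain_product h p x d is js))"
proof -
  define V where "V = {1..d}"
  have V: "i \<in> V" if "0 < i" "i \<le> d" for i using that by (simp add: V_def)
  interpret substitution "V" x using x by unfold_locales (auto simp: V_def)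
  interpret G: evaluation "V" x g by (rule evaluation.intro[OF substitution_axioms g])
  interpret H: evaluation "V" x h by (rule evaluation.intro[OF substitution_axioms h])
  interpret P: alg_morphism "pairing g h" by (rule alg_morphism_pairing[OF g h])
  have summand: "subst V x (map_series (pairing g h) (tensor_series (gen_series (symbol (map p (is @ [d + 1]))) (map tvar js))
         (gen_series (symbol (map p [1..<i 1 + 1])) (map tvar [1..<i 1]) *
          (\<Prod>\<alpha> = 1..length is.
             (- 1) ^ (j \<alpha> - i \<alpha>) *
             exp_series (log0 (p (i \<alpha>)) (p (i (\<alpha> + 1)))) (tvar (j \<alpha>)) *
             gen_series (symbol (map p (rev [i \<alpha>..<j \<alpha> + 1])))
               (map (\<lambda>r. tvar (j \<alpha>) - tvar r) (rev [i \<alpha>..<j \<alpha>])) *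
             gen_series (symbol (map p [j \<alpha> + 1..<i (\<alpha> + 1) + 1]))
               (map (\<lambda>r. tvar r - tvar (j \<alpha>)) [j \<alpha> + 1..<i (\<alpha> + 1)]))))) =
      symbol_series g (map p (is @ [d + 1])) (map x js) *
       (symbol_series h (map p [1..<(is @ [d + 1]) ! 0 + 1]) (map x [1..<(is @ [d + 1]) ! 0]) *
        chain_product h p x d is js)"
    if ch: "(is, js) \<in> chains d" and i: "i = (\<lambda>\<alpha>. (is @ [d + 1]) ! (\<alpha> - 1))" and j: "j = (\<lambda>\<alpha>. js ! (\<alpha> - 1))" for "is" js i j
  proof -
    have len: "length js = length is" using ch by (simp add: chains_def)
    have b: "(\<forall>i\<in>set is. 0 < i \<and> i \<le> d) \<and> (\<forall>j\<in>set js. 0 < j \<and> j \<le> d)"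
      using ch is_chain_bounds by (auto simp: chains_eq)
    have ib: "1 \<le> i \<alpha> \<and> i \<alpha> \<le> d + 1" if "1 \<le> \<alpha>" "\<alpha> \<le> length is + 1" for \<alpha>
    proof (cases "\<alpha> \<le> length is")
      case True
      then have "\<alpha> - 1 < length is" using that by linarith
      then have "i \<alpha> \<in> set is" by (simp add: i nth_append del: One_nat_def)
      then show ?thesis using b by auto
    next
      case False
      then have "\<alpha> = length is + 1" using that by simp
      then show ?thesis by (simp add: i)
    qed
    have jb: "1 \<le> j \<alpha> \<and> j \<alpha> \<le> d" if "1 \<le> \<alpha>" "\<alpha> \<le> length is" for \<alpha>
    proof -
      have "\<alpha> - 1 < length js" using that len by linarith
      then have "j \<alpha> \<in> set js" by (simp add: j del: One_nat_def)
      then show ?thesis using b by auto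
    qed
    have 1: "G.ev (gen_series (symbol (map p (is @ [d + 1]))) (map tvar js)) = symbol_series g (map p (is @ [d + 1])) (map x js)"
      unfolding symbol_series_def using b
      by (subst G.ev_gen_series) (auto simp: G.ev_tvar V Suc_le_eq intro!: arg_cong[where f = "gen_series _"])
    have 2: "H.ev (gen_series (symbol (map p [1..<i 1 + 1])) (map tvar [1..<i 1])) =
        symbol_series h (map p [1..<(is @ [d + 1]) ! 0 + 1]) (map x [1..<(is @ [d + 1]) ! 0])"
      unfolding symbol_series_def using ib[of 1]
      by (subst H.ev_gen_series) (auto simp: H.ev_tvar V Suc_le_eq i intro!: arg_cong[where f = "gen_series _"])
    have 3: "H.ev ((- 1) ^ (j \<alpha> - i \<alpha>) *
             exp_series (log0 (p (i \<alpha>)) (p (i (\<alpha> + 1)))) (tvar (j \<alpha>)) *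
             gen_series (symbol (map p (rev [i \<alpha>..<j \<alpha> + 1])))
               (map (\<lambda>r. tvar (j \<alpha>) - tvar r) (rev [i \<alpha>..<j \<alpha>])) *
             gen_series (symbol (map p [j \<alpha> + 1..<i (\<alpha> + 1) + 1]))
               (map (\<lambda>r. tvar r - tvar (j \<alpha>)) [j \<alpha> + 1..<i (\<alpha> + 1)])) =
        chain_term h p x ((is @ [d + 1]) ! (\<alpha> - 1)) (js ! (\<alpha> - 1)) ((is @ [d + 1]) ! \<alpha>)"
      if \<alpha>: "\<alpha> \<in> {1..length is}" for \<alpha>
    proof -
      have "i (\<alpha> + 1) = (is @ [d + 1]) ! \<alpha>" using \<alpha> by (simp add: i)
      moreover have "H.ev (gen_series (symbol q) (map (\<lambda>r. tvar (j \<alpha>) - tvar r) (rev [i \<alpha>..<j \<alpha>]))) =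
          symbol_series h q (map (\<lambda>r. x (j \<alpha>) - x r) (rev [i \<alpha>..<j \<alpha>]))" for q
        unfolding symbol_series_def using ib[of \<alpha>] jb[of \<alpha>] \<alpha>
        by (subst H.ev_gen_series) (auto simp: H.ev_tvar V Suc_le_eq H.ev_diff small_diff intro!: arg_cong[where f = "gen_series _"])
      moreover have "H.ev (gen_series (symbol q) (map (\<lambda>r. tvar r - tvar (j \<alpha>)) [j \<alpha> + 1..<i (\<alpha> + 1)])) =
          symbol_series h q (map (\<lambda>r. x r - x (j \<alpha>)) [j \<alpha> + 1..<i (\<alpha> + 1)])" for q
        unfolding symbol_series_def using ib[of "\<alpha> + 1"] jb[of \<alpha>] \<alpha>
        by (subst H.ev_gen_series) (auto simp: H.ev_tvar V Suc_le_eq H.ev_diff small_diff intro!: arg_cong[where f = "gen_series _"])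
      ultimately show ?thesis
        using jb[of \<alpha>] \<alpha> unfolding chain_term_def
        by (simp add: H.ev_times H.ev_power H.ev_uminus H.ev_1 H.ev_exp_series H.ev_tvar V Suc_le_eq i j del: upt_Suc)
    qed
    show ?thesis
      unfolding map_series_tensor_series[OF g h] subst_times G.ev_def[symmetric] H.ev_def[symmetric]
        H.ev_times[of "gen_series _ _" "prod _ _"] H.ev_prod 1 2
      by (intro mult_cong refl prod.cong 3)
  qed
  show ?thesis
    unfolding V_def[symmetric] coproduct_bar_series_def Let_def P.map_series_sum subst_sum d_def[symmetric] p_def[symmetric]
    by (intro sum.cong refl) (use summand in \<open>auto simp only: case_prod_conv\<close>)
qed

lemma subst_cong: "(\<And>i. i \<in> V \<Longrightarrow> \<sigma> i = \<tau> i) \<Longrightarrow> subst V \<sigma> f = subst V \<tau> f"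
  unfolding subst_def monomial_value_def
  by (intro gsum_cong mult_cong prod.cong refl) auto

lemma symbol_eq_gen: "ns \<noteq> [] \<Longrightarrow> symbol ps ns = gen (Abs_generator (Symbol ps ns))"
  by (simp add: symbol_def symbol_monomial_def gen_def)

text \<open>The coproduct of each symbol is a coefficient of one series, and
  \<open>gen_series_coeff\<close> puts these coefficients together again.\<close>

lemma symbol_series_convolution:
  assumes g: "alg_morphism g" and h: "alg_morphism h"
    and ps: "increasing ps" "\<forall>i\<in>set ps. 1 \<le> i" "length ps = Suc d" "d \<noteq> 0"
    and Ls: "length Ls = d" "\<And>L. L \<in> set Ls \<Longrightarrow> small L"
  shows "symbol_series (convolution g h) ps Ls =
    subst {1..d} (\<lambda>i. Ls ! (i - 1)) (map_series (pairing g h) (coproduct_bar_series ps))"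
proof -
  have "convolution g h (symbol ps ns) = coeff (map_series (pairing g h) (coproduct_bar_series ps)) (t_exponent ns)"
    if "ns \<in> gen_indices d" for ns
  proof -
    have ns: "ns \<noteq> []" "valid_generator (Symbol ps ns)"
      using that ps by (auto simp: gen_indices_def)
    then have "coproduct_bar (symbol ps ns) = coeff (coproduct_bar_series ps) (t_exponent ns)"
      by (simp add: symbol_eq_gen gen_def coproduct_bar_def alg_hom_gen[unfolded One_nat_def] Abs_generator_inverse)
    then show ?thesis by (simp add: convolution_def coeff_map_series)
  qed
  then have "symbol_series (convolution g h) ps Ls =
      gen_series (\<lambda>ns. coeff (map_series (pairing g h) (coproduct_bar_series ps)) (t_exponent ns)) Ls"
    unfolding symbol_series_def using Ls by (intro gen_series_cong) simp
  then show ?thesis using gen_series_coeff[OF Ls(2)] Ls(1) by simp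
qed

lemma convolution_log0:
  assumes "alg_morphism g" "alg_morphism h" "1 \<le> P"
  shows "convolution g h (log0 1 P) = g (log0 1 P) + h (log0 1 P)"
proof -
  have "convolution g h (gen (Abs_generator (Log0 r))) = g (gen (Abs_generator (Log0 r))) + h (gen (Abs_generator (Log0 r)))"
    if "1 \<le> r" for r
  proof -
    have "coproduct_bar (gen (Abs_generator (Log0 r))) = gen (Abs_generator (Log0 r)) \<otimes> 1 + 1 \<otimes> gen (Abs_generator (Log0 r))"
      unfolding coproduct_bar_def using that
      by (subst gen_def, subst alg_hom_gen) (simp add: Abs_generator_inverse)
    then show ?thesis
      using alg_morphism.add[OF alg_morphism_pairing[OF assms(1,2)]]
      by (simp add: convolution_def pairing_tensor[OF assms(1,2)] alg_morphism.one[OF assms(1)] alg_morphism.one[OF assms(2)])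
  qed
  moreover have "log0 1 P = (\<Sum>r\<in>{1..<P}. gen (Abs_generator (Log0 r)))" using assms(3) by (simp add: log0_def)
  ultimately show ?thesis
    by (simp only: alg_morphism.sum[OF alg_morphism_convolution[OF assms(1,2)]]
      alg_morphism.sum[OF assms(1)] alg_morphism.sum[OF assms(2)] sum.distrib[symmetric])
      (auto intro!: sum.cong)
qed

lemma log0_diff: "1 \<le> a \<Longrightarrow> 1 \<le> b \<Longrightarrow> log0 a b = log0 1 b - log0 1 a"
proof -
  have *: "log0 1 b = log0 1 a + (\<Sum>r\<in>{a..<b}. gen (Abs_generator (Log0 r)))" if "1 \<le> a" "a \<le> b" for a b
    using that sum.atLeastLessThan_concat[of 1 a b "\<lambda>r. gen (Abs_generator (Log0 r))"] by (simp add: log0_def)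
  show "1 \<le> a \<Longrightarrow> 1 \<le> b \<Longrightarrow> log0 a b = log0 1 b - log0 1 a"
    using *[of a b] *[of b a] by (cases "a \<le> b") (simp_all add: log0_def[of a b])
qed

section \<open>Change of base slot and the composition law for A\<close>

lemma path_in_rebase:
  assumes "small t" "small b" "small c"
  shows "path_in \<phi> b P t u = exp_series (\<phi> (log0 1 P)) (c - b) * path_in \<phi> c P t u"
  using exp_series_add_right[of "c - b" "t - c" "\<phi> (log0 1 P)"] assms by (simp add: path_in_def small_diff)

lemma small_end_slot: "small t \<Longrightarrow> (\<And>x. x \<in> set u \<Longrightarrow> small (snd x)) \<Longrightarrow> small (end_slot t u)"
  by (induction u arbitrary: t) auto

lemma path_out_rebase:
  assumes "small (end_slot t u)" "small b" "small c"
  shows "path_out \<phi> b p t u = exp_series (- \<phi> (log0 1 p)) (c - b) * path_out \<phi> c p t u"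
  using exp_series_add_right[of "c - b" "end_slot t u - c" "- \<phi> (log0 1 p)"] assms
  by (simp add: path_out_def small_diff mult_ac)

lemma path_in_unit: "alg_morphism \<phi> \<Longrightarrow> path_in \<phi> b P b [] = 1"
  by (simp add: path_in_def symbol_series_Nil)

lemma path_out_unit: "alg_morphism \<phi> \<Longrightarrow> path_out \<phi> b p b [] = 1"
  by (simp add: path_out_def symbol_series_Nil)

lemma sigma_path_rebase:
  assumes "small t" "small b" "small c" "\<And>x. x \<in> set w \<Longrightarrow> small (snd x)"
  shows "sigma (path_in \<phi> b) (path_out \<phi> b) f t w = sigma (path_in \<phi> c) (path_out \<phi> c) f t w"
proof -
  have "exp_series a L * exp_series (- a) L = 1" if "small L" for a :: "'a \<Rightarrow>\<^sub>0 rat" and L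
    using exp_series_add_left[OF that, of a "- a"] by simp
  then have "sigma (\<lambda>p t u. exp_series (\<phi> (log0 1 p)) (c - b) * path_in \<phi> c p t u)
      (\<lambda>p t u. exp_series (- \<phi> (log0 1 p)) (c - b) * path_out \<phi> c p t u) f t w = sigma (path_in \<phi> c) (path_out \<phi> c) f t w"
    using assms by (intro sigma_rescale[where c = "\<lambda>p. exp_series (\<phi> (log0 1 p)) (c - b)" and d = "\<lambda>p. exp_series (- \<phi> (log0 1 p)) (c - b)"])
      (simp_all add: small_diff)
  moreover have "sigma (path_in \<phi> b) (path_out \<phi> b) f t w = sigma (\<lambda>p t u. exp_series (\<phi> (log0 1 p)) (c - b) * path_in \<phi> c p t u)
      (\<lambda>p t u. exp_series (- \<phi> (log0 1 p)) (c - b) * path_out \<phi> c p t u) f t w"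
  proof -
    have "\<forall>s\<in>snd ` set w. small s" using assms(4) by auto
    then show ?thesis
      using assms(1-3) by (intro sigma_cong path_in_rebase path_out_rebase small_end_slot) auto
  qed
  ultimately show ?thesis by simp
qed

lemma path_in_segment:
  assumes "j < k"
  shows "path_in \<phi> b (p k) (x j) (segment p x (Suc j) k) = exp_series (\<phi> (log0 1 (p k))) (x j - b) *
    symbol_series \<phi> (map p [j + 1..<k + 1]) (map (\<lambda>r. x r - x j) [j + 1..<k])"
  using assms by (simp add: path_in_def segment_def o_def)

text \<open>The slot x_i belongs to the letter e_{p_i} in front of the word and x_j is the end slot.
  The result is the signed factor in y_{j-1}^{-1}, ..., y_i^{-1} of the coproduct formula, apart
  from the normalizing exponential.\<close>

lemma path_out_segment:
  assumes "i \<le> j"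
  shows "path_out \<phi> b (p i) (x i) (segment p x (Suc i) (Suc j)) = (- 1) ^ (j - i) *
    exp_series (- \<phi> (log0 1 (p i))) (x j - b) *
    symbol_series \<phi> (map p (rev [i..<j + 1])) (map (\<lambda>r. x j - x r) (rev [i..<j]))"
proof -
  have "x i # map x [Suc i..<Suc j] = map x [i..<Suc j]" "p i # map p [Suc i..<Suc j] = map p [i..<Suc j]"
    using assms upt_conv_Cons[of i "Suc j"] by (simp_all del: upt_Suc)
  moreover have "butlast (map x [i..<Suc j]) = map x [i..<j]" using assms by simp
  moreover have "rev (map p [Suc i..<Suc j]) @ [p i] = rev (p i # map p [Suc i..<Suc j])" by simp
  ultimately show ?thesis
    unfolding path_out_def end_slot_segment[OF assms]
    by (simp add: segment_def o_def rev_map del: upt_Suc rev.simps)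
qed

text \<open>The product A B A B ... A of the expansion is regrouped: the leading A stays alone and
  each B joins the A behind it. There the exponentials of -[x_{1 \<rightarrow> p_i}]_0 and
  [x_{1 \<rightarrow> p_k}]_0 merge into that of [y_{i \<rightarrow> k}]_0.\<close>

lemma chain_weight_eq:
  assumes h: "alg_morphism h" and p: "\<And>i. i \<in> {1..d + 1} \<Longrightarrow> 1 \<le> p i" "p (d + 1) = P"
    and x: "\<And>i. i \<le> d \<Longrightarrow> small (x i)" and t: "small t"
  shows "is_chain d a is js \<Longrightarrow> chain_weight (path_in h t) (path_out h t) P p x d f a is js =
    f (zip (map p is) (map x js)) * (exp_series (h (log0 1 (p ((is @ [d + 1]) ! 0)))) (x a - t) *
      symbol_series h (map p [a + 1..<(is @ [d + 1]) ! 0 + 1]) (map (\<lambda>r. x r - x a) [a + 1..<(is @ [d + 1]) ! 0])) *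
    chain_product h p (\<lambda>r. x r - t) d is js"
proof (induction "is" arbitrary: a js f)
  case Nil
  then have "js = []" "a < d + 1" by (cases js; simp)+
  then show ?case using path_in_segment[of a "d + 1" h t p x] p by simp
next
  case (Cons i "is")
  then obtain j js' where js: "js = j # js'" and ch: "a < i" "i \<le> j" "is_chain d j is js'"
    by (cases js) auto
  define k where "k = (is @ [d + 1]) ! 0"
  have "j \<le> d" using is_chain_bounds[OF ch(3)] by simp
  have k: "j < k" "k \<le> d + 1"
    using is_chain_bounds[OF ch(3)] by (cases "is"; auto simp: k_def)+
  have "small (x j - t)" using x t \<open>j \<le> d\<close> by (simp add: small_diff)
  moreover have "h (log0 (p i) (p k)) = - h (log0 1 (p i)) + h (log0 1 (p k))"
    using p ch k \<open>j \<le> d\<close> by (subst log0_diff) (auto simp: alg_morphism.diff[OF h])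
  ultimately have e: "exp_series (h (log0 (p i) (p k))) (x j - t) =
      exp_series (- h (log0 1 (p i))) (x j - t) * exp_series (h (log0 1 (p k))) (x j - t)"
    by (simp only: exp_series_add_left)
  have H: "path_out h t (p i) (x i) (segment p x (Suc i) (Suc j)) * (exp_series (h (log0 1 (p k))) (x j - t) *
      symbol_series h (map p [j + 1..<k + 1]) (map (\<lambda>r. x r - x j) [j + 1..<k])) = chain_term h p (\<lambda>r. x r - t) i j k"
    unfolding chain_term_def path_out_segment[OF ch(2)] e by (simp add: mult_ac)
  have prod: "(\<Prod>\<alpha> = 1..length (i # is). F \<alpha>) = F 1 * (\<Prod>\<alpha> = 1..length is. F (Suc \<alpha>))" for F :: "nat \<Rightarrow> 'a series"
    by (simp add: prod.atLeast_Suc_atMost prod.shift_bounds_cl_Suc_ivl del: prod.cl_ivl_Suc)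
  have "chain_weight (path_in h t) (path_out h t) P p x d f a (i # is) js =
    path_in h t (p i) (x a) (segment p x (Suc a) i) * path_out h t (p i) (x i) (segment p x (Suc i) (Suc j)) *
    (f ((p i, x j) # zip (map p is) (map x js')) * (exp_series (h (log0 1 (p k))) (x j - t) *
      symbol_series h (map p [j + 1..<k + 1]) (map (\<lambda>r. x r - x j) [j + 1..<k])) *
    chain_product h p (\<lambda>r. x r - t) d is js')"
    unfolding js chain_weight.simps list.sel Cons.IH[OF ch(3)] k_def ..
  also have "\<dots> = f ((p i, x j) # zip (map p is) (map x js')) * path_in h t (p i) (x a) (segment p x (Suc a) i) *
    (chain_term h p (\<lambda>r. x r - t) i j k *
    chain_product h p (\<lambda>r. x r - t) d is js')"
    unfolding H[symmetric] by (simp only: mult_ac)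
  also have "(chain_term h p (\<lambda>r. x r - t) i j k *
    chain_product h p (\<lambda>r. x r - t) d is js') =
    chain_product h p (\<lambda>r. x r - t) d (i # is) js"
    unfolding prod js k_def
    by (intro mult_cong prod.cong refl) (auto simp: nth_Cons')
  finally show ?case using path_in_segment[OF ch(1), of h t p x] by (simp add: js)
qed

lemma path_in_convolution:
  assumes g: "alg_morphism g" and h: "alg_morphism h"
    and inc: "increasing (map fst u @ [P])" "\<forall>i\<in>set (map fst u @ [P]). 1 \<le> i"
    and small: "small b" "small t" "\<And>x. x \<in> set u \<Longrightarrow> small (snd x)"
  shows "path_in (convolution g h) b P t u =
    conv (sigma (path_in h b) (path_out h b) (path_in g b P t) t) (path_in h b P) t u"
proof -
  let ?k = "convolution g h"
  note k = alg_morphism_convolution[OF g h]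
  \<comment> \<open>In the coproduct formula the first factor carries no exponential, which is the
    normalization with base slot \<open>t\<close>. A general base is reached afterwards by
    rescaling.\<close>
  have base: "path_in ?k t P t u = conv (sigma (path_in h t) (path_out h t) (path_in g t P t) t) (path_in h t P) t u"
  proof (cases "u = []")
    case True
    then show ?thesis by (simp add: path_in_unit g h k sigma_eq)
  next
    case False
    \<comment> \<open>Position 0 carries the start slot, so that letters are numbered from 1 as in
      the coproduct formula.\<close>
    define d p x where "d = length u" and "p = (\<lambda>i. (map fst u @ [P]) ! (i - 1))" and "x = (\<lambda>i. if i = 0 then t else snd (u ! (i - 1)))"
    have u: "segment p x (Suc 0) (Suc d) = u"
      by (rule nth_equalityI) (auto simp: d_def nth_segment p_def x_def nth_append)
    have sx: "small (x i)" if "i \<le> d" for i using that small by (auto simp: x_def d_def)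
    have p1: "1 \<le> p i" if "i \<in> {1..d + 1}" for i
    proof -
      have "p i \<in> set (map fst u @ [P])" unfolding p_def using that by (intro nth_mem) (auto simp: d_def)
      then show ?thesis using inc(2) by blast
    qed
    have x0: "x 0 = t" by (simp add: x_def)
    have pP: "p (d + 1) = P" by (simp add: p_def d_def nth_append)
    have ps: "map fst u @ [P] \<noteq> []" "length (map fst u @ [P]) - 1 = d" by (simp_all add: d_def)
    have "path_in ?k t P t u = symbol_series ?k (map fst u @ [P]) (map (\<lambda>x. snd x - t) u)"
      by (simp add: path_in_def)
    also have "\<dots> = subst {1..d} (\<lambda>i. map (\<lambda>x. snd x - t) u ! (i - 1)) (map_series (pairing g h) (coproduct_bar_series (map fst u @ [P])))"
      using inc False small by (intro symbol_series_convolution[OF g h]) (auto simp: d_def small_diff)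
    also have "\<dots> = subst {1..d} (\<lambda>r. x r - t) (map_series (pairing g h) (coproduct_bar_series (map fst u @ [P])))"
      by (intro subst_cong) (auto simp: x_def d_def)
    also have "\<dots> = (\<Sum>(is, js)\<in>chains d. symbol_series g (map p (is @ [d + 1])) (map (\<lambda>r. x r - t) js) *
       (symbol_series h (map p [1..<(is @ [d + 1]) ! 0 + 1]) (map (\<lambda>r. x r - t) [1..<(is @ [d + 1]) ! 0]) *
        chain_product h p (\<lambda>r. x r - t) d is js))"
      using eval_coproduct_bar_series[OF g h, of "map fst u @ [P]" "\<lambda>r. x r - t"] sx small(2)
      unfolding ps(2) p_def by (simp add: small_diff)
    also have "\<dots> = (\<Sum>(is, js)\<in>{(is, js). is_chain d 0 is js}. chain_weight (path_in h t) (path_out h t) P p x d (path_in g t P t) 0 is js)"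
      unfolding chains_eq
    proof (intro sum.cong refl, clarify)
      fix "is" js assume ch: "is_chain d 0 is js"
      have "length js = length is" using is_chain_length[OF ch] .
      then have "map fst (zip (map p is) (map x js)) = map p is" "map snd (zip (map p is) (map x js)) = map x js"
        by simp_all
      moreover have "map (\<lambda>z. snd z - t) (zip (map p is) (map x js)) = map (\<lambda>s. s - t) (map snd (zip (map p is) (map x js)))"
        by simp
      ultimately have "map (\<lambda>z. snd z - t) (zip (map p is) (map x js)) = map (\<lambda>r. x r - t) js"
        "map fst (zip (map p is) (map x js)) = map p is" by simp_all
      then have "path_in g t P t (zip (map p is) (map x js)) = symbol_series g (map p (is @ [d + 1])) (map (\<lambda>r. x r - t) js)"
        using pP unfolding path_in_def
        by (simp del: map_map)
      then show "symbol_series g (map p (is @ [d + 1])) (map (\<lambda>r. x r - t) js) *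
       (symbol_series h (map p [1..<(is @ [d + 1]) ! 0 + 1]) (map (\<lambda>r. x r - t) [1..<(is @ [d + 1]) ! 0]) *
        chain_product h p (\<lambda>r. x r - t) d is js) =
        chain_weight (path_in h t) (path_out h t) P p x d (path_in g t P t) 0 is js"
        using chain_weight_eq[where h = h and p = p and x = x and d = d and P = P and t = t and f = "path_in g t P t", OF h p1 pP sx small(2) ch]
        by (simp only: x0 diff_self exp_series_0 mult_1_left add_0 mult_ac)
    qed
    also have "\<dots> = conv (sigma (path_in h t) (path_out h t) (path_in g t P t) t) (path_in h t P) t u"
      using sigma_chains[of 0 d "path_in h t" "path_out h t" "path_in g t P t" x P p] unfolding u by (simp add: x_def)
    finally show ?thesis .
  qed
  have "path_in ?k b P t u = (exp_series (g (log0 1 P)) (t - b) * exp_series (h (log0 1 P)) (t - b)) * path_in ?k t P t u"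
  proof -
    have "1 \<le> P" using inc(2) by simp
    show ?thesis
      unfolding path_in_rebase[OF small(2,1,2), of ?k P] convolution_log0[OF g h \<open>1 \<le> P\<close>]
        exp_series_add_left[OF small_diff[OF small(2,1)]] ..
  qed
  moreover have "conv (sigma (path_in h b) (path_out h b) (path_in g b P t) t) (path_in h b P) t u =
      conv (\<lambda>u. exp_series (g (log0 1 P)) (t - b) * sigma (path_in h t) (path_out h t) (path_in g t P t) t u)
        (\<lambda>s v. exp_series (h (log0 1 P)) (t - b) * path_in h t P s v) t u"
  proof (intro conv_cong mult_cong)
    fix u1 v assume uv: "u = u1 @ v"
    have "path_in g b P t = (\<lambda>z. exp_series (g (log0 1 P)) (t - b) * path_in g t P t z)"
      using small by (intro ext path_in_rebase)
    moreover have "sigma (path_in h b) (path_out h b) f t u1 = sigma (path_in h t) (path_out h t) f t u1" for f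
      using small uv by (intro sigma_path_rebase) auto
    ultimately show "sigma (path_in h b) (path_out h b) (path_in g b P t) t u1 =
        exp_series (g (log0 1 P)) (t - b) * sigma (path_in h t) (path_out h t) (path_in g t P t) t u1"
      by (simp add: sigma_scale)
    show "path_in h b P (end_slot t u1) v = exp_series (h (log0 1 P)) (t - b) * path_in h t P (end_slot t u1) v"
      using small uv by (intro path_in_rebase small_end_slot) auto
  qed
  ultimately show ?thesis unfolding base by (simp add: conv_scale_left conv_scale_right)
qed

section \<open>The inversion relation\<close>

text \<open>Here l_k is the entry of 1 + d from the first letter to the k-th, and r_k that of 1 + a
  from the k-th letter to e_P. The value l_1 = 1 and the empty word in r_{d+1} represent the
  adjoined unit; R sits between the neighbouring letters j and j + 1.\<close>

lemma through_rhs_index: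
  fixes A B :: "('l, 's, 'a::comm_ring_1) family"
  assumes A: "\<And>P. A P b [] = 1" and d: "1 \<le> d" and P: "P = p (Suc d)"
    and l: "l = (\<lambda>k. if k = 1 then 1 else B (p 1) (x 1) (segment p x 2 k @ [(p k, b)]))"
    and r: "r = (\<lambda>k. A P b (segment p x k (Suc d)))"
  shows "through_rhs \<rho> c b A B (p 1) (x 1) (segment p x 2 (Suc d)) P =
    (\<Sum>j=1..d. \<rho> (x j) * (l j * r (Suc j))) - c * (\<Sum>k=1..Suc d. l k * r k)"
proof -
  let ?w = "segment p x 2 (Suc d)" and ?a = "head_coeff A b" and ?d = "last_coeff B b"
  define X where "X = (\<lambda>(p::'l) s w P. \<rho> s * A P b w)"
  have X: "(\<lambda>p s w P. slot_weight \<rho> p s w P + letter_comp (slot_weight \<rho>) ?a p s w P) = X"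
  proof (intro ext)
    fix p :: 'l and s w P
    have "mark (\<lambda>q u. 0) K w = 0" for K :: "'l \<Rightarrow> 's \<Rightarrow> ('l, 's) word \<Rightarrow> 'a" and w
      using mark_scale_left[of 0 "\<lambda>q u. 0" K w] by simp
    then show "slot_weight \<rho> p s w P + letter_comp (slot_weight \<rho>) ?a p s w P = X p s w P"
      by (cases w) (simp_all add: slot_weight_def letter_comp_def head_coeff_def X_def A)
  qed
  have mk: "mark (\<lambda>q u. B (p 1) (x 1) (u @ [(q, b)])) K ?w =
      (\<Sum>k=2..d. l k * K (p k) (x k) (segment p x (Suc k) (Suc d)))" for K
  proof -
    have "mark (\<lambda>q u. B (p 1) (x 1) (u @ [(q, b)])) K ?w =
      (\<Sum>i<d - 1. l (i + 2) * K (p (i + 2)) (x (i + 2)) (segment p x (Suc (i + 2)) (Suc d)))"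
      unfolding mark_index by (intro sum.cong) (auto simp: nth_segment take_segment drop_segment l)
    also have "\<dots> = (\<Sum>k=2..d. l k * K (p k) (x k) (segment p x (Suc k) (Suc d)))"
      by (rule sum.reindex_bij_witness[where i = "\<lambda>k. k - 2" and j = "\<lambda>i. i + 2"]) auto
    finally show ?thesis .
  qed
  have seg: "segment p x k (Suc d) = (p k, x k) # segment p x (Suc k) (Suc d)" if "k \<le> d" for k
    using that unfolding segment_def by (subst upt_conv_Cons) auto
  have "slot_weight \<rho> (p 1) (x 1) ?w P + letter_comp ?d (slot_weight \<rho>) (p 1) (x 1) ?w P + letter_comp (slot_weight \<rho>) ?a (p 1) (x 1) ?w P +
      letter_comp ?d (letter_comp (slot_weight \<rho>) ?a) (p 1) (x 1) ?w P = X (p 1) (x 1) ?w P + letter_comp ?d X (p 1) (x 1) ?w P"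
    unfolding X[symmetric] comp_add_right by simp
  also have "\<dots> = (\<Sum>j=1..d. \<rho> (x j) * (l j * r (Suc j)))"
    using d unfolding letter_comp_def last_coeff_def mk sum.atLeast_Suc_atMost[OF d]
    by (auto simp: X_def l r numeral_2_eq_2 intro!: sum.cong)
  finally have 1: "slot_weight \<rho> (p 1) (x 1) ?w P + letter_comp ?d (slot_weight \<rho>) (p 1) (x 1) ?w P + letter_comp (slot_weight \<rho>) ?a (p 1) (x 1) ?w P +
      letter_comp ?d (letter_comp (slot_weight \<rho>) ?a) (p 1) (x 1) ?w P = (\<Sum>j=1..d. \<rho> (x j) * (l j * r (Suc j)))" .
  have "letter_comp ?d ?a (p 1) (x 1) ?w P = (\<Sum>k=2..d. l k * r k)"
    unfolding letter_comp_def last_coeff_def mk head_coeff_def r by (intro sum.cong refl) (simp add: seg)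
  moreover have "?a (p 1) (x 1) ?w P = l 1 * r 1"
    using seg[OF d] by (simp add: head_coeff_def l r numeral_2_eq_2)
  moreover have "?d (p 1) (x 1) ?w P = l (Suc d) * r (Suc d)"
    using d by (simp add: last_coeff_def l r P A segment_def)
  moreover have "(\<Sum>k=1..Suc d. l k * r k) = l 1 * r 1 + ((\<Sum>k=2..d. l k * r k) + l (Suc d) * r (Suc d))"
    using d by (simp add: sum.atLeast_Suc_atMost[OF d[unfolded One_nat_def]] numeral_2_eq_2 add.assoc)
  ultimately have 2: "?a (p 1) (x 1) ?w P + ?d (p 1) (x 1) ?w P + letter_comp ?d ?a (p 1) (x 1) ?w P = (\<Sum>k=1..Suc d. l k * r k)"
    by simp
  show ?thesis unfolding through_rhs_def Let_def 1 2 ..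
qed

lemma through_index:
  assumes d: "1 \<le> d"
  shows "through \<rho> A B (p 1) (x 1) (segment p x 2 (Suc d)) P =
    (\<Sum>j=1..d. \<rho> (x j) * (B (p 1) (x 1) (segment p x 2 (Suc j)) * A P (x j) (segment p x (Suc j) (Suc d))))"
proof -
  have "through \<rho> A B (p 1) (x 1) (segment p x 2 (Suc d)) P =
    (\<Sum>j\<le>d - 1. \<rho> (x (Suc j)) * (B (p 1) (x 1) (segment p x 2 (Suc (Suc j))) * A P (x (Suc j)) (segment p x (Suc (Suc j)) (Suc d))))"
    unfolding through_def conv_index
  proof (intro sum.cong)
    fix j assume j: "j \<in> {..d - 1}"
    have "take j (segment p x 2 (Suc d)) = segment p x 2 (Suc (Suc j))"
      using j d by (subst take_segment) auto
    moreover have "end_slot (x 1) (segment p x 2 (Suc (Suc j))) = x (Suc j)"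
      using end_slot_segment[of 1 "Suc j" x p] by (simp add: numeral_2_eq_2)
    ultimately show "B (p 1) (x 1) (take j (segment p x 2 (Suc d))) *
        (\<rho> (end_slot (x 1) (take j (segment p x 2 (Suc d)))) *
         A P (end_slot (x 1) (take j (segment p x 2 (Suc d)))) (drop j (segment p x 2 (Suc d)))) =
      \<rho> (x (Suc j)) * (B (p 1) (x 1) (segment p x 2 (Suc (Suc j))) * A P (x (Suc j)) (segment p x (Suc (Suc j)) (Suc d)))"
      by (simp add: drop_segment mult_ac)
  qed (use d in auto)
  also have "\<dots> = (\<Sum>j=1..d. \<rho> (x j) * (B (p 1) (x 1) (segment p x 2 (Suc j)) * A P (x j) (segment p x (Suc j) (Suc d))))"
    by (rule sum.reindex_bij_witness[where i = "\<lambda>k. k - 1" and j = Suc]) (use d in auto)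
  finally show ?thesis .
qed

text \<open>A point invariant under INV takes the same value on an inverted symbol and on its image,
  so the recursion for \<open>inv_symbol\<close> becomes one for the values on inverted
  symbols.\<close>

lemma symbol_series_inv_symbol:
  assumes g: "alg_morphism g" and inv: "\<And>a. g (INV a) = g a"
    and ps: "increasing ps" "\<forall>i\<in>set ps. 1 \<le> i" "length ps = Suc (length Ls)"
  shows "gen_series (\<lambda>ns. g (inv_symbol ps ns)) Ls = symbol_series g (rev ps) Ls"
  unfolding symbol_series_def
proof (rule gen_series_cong)
  fix ns assume ns: "ns \<in> gen_indices (length Ls)"
  show "g (inv_symbol ps ns) = g (symbol (rev ps) ns)"
  proof (cases "ns = []")
    case True
    then have "length ps = 1" using ns ps(3) by (simp add: gen_indices_def)
    then show ?thesis using True by (subst inv_symbol.simps) (simp add: symbol_def symbol_monomial_def)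
  next
    case False
    have "valid_generator (Symbol (rev ps) ns)"
      using ns ps False by (auto simp: gen_indices_def increasing_def decreasing_def sorted_wrt_rev)
    \<comment> \<open>A decreasing sequence with at least two entries is not increasing, so INV
      takes its branch for inverted symbols.\<close>
    moreover have "\<not> increasing (rev ps)"
    proof
      assume "increasing (rev ps)"
      moreover obtain a q b where "ps = a # q @ [b]"
      proof -
        have "length ps \<ge> 2" using False ns ps(3) by (cases ns) (auto simp: gen_indices_def)
        then obtain a q' where "ps = a # q'" "q' \<noteq> []" by (cases ps; cases "tl ps") auto
        then show ?thesis using that by (metis append_butlast_last_id)
      qed
      ultimately show False using ps(1) by (auto simp: increasing_def sorted_wrt_append)
    qed
    ultimately have "INV (symbol (rev ps) ns) = inv_symbol ps ns"
      unfolding symbol_eq_gen[OF False] gen_def INV_def alg_hom_gen by (simp add: Abs_generator_inverse)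
    then show ?thesis using inv[of "symbol (rev ps) ns"] by simp
  qed
qed

lemma sign_cancel: "(- 1) ^ n * ((- 1) ^ n * z) = (z :: 'a::comm_ring_1)"
  by (simp flip: mult.assoc power_mult_distrib)

text \<open>The recursion for INV at t_i = x_i - b, with its first sum moved to the left: the j-th
  summand there is the term k = j + 1, and the symbol being defined supplies k = d + 1. After
  multiplication by c the denominator t_j turns into the factor \<rho>_j.\<close>

lemma inversion_relation:
  fixes g :: "'k::comm_monoid_add point" and ps :: "nat list"
  assumes g: "alg_morphism g" and inv: "\<And>a. g (INV a) = g a"
    and ps: "increasing ps" "\<forall>i\<in>set ps. 1 \<le> i" "length ps = Suc d" and d: "1 \<le> d"
    and x: "\<And>i. 1 \<le> i \<Longrightarrow> i \<le> d \<Longrightarrow> small (x i)" and b: "small b"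
    and \<rho>: "\<And>i. 1 \<le> i \<Longrightarrow> i \<le> d \<Longrightarrow> (x i - b) * \<rho> i = c"
    and l: "l = (\<lambda>k. (- 1) ^ (k - 1) * symbol_series g (rev (take k ps)) (map (\<lambda>r. b - x r) (rev [1..<k])))"
    and r: "r = (\<lambda>k. symbol_series g (drop (k - 1) ps) (map (\<lambda>r. x r - b) [k..<d + 1]))"
    and m: "m = (\<lambda>j. symbol_series g (rev (take j ps)) (map (\<lambda>r. x j - x r) (rev [1..<j])) *
      exp_series (g (log0 (hd ps) (last ps))) (x j - b) *
      symbol_series g (drop j ps) (map (\<lambda>r. x r - x j) [j + 1..<d + 1]))"
  shows "c * (\<Sum>k=1..Suc d. l k * r k) = (\<Sum>j=1..d. \<rho> j * (l j * r (Suc j) - (- 1) ^ (j - 1) *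
     m j))"
proof -
  define V where "V = {1..d}"
  have V: "i \<in> V" if "0 < i" "i \<le> d" for i using that by (simp add: V_def)
  define \<sigma> where "\<sigma> = (\<lambda>i. x i - b)"
  interpret substitution V \<sigma>
    using x b by unfold_locales (auto simp: V_def \<sigma>_def small_diff)
  interpret evaluation V \<sigma> g by (rule evaluation.intro[OF substitution_axioms g])
  have ev_t: "ev (tvar i) = x i - b" if "0 < i" "i \<le> d" for i
    using ev_tvar[OF V[OF that]] by (simp add: \<sigma>_def)
  define f where "f = (\<lambda>j. gen_series (inv_symbol (take j ps)) (map (\<lambda>r. - tvar r) (rev [1..<j])) *
             gen_series (symbol (drop j ps)) (map tvar [j + 1..<d + 1])
             - gen_series (inv_symbol (take j ps)) (map (\<lambda>r. tvar j - tvar r) (rev [1..<j])) *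
               exp_series (log0 (hd ps) (last ps)) (tvar j) *
               gen_series (symbol (drop j ps)) (map (\<lambda>r. tvar r - tvar j) [j + 1..<d + 1]))"
  define R where "R = (\<Sum>j\<in>{0..d - 1}. (- 1) ^ (d - 1 + j) *
            gen_series (inv_symbol (take (j + 1) ps)) (map (\<lambda>r. - tvar r) (rev [1..<j + 1])) *
            gen_series (symbol (drop j ps)) (map tvar [j + 1..<d + 1])) +
         (\<Sum>j\<in>{1..d}. (- 1) ^ (d - 1 + j) * divide_t j (f j))"
  have inv_symbol: "inv_symbol ps ns = (- 1) ^ (\<Sum>n\<leftarrow>ns. n - 1) * coeff R (t_exponent (rev ns))" for ns
    using ps d by (subst inv_symbol.simps) (simp add: Let_def R_def f_def del: upt_Suc)
  have inc: "increasing (take j ps)" "increasing (drop j ps)" for j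
    using ps by (auto simp: increasing_def sorted_wrt_take sorted_wrt_drop)
  have ev_inv: "ev (gen_series (inv_symbol (take j ps)) Ls) = symbol_series g (rev (take j ps)) (map ev Ls)"
    if "\<And>L. L \<in> set Ls \<Longrightarrow> small L" "Suc (length Ls) = j" "j \<le> Suc d" for j Ls
    using that ps inc by (subst ev_gen_series, simp, subst symbol_series_inv_symbol[OF g inv]) (auto dest: in_set_takeD)
  have ev_sym: "ev (gen_series (symbol q) Ls) = symbol_series g q (map ev Ls)" if "\<And>L. L \<in> set Ls \<Longrightarrow> small L" for q Ls
    using that by (subst ev_gen_series) (simp_all add: symbol_series_def)
  have "symbol_series g (rev ps) (map (\<lambda>r. b - x r) (rev [1..<Suc d])) = ev R"
  proof -
    let ?Ls = "map \<sigma> [1..<Suc d]"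
    have small: "small L" if "L \<in> set ?Ls" for L using that x b by (auto simp: \<sigma>_def small_diff)
    \<comment> \<open>The slots b - x_r in reverse order are the arguments -t_d, ..., -t_1 of the
      recursion, so sign and reversal in \<open>inv_symbol\<close> disappear.\<close>
    have Ms: "map (\<lambda>r. b - x r) (rev [1..<Suc d]) = map uminus (rev ?Ls)"
      by (simp add: \<sigma>_def rev_map o_def del: upt_Suc)
    have "symbol_series g (rev ps) (map uminus (rev ?Ls)) = gen_series (\<lambda>ns. g (inv_symbol ps ns)) (map uminus (rev ?Ls))"
      using ps by (intro symbol_series_inv_symbol[OF g inv, symmetric]) auto
    also have "\<dots> = gen_series (\<lambda>ns. (- 1) ^ (\<Sum>n\<leftarrow>ns. n - 1) * coeff (map_series g R) (t_exponent (rev ns))) (map uminus (rev ?Ls))"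
      by (simp only: inv_symbol times power uminus one coeff_map_series)
    also have "\<dots> = gen_series (\<lambda>ns. coeff (map_series g R) (t_exponent (rev ns))) (rev ?Ls)"
      unfolding gen_series_sign by (simp add: o_def del: upt_Suc)
    also have "\<dots> = gen_series (\<lambda>ns. coeff (map_series g R) (t_exponent ns)) ?Ls"
      using gen_series_rev[of "rev ?Ls" "\<lambda>ns. coeff (map_series g R) (t_exponent ns)"] small by simp
    also have "\<dots> = subst {1..length ?Ls} (\<lambda>i. ?Ls ! (i - 1)) (map_series g R)"
      by (rule gen_series_coeff[OF small])
    also have "\<dots> = subst V \<sigma> (map_series g R)"
    proof -
      have "length ?Ls = d" by simp
      then show ?thesis unfolding V_def by (simp only:) (rule subst_cong, auto simp del: upt_Suc)
    qed
    also have "\<dots> = ev R" by (simp add: ev_def)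
    finally show ?thesis unfolding Ms .
  qed
  then have L: "l (Suc d) = (- 1) ^ d * ev R"
    using ps by (simp add: l del: upt_Suc)
  have l_ev: "ev (gen_series (inv_symbol (take k ps)) (map (\<lambda>r. - tvar r) (rev [1..<k]))) = (- 1) ^ (k - 1) * l k"
    if "1 \<le> k" "k \<le> d" for k
  proof -
    have "ev (gen_series (inv_symbol (take k ps)) (map (\<lambda>r. - tvar r) (rev [1..<k]))) =
        symbol_series g (rev (take k ps)) (map (\<lambda>r. b - x r) (rev [1..<k]))"
      using that by (subst ev_inv) (auto simp: small_uminus ev_uminus ev_t Suc_le_eq intro!: arg_cong[where f = "symbol_series g _"])
    then show ?thesis by (simp only: l sign_cancel)
  qed
  have r_ev: "ev (gen_series (symbol (drop j ps)) (map tvar [j + 1..<d + 1])) = r (Suc j)" for j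
    by (subst ev_sym) (auto simp: r ev_t Suc_le_eq intro!: arg_cong[where f = "symbol_series g _"])
  have f_ev: "ev (f j) = (- 1) ^ (j - 1) * (l j * r (Suc j)) - m j" if j: "1 \<le> j" "j \<le> d" for j
  proof -
    have "ev (gen_series (inv_symbol (take j ps)) (map (\<lambda>r. tvar j - tvar r) (rev [1..<j]))) =
        symbol_series g (rev (take j ps)) (map (\<lambda>r. x j - x r) (rev [1..<j]))"
      using j by (subst ev_inv) (auto simp: small_diff ev_diff ev_t Suc_le_eq intro!: arg_cong[where f = "symbol_series g _"])
    moreover have "ev (gen_series (symbol (drop j ps)) (map (\<lambda>r. tvar r - tvar j) [j + 1..<d + 1])) =
        symbol_series g (drop j ps) (map (\<lambda>r. x r - x j) [j + 1..<d + 1])"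
      using j by (subst ev_sym) (auto simp: small_diff ev_diff ev_t Suc_le_eq intro!: arg_cong[where f = "symbol_series g _"])
    moreover have "ev (exp_series (log0 (hd ps) (last ps)) (tvar j)) = exp_series (g (log0 (hd ps) (last ps))) (x j - b)"
      using j by (simp add: ev_exp_series ev_t Suc_le_eq)
    ultimately show ?thesis
      unfolding f_def ev_diff ev_times l_ev[OF j] r_ev m by (simp add: mult.assoc)
  qed
  \<comment> \<open>The quotient by t_j exists before evaluation; afterwards c = (x_j - b) \<rho>_j
    lets it be replaced without dividing by x_j - b.\<close>
  have q: "c * ev (divide_t j (f j)) = \<rho> j * ev (f j)" if j: "1 \<le> j" "j \<le> d" for j
  proof -
    have "tvar j * divide_t j (f j) = f j" unfolding f_def by (rule inv_symbol_quotient)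
    then have "ev (f j) = (x j - b) * ev (divide_t j (f j))"
      using j ev_times[of "tvar j" "divide_t j (f j)"] ev_t[of j] by simp
    then show ?thesis using \<rho>[OF j] by (simp add: mult_ac flip: \<open>(x j - b) * \<rho> j = c\<close>)
  qed
  have sgn: "(- 1) ^ d * ((- 1) ^ (d - 1 + j) * ((- 1) ^ j * z)) = - z" for j and z :: "'k series"
  proof -
    have "(- 1) ^ d * ((- 1) ^ (d - 1 + j) * ((- 1) ^ j * z)) = - ((- 1) ^ (d - 1) * ((- 1) ^ (d - 1) * ((- 1) ^ j * ((- 1) ^ j * z))))"
      using d by (cases d) (simp_all add: power_add mult.assoc)
    then show ?thesis by (simp only: sign_cancel)
  qed
  have sgn': "(- 1) ^ d * ((- 1) ^ (d - 1 + j) * z) = (- 1) ^ (j - 1) * z" if "1 \<le> j" for j and z :: "'k series"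
  proof -
    have "(- 1) ^ d * ((- 1) ^ (d - 1 + j) * z) = (- 1) ^ (d - 1) * ((- 1) ^ (d - 1) * ((- 1) ^ (j - 1) * z))"
      using d that by (cases d; cases j) (simp_all add: power_add mult.assoc)
    then show ?thesis by (simp only: sign_cancel)
  qed
  have "l (Suc d) = (\<Sum>j\<in>{0..d - 1}. - (l (Suc j) * r (Suc j))) + (\<Sum>j\<in>{1..d}. (- 1) ^ (j - 1) * ev (divide_t j (f j)))"
  proof -
    have "(- 1) ^ d * ev ((- 1) ^ (d - 1 + j) *
            gen_series (inv_symbol (take (j + 1) ps)) (map (\<lambda>r. - tvar r) (rev [1..<j + 1])) *
            gen_series (symbol (drop j ps)) (map tvar [j + 1..<d + 1])) = - (l (Suc j) * r (Suc j))" if "j \<in> {0..d - 1}" for j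
    proof -
      have "1 \<le> j + 1" "j + 1 \<le> d" using that d by auto
      then show ?thesis
        unfolding ev_times l_ev[OF \<open>1 \<le> j + 1\<close> \<open>j + 1 \<le> d\<close>] r_ev ev_power ev_uminus ev_1
        using sgn[of j "l (Suc j) * r (Suc j)"] by (simp add: mult.assoc)
    qed
    moreover have "(- 1) ^ d * ev ((- 1) ^ (d - 1 + j) * divide_t j (f j)) = (- 1) ^ (j - 1) * ev (divide_t j (f j))" if "j \<in> {1..d}" for j
      using that sgn'[of j] by (simp add: ev_times ev_power ev_uminus ev_1)
    ultimately show ?thesis
      unfolding L R_def ev_add ev_sum distrib_left sum_distrib_left by (intro arg_cong2[where f = "(+)"] sum.cong refl) auto
  qed
  moreover have "(\<Sum>j\<in>{0..d - 1}. l (Suc j) * r (Suc j)) = (\<Sum>k=1..d. l k * r k)"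
    by (rule sum.reindex_bij_witness[where i = "\<lambda>k. k - 1" and j = Suc]) (use d in auto)
  moreover have "r (Suc d) = 1"
    using g by (simp add: r symbol_series_Nil)
  ultimately have "(\<Sum>k=1..Suc d. l k * r k) = (\<Sum>j\<in>{1..d}. (- 1) ^ (j - 1) * ev (divide_t j (f j)))"
    by (simp add: sum_negf)
  then have "c * (\<Sum>k=1..Suc d. l k * r k) = (\<Sum>j\<in>{1..d}. (- 1) ^ (j - 1) * (\<rho> j * ev (f j)))"
    by (simp add: sum_distrib_left q[symmetric] mult_ac)
  also have "\<dots> = (\<Sum>j=1..d. \<rho> j * (l j * r (Suc j) - (- 1) ^ (j - 1) *
     m j))"
  proof (rule sum.cong[OF refl])
    fix j assume "j \<in> {1..d}"
    then have j: "1 \<le> j" "j \<le> d" by auto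
    have "(- 1) ^ (j - 1) * (\<rho> j * ((- 1) ^ (j - 1) * y - z)) = \<rho> j * ((- 1) ^ (j - 1) * ((- 1) ^ (j - 1) * y) - (- 1) ^ (j - 1) * z)" for y z
      by (simp add: algebra_simps)
    then show "(- 1) ^ (j - 1) * (\<rho> j * ev (f j)) = \<rho> j * (l j * r (Suc j) - (- 1) ^ (j - 1) *
     m j)"
      unfolding f_ev[OF j] by (simp only: sign_cancel)
  qed
  finally show ?thesis .
qed

text \<open>Translates \<open>inversion_relation\<close> by the two index formulas: l and r are
  \<open>path_out\<close> and \<open>path_in\<close> at the slot \<open>b\<close>, and m_j, up to
  sign, is their product at the cut x_j.\<close>

lemma through_path_INV:
  fixes g :: "'k::comm_monoid_add point"
  assumes g: "alg_morphism g" and inv: "\<And>a. g (INV a) = g a"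
    and ok: "ok_word {1..} D l w P" "s \<in> D"
    and small: "small b" "\<And>y. y \<in> D \<Longrightarrow> small y" and \<rho>: "\<And>y. y \<in> D \<Longrightarrow> (y - b) * \<rho> y = c"
  shows "through \<rho> (path_in g b) (path_out g b) l s w P = through_rhs \<rho> c b (path_in g b) (path_out g b) l s w P"
proof -
  define ps d p x where "ps = l # map fst w @ [P]" and "d = Suc (length w)"
    and "p = (\<lambda>i. ps ! (i - 1))" and "x = (\<lambda>i. (s # map snd w) ! (i - 1))"
  have ps: "increasing ps" "\<forall>i\<in>set ps. 1 \<le> i" "length ps = Suc d" and d: "1 \<le> d"
    using ok(1) by (auto simp: ok_word_def increasing_def ps_def d_def)
  have w: "segment p x 2 (Suc d) = w"
    by (rule nth_equalityI) (auto simp: d_def nth_segment p_def x_def ps_def nth_append)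
  have p1: "p 1 = l" and x1: "x 1 = s" and pP: "P = p (Suc d)"
    by (simp_all add: p_def x_def ps_def d_def nth_append)
  have xD: "x i \<in> D" if "1 \<le> i" "i \<le> d" for i
  proof -
    have "x i \<in> set (s # map snd w)" unfolding x_def using that by (intro nth_mem) (auto simp: d_def)
    then show ?thesis using ok by (auto simp: ok_word_def)
  qed
  have take: "map p [1..<Suc k] = take k ps" if "k \<le> Suc d" for k
    using that ps(3) by (intro nth_equalityI) (auto simp: p_def nth_append simp del: upt_Suc)
  have drop: "map p [Suc k..<Suc (Suc d)] = drop k ps" for k
    using ps(3) by (intro nth_equalityI) (auto simp: p_def simp del: upt_Suc)
  have hl: "hd ps = p 1" "last ps = p (Suc d)"
    using ps(3) by (simp_all add: p_def ps_def d_def nth_append)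
  define lf where "lf = (\<lambda>k. (- 1) ^ (k - 1) * symbol_series g (rev (take k ps)) (map (\<lambda>r. b - x r) (rev [1..<k])))"
  define rf where "rf = (\<lambda>k. symbol_series g (drop (k - 1) ps) (map (\<lambda>r. x r - b) [k..<d + 1]))"
  define m where "m = (\<lambda>j. symbol_series g (rev (take j ps)) (map (\<lambda>r. x j - x r) (rev [1..<j])) *
      exp_series (g (log0 (hd ps) (last ps))) (x j - b) *
      symbol_series g (drop j ps) (map (\<lambda>r. x r - x j) [j + 1..<d + 1]))"
  define lf' where "lf' = (\<lambda>k. if k = 1 then 1 else path_out g b (p 1) (x 1) (segment p x 2 k @ [(p k, b)]))"
  define rf' where "rf' = (\<lambda>k. path_in g b P b (segment p x k (Suc d)))"
  have lf: "lf' k = lf k" if "1 \<le> k" "k \<le> Suc d" for k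
  proof (cases "k = 1")
    case True
    then show ?thesis by (simp add: lf'_def lf_def symbol_series_Nil[OF g])
  next
    case False
    then have k: "2 \<le> k" using that by simp
    have "map snd (segment p x 2 k @ [(p k, b)]) = map x [2..<k] @ [b]"
      "map fst (segment p x 2 k @ [(p k, b)]) = map p [2..<k] @ [p k]"
      by (simp_all add: segment_def o_def)
    moreover have "x 1 # map x [2..<k] = map x [1..<k]" "p 1 # map p [2..<k] @ [p k] = map p [1..<Suc k]"
      using k upt_conv_Cons[of 1 k] by (simp_all add: numeral_2_eq_2)
    ultimately have "x 1 # map snd (segment p x 2 k @ [(p k, b)]) = map x [1..<k] @ [b]"
      "p 1 # map fst (segment p x 2 k @ [(p k, b)]) = take k ps"
      using take[of k] that(2) by (metis append_Cons)+
    then have "butlast (x 1 # map snd (segment p x 2 k @ [(p k, b)])) = map x [1..<k]"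
      "rev (map fst (segment p x 2 k @ [(p k, b)])) @ [p 1] = rev (take k ps)"
      by (metis butlast_snoc, metis rev.simps(2))
    moreover have "length (segment p x 2 k @ [(p k, b)]) = k - 1" using k by simp
    moreover have "end_slot (x 1) (segment p x 2 k @ [(p k, b)]) = b" by simp
    ultimately show ?thesis
      using False unfolding lf'_def lf_def path_out_def by (simp only: if_False diff_self exp_series_0 mult_1_right rev_map map_map o_def)
  qed
  have rf: "rf' k = rf k" if "1 \<le> k" "k \<le> Suc d" for k
  proof -
    have "map fst (segment p x k (Suc d)) @ [P] = map p [k..<Suc (Suc d)]"
      using that by (simp add: segment_def o_def pP)
    also have "\<dots> = drop (k - 1) ps" using drop[of "k - 1"] that by simp
    finally have "map fst (segment p x k (Suc d)) @ [P] = drop (k - 1) ps" .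
    then show ?thesis
      unfolding rf'_def rf_def path_in_def by (simp add: segment_def o_def del: upt_Suc)
  qed
  have "through_rhs \<rho> c b (path_in g b) (path_out g b) (p 1) (x 1) (segment p x 2 (Suc d)) P =
      (\<Sum>j=1..d. \<rho> (x j) * (lf' j * rf' (Suc j))) - c * (\<Sum>k=1..Suc d. lf' k * rf' k)"
    by (rule through_rhs_index[where A = "path_in g b" and B = "path_out g b" and p = p and x = x, OF path_in_unit[OF g] d pP lf'_def rf'_def])
  also have "\<dots> = (\<Sum>j=1..d. \<rho> (x j) * (lf j * rf (Suc j))) - c * (\<Sum>k=1..Suc d. lf k * rf k)"
    by (intro arg_cong2[where f = "(-)"] mult_cong refl sum.cong) (auto simp: lf rf)
  also have "c * (\<Sum>k=1..Suc d. lf k * rf k) = (\<Sum>j=1..d. \<rho> (x j) * (lf j * rf (Suc j) - (- 1) ^ (j - 1) *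
     m j))"
    using small xD \<rho> by (intro inversion_relation[OF g inv ps d _ _ _ lf_def rf_def m_def]) auto
  also have "(\<Sum>j=1..d. \<rho> (x j) * (lf j * rf (Suc j))) - \<dots> =
    (\<Sum>j=1..d. \<rho> (x j) * (path_out g b (p 1) (x 1) (segment p x 2 (Suc j)) * path_in g b P (x j) (segment p x (Suc j) (Suc d))))"
    unfolding sum_subtractf[symmetric]
  \<comment> \<open>The products l_j r_{j+1} cancel. In the remaining m_j the exponential of
    [x_{l \<rightarrow> P}]_0 splits into the normalizing factors of the outgoing and the incoming
    path.\<close>
  proof (rule sum.cong[OF refl])
    fix j assume "j \<in> {1..d}"
    then have j: "1 \<le> j" "j \<le> d" by auto
    have "1 \<le> p 1" "1 \<le> p (Suc d)" using ps(2,3) by (auto simp: p_def nth_mem)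
    then have "g (log0 (hd ps) (last ps)) = - g (log0 1 (p 1)) + g (log0 1 P)"
      unfolding hl pP by (subst log0_diff) (simp_all add: alg_morphism.diff[OF g])
    moreover have "small (x j - b)" using small xD[OF j] by (simp add: small_diff)
    ultimately have e: "exp_series (g (log0 (hd ps) (last ps))) (x j - b) =
        exp_series (- g (log0 1 (p 1))) (x j - b) * exp_series (g (log0 1 P)) (x j - b)"
      by (simp only: exp_series_add_left)
    have "map p (rev [1..<j + 1]) = rev (take j ps)" "map p [j + 1..<Suc d + 1] = drop j ps"
      using take[of j] drop[of j] j by (simp_all add: rev_map[symmetric] del: upt_Suc)
    then have "path_out g b (p 1) (x 1) (segment p x 2 (Suc j)) = (- 1) ^ (j - 1) * exp_series (- g (log0 1 (p 1))) (x j - b) *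
        symbol_series g (rev (take j ps)) (map (\<lambda>r. x j - x r) (rev [1..<j]))"
      "path_in g b P (x j) (segment p x (Suc j) (Suc d)) = exp_series (g (log0 1 P)) (x j - b) *
        symbol_series g (drop j ps) (map (\<lambda>r. x r - x j) [j + 1..<d + 1])"
      using path_out_segment[OF j(1), of g b p x] path_in_segment[of j "Suc d" g b p x] j
      by (simp_all add: pP numeral_2_eq_2 del: upt_Suc)
    then show "\<rho> (x j) * (lf j * rf (Suc j)) - \<rho> (x j) * (lf j * rf (Suc j) - (- 1) ^ (j - 1) *
     m j) =
      \<rho> (x j) * (path_out g b (p 1) (x 1) (segment p x 2 (Suc j)) * path_in g b P (x j) (segment p x (Suc j) (Suc d)))"
      unfolding m_def e by (simp add: algebra_simps)
  qed
  also have "\<dots> = through \<rho> (path_in g b) (path_out g b) (p 1) (x 1) (segment p x 2 (Suc d)) P"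
    by (rule through_index[OF d, symmetric])
  finally show ?thesis unfolding w p1 x1 by simp
qed

section \<open>Cancellation of differences of variables\<close>

lemma coeff_tvar_times:
  "coeff (tvar i * f) (m + Poly_Mapping.single i 1) = coeff f m"
  "Poly_Mapping.lookup m i = 0 \<Longrightarrow> coeff (tvar i * f) m = 0"
proof -
  let ?e = "Poly_Mapping.single i (1::nat)"
  have "coeff (tvar i * f) (m + ?e) = (\<Sum>(a, b)\<in>{(?e, m)}. coeff (tvar i) a * coeff f b)"
    unfolding times_mseries.rep_eq
  proof (intro sum.mono_neutral_right finite_splits)
    have "b = m" if "?e + b = m + ?e" for b using that by (metis add.commute add_right_cancel)
    then show "\<forall>z\<in>splits (m + ?e) - {(?e, m)}. (case z of (a, b) \<Rightarrow> coeff (tvar i) a * coeff f b) = 0"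
      by (auto simp: splits_def coeff_simps split: if_splits)
  qed (simp add: splits_def add.commute)
  then show "coeff (tvar i * f) (m + ?e) = coeff f m" by (simp add: coeff_simps)
  show "coeff (tvar i * f) m = 0" if "Poly_Mapping.lookup m i = 0"
  proof -
    have "a \<noteq> ?e" if "a + b = m" for a b
    proof
      assume "a = ?e"
      then have "Poly_Mapping.lookup m i = 1 + Poly_Mapping.lookup b i" using that by (auto simp: lookup_add)
      then show False using \<open>Poly_Mapping.lookup m i = 0\<close> by simp
    qed
    then show ?thesis by (auto simp: times_mseries.rep_eq splits_def coeff_simps intro!: sum.neutral)
  qed
qed

text \<open>Valid over rings with zero divisors: t_i f = t_j f lets a coefficient be moved to one
  with smaller exponent of t_j and larger exponent of t_i, until the exponent of t_j is 0, where the
  coefficient must vanish.\<close>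

lemma tvar_diff_cancel:
  fixes f :: "'a::comm_ring_1 mseries"
  assumes "i \<noteq> j" "(tvar i - tvar j) * f = 0"
  shows "f = 0"
proof (rule mseries_eqI)
  have eq: "coeff (tvar i * f) m = coeff (tvar j * f) m" for m
    using arg_cong[OF assms(2), of "\<lambda>f. coeff f m"] by (simp add: left_diff_distrib coeff_simps)
  show "coeff f m = coeff 0 m" for m
  proof (induction "Poly_Mapping.lookup m j" arbitrary: m)
    case 0
    then show ?case
      using eq[of "m + Poly_Mapping.single i 1"] assms(1) unfolding coeff_tvar_times(1)
      by (subst (asm) coeff_tvar_times(2)) (auto simp: lookup_add lookup_single coeff_simps)
  next
    case (Suc n)
    define m' where "m' = m - Poly_Mapping.single j 1"
    have m: "m = m' + Poly_Mapping.single j 1"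
      using Suc(2) unfolding m'_def
      by (intro poly_mapping_eqI) (auto simp: lookup_add lookup_minus lookup_single when_def)
    have "coeff f m = coeff (tvar j * f) (m + Poly_Mapping.single i 1)"
      unfolding eq[symmetric] coeff_tvar_times(1) ..
    also have "m + Poly_Mapping.single i 1 = (m' + Poly_Mapping.single i 1) + Poly_Mapping.single j 1"
      unfolding m by (simp add: add_ac)
    also have "coeff (tvar j * f) \<dots> = coeff f (m' + Poly_Mapping.single i 1)"
      by (rule coeff_tvar_times(1))
    also have "\<dots> = coeff 0 (m' + Poly_Mapping.single i 1)"
      using Suc(2) assms(1) by (intro Suc(1)) (simp add: m lookup_add lookup_single)
    finally show ?case by (simp add: coeff_simps)
  qed
qed

lemma prod_tvar_diff_cancel:
  fixes f :: "'a::comm_ring_1 mseries"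
  assumes "finite D" "D \<subseteq> range tvar" "tvar j \<notin> D" "(\<Prod>y\<in>D. y - tvar j) * f = 0"
  shows "f = 0"
  using assms
proof (induction D rule: finite_induct)
  case (insert y D)
  then obtain i where y: "y = tvar i" by auto
  have "(y - tvar j) * (\<Prod>y\<in>D. y - tvar j) * f = 0"
    using insert.prems(3) insert.hyps by simp
  then have "(tvar i - tvar j) * ((\<Prod>y\<in>D. y - tvar j) * f) = 0"
    by (simp only: y mult.assoc)
  moreover have "i \<noteq> j" using insert.prems(2) y by blast
  ultimately have "(\<Prod>y\<in>D. y - tvar j) * f = 0" using tvar_diff_cancel by blast
  with insert.prems(1,2) show ?case using insert.IH by blast
qed simp

lemma comp_cong_at:
  assumes "\<And>u q s' v. w = u @ (q, s') # v \<Longrightarrow> M p s u q * N q s' v P = M' p s u q * N' q s' v P"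
  shows "letter_comp M N p s w P = letter_comp M' N' p s w P"
  unfolding letter_comp_def using assms by (intro mark_cong) auto

section \<open>Points invariant under INV and the composition law for B\<close>

lemma symbol_series_INV:
  assumes "increasing ps" "\<forall>i\<in>set ps. 1 \<le> i" "length ps = Suc (length Ls)"
  shows "symbol_series (\<phi> \<circ> INV) ps Ls = symbol_series \<phi> ps Ls"
  unfolding symbol_series_def
  using assms by (intro gen_series_cong) (auto simp: gen_indices_def intro!: arg_cong[where f = \<phi>] INV_id symbol_Hsymb)

lemma path_in_INV:
  assumes "increasing (map fst u @ [P])" "\<forall>i\<in>set (map fst u @ [P]). 1 \<le> i"
  shows "path_in (\<phi> \<circ> INV) b P t u = path_in \<phi> b P t u"
proof -
  have "INV (log0 1 P) = log0 1 P" using assms by (intro INV_id log0_Hsymb) auto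
  then show ?thesis
    using assms unfolding path_in_def by (simp add: symbol_series_INV)
qed

text \<open>These are the homomorphisms on \<open>Hsymb\<close>, extended to inverted symbols by
  means of INV.\<close>

definition is_INV_point :: "'k::comm_monoid_add point \<Rightarrow> bool" where
  "is_INV_point g \<longleftrightarrow> alg_morphism g \<and> (\<forall>a. g (INV a) = g a)"

lemma is_INV_point_compose: "alg_morphism g \<Longrightarrow> is_INV_point (g \<circ> INV)"
  by (simp add: is_INV_point_def alg_morphism_compose alg_morphism_INV INV_id INV_Hsymb)

text \<open>A variant of \<open>sigma_cong_fun\<close> that follows only the slots: a change of base
  requires small slots, whatever the letters are.\<close>

lemma sigma_cong_slots:
  fixes f g :: "('l, 's) word \<Rightarrow> 'a::comm_ring_1"
  assumes "\<And>z. snd ` set z \<subseteq> snd ` set w \<Longrightarrow> f z = g z"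
  shows "sigma A B f t w = sigma A B g t w"
  using assms
proof (induction "length w" arbitrary: f g t w rule: less_induct)
  case less
  have "mark (\<lambda>p. A p t) (\<lambda>p s. conv (B p s) (\<lambda>e. sigma A B (\<lambda>z. f ((p, e) # z)) e) s) w =
    mark (\<lambda>p. A p t) (\<lambda>p s. conv (B p s) (\<lambda>e. sigma A B (\<lambda>z. g ((p, e) # z)) e) s) w"
  proof (intro mark_cong conv_cong mult_cong refl less.hyps)
    fix u q s v u' v' and z :: "('l, 's) word" assume w: "w = u @ (q, s) # v" and v: "v = u' @ v'"
    show "length v' < length w" by (simp add: w v)
    assume z: "snd ` set z \<subseteq> snd ` set v'"
    have "end_slot s u' \<in> insert s (snd ` set u')" by (induction u' arbitrary: s) auto
    then show "f ((q, end_slot s u') # z) = g ((q, end_slot s u') # z)"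
      using z by (intro less.prems) (auto simp: w v)
  qed
  moreover have "f [] = g []" using less.prems by simp
  ultimately show ?case unfolding sigma_eq[of A B f t w] sigma_eq[of A B g t w] by simp
qed

lemma path_out_convolution_rebase:
  fixes g h :: "'k::comm_monoid_add point"
  assumes "small b" "small c" "small t" "\<And>x. x \<in> set u \<Longrightarrow> small (snd x)"
  shows "conv (path_out h b p t) (\<lambda>s. sigma (path_in h b) (path_out h b) (path_out g b p s) s) t u =
    exp_series (- (g (log0 1 p) + h (log0 1 p))) (c - b) *
    conv (path_out h c p t) (\<lambda>s. sigma (path_in h c) (path_out h c) (path_out g c p s) s) t u"
proof -
  let ?G = "exp_series (- g (log0 1 p)) (c - b)" and ?H = "exp_series (- h (log0 1 p)) (c - b)"
  have "conv (path_out h b p t) (\<lambda>s. sigma (path_in h b) (path_out h b) (path_out g b p s) s) t u =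
    conv (\<lambda>u. ?H * path_out h c p t u) (\<lambda>s v. ?G * sigma (path_in h c) (path_out h c) (path_out g c p s) s v) t u"
  proof (intro conv_cong mult_cong)
    fix u1 v assume uv: "u = u1 @ v"
    let ?s = "end_slot t u1"
    have s: "small ?s" using assms uv by (intro small_end_slot) auto
    show "path_out h b p t u1 = ?H * path_out h c p t u1" using assms s by (intro path_out_rebase)
    have "sigma (path_in h b) (path_out h b) (path_out g b p ?s) ?s v = sigma (path_in h c) (path_out h c) (path_out g b p ?s) ?s v"
      using assms uv s by (intro sigma_path_rebase) auto
    also have "\<dots> = sigma (path_in h c) (path_out h c) (\<lambda>z. ?G * path_out g c p ?s z) ?s v"
    proof (rule sigma_cong_slots)
      fix z :: "(nat, 'k series) word" assume "snd ` set z \<subseteq> snd ` set v"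
      moreover have "\<forall>y\<in>snd ` set v. small y" using assms uv by auto
      ultimately have "\<And>x. x \<in> set z \<Longrightarrow> small (snd x)" by blast
      then have "small (end_slot ?s z)" by (rule small_end_slot[OF s])
      then show "path_out g b p ?s z = ?G * path_out g c p ?s z" using assms by (intro path_out_rebase)
    qed
    finally show "sigma (path_in h b) (path_out h b) (path_out g b p ?s) ?s v = ?G * sigma (path_in h c) (path_out h c) (path_out g c p ?s) ?s v"
      by (simp add: sigma_scale)
  qed
  moreover have "?H * ?G = exp_series (- (g (log0 1 p) + h (log0 1 p))) (c - b)"
  proof -
    have "- (g (log0 1 p) + h (log0 1 p)) = - h (log0 1 p) + - g (log0 1 p)" by simp
    then show ?thesis using assms by (simp only: exp_series_add_left small_diff)
  qed
  ultimately show ?thesis by (simp add: conv_scale_left conv_scale_right mult.assoc[symmetric])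
qed

text \<open>INV fixes the regular symbols and the logarithms, so the law for A survives composition
  with INV directly.\<close>

lemma path_in_convolution_INV:
  assumes "alg_morphism g" "alg_morphism h"
    and "increasing (map fst u @ [P])" "\<forall>i\<in>set (map fst u @ [P]). 1 \<le> i"
    and "small b" "small t" "\<And>x. x \<in> set u \<Longrightarrow> small (snd x)"
  shows "path_in (convolution g h \<circ> INV) b P t u =
    conv (sigma (path_in h b) (path_out h b) (path_in g b P t) t) (path_in h b P) t u"
  unfolding path_in_INV[OF assms(3,4)] by (rule path_in_convolution[OF assms])

text \<open>Both sides obey the same relation together with the same A. By induction they agree on
  shorter words, so the relation leaves only c times the value on the whole word to compare.\<close>

lemma path_out_convolution_INV:
  fixes g h :: "'k::comm_monoid_add point"
  assumes gp: "is_INV_point g" and hp: "is_INV_point h"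
    and "increasing (p # map fst u)" "1 \<le> p"
    and "set (t # map snd u) \<subseteq> range tvar" "distinct (t # map snd u)" "small b"
  shows "path_out (convolution g h \<circ> INV) b p t u =
    conv (path_out h b p t) (\<lambda>s. sigma (path_in h b) (path_out h b) (path_out g b p s) s) t u"
  using assms(3-)
proof (induction "length u" arbitrary: u b rule: less_induct)
  case less
  define k where "k = convolution g h \<circ> INV"
  have g: "alg_morphism g" and h: "alg_morphism h" using gp hp by (simp_all add: is_INV_point_def)
  have k: "is_INV_point k" unfolding k_def by (intro is_INV_point_compose alg_morphism_convolution g h)
  then have k': "alg_morphism k" by (simp add: is_INV_point_def)
  \<comment> \<open>With the end slot as base slot, the value on a nonempty \<open>u\<close> is an
    entry of \<open>last_coeff\<close>; the given base \<open>b\<close> is restored at the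
    end.\<close>
  define e where "e = end_slot t u"
  have e_in: "e \<in> set (t # map snd u)"
    unfolding e_def by (cases u rule: rev_cases) auto
  then have e: "small e" "small t" using less.prems(3) by auto
  have su: "small (snd x)" if "x \<in> set u" for x using that less.prems(3) by auto
  define A where "A = (\<lambda>P t. conv (sigma (path_in h e) (path_out h e) (path_in g e P t) t) (path_in h e P) t)"
  define B where "B = (\<lambda>p t. conv (path_out h e p t) (\<lambda>s. sigma (path_in h e) (path_out h e) (path_out g e p s) s) t)"
  have main: "path_out k e p t u = B p t u"
  proof (cases u rule: rev_cases)
    case Nil
    then show ?thesis by (simp add: e_def B_def path_out_unit k' g h sigma_eq)
  next
    case (snoc w y)
    obtain P where u: "u = w @ [(P, e)]" using snoc by (cases y) (simp add: e_def)
    define D where "D = set (t # map snd w)"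
    \<comment> \<open>A common multiple of the denominators y - e for all slots y of the shorter
      word: c is the full product and \<open>\<rho> y\<close> omits the factor of y.\<close>
    define \<rho> where "\<rho> = (\<lambda>y. \<Prod>z\<in>D - {y}. z - e)"
    define c where "c = (\<Prod>z\<in>D. z - e)"
    have D: "finite D" "D \<subseteq> range tvar" "e \<notin> D" "t \<in> D"
      using less.prems(3,4) by (auto simp: D_def u)
    obtain j where j: "e = tvar j" using less.prems(3) u by auto
    have \<rho>: "(y - e) * \<rho> y = c" if "y \<in> D" for y
      using that D by (simp add: \<rho>_def c_def prod.remove)
    have sD: "small y" if "y \<in> D" for y using that D by auto
    have ok: "ok_word {1..} D p w P"
      using less.prems(1,2) by (fastforce simp: ok_word_def increasing_def u D_def sorted_wrt_append)
    interpret composition "path_in g e" "path_out g e" "path_in h e" "path_out h e" A B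
      by unfold_locales (simp_all add: A_def B_def)
    have rel: "through \<rho> (path_in \<phi> e) (path_out \<phi> e) l s w P = through_rhs \<rho> c e (path_in \<phi> e) (path_out \<phi> e) l s w P"
      if "is_INV_point \<phi>" "ok_word {1..} D l w P" "s \<in> D" for \<phi> :: "'k point" and l s w P
      using that e sD \<rho> by (intro through_path_INV) (auto simp: is_INV_point_def)
    \<comment> \<open>The convolution satisfies the relation because it is invariant under INV, and
      the composed pair because \<open>g\<close> and \<open>h\<close> satisfy it.\<close>
    have 1: "through \<rho> (path_in k e) (path_out k e) p t w P = through_rhs \<rho> c e (path_in k e) (path_out k e) p t w P"
      using rel[OF k ok] D by simp
    have 2: "through \<rho> A B p t w P = through_rhs \<rho> c e A B p t w P"
      using rel[OF gp] rel[OF hp] ok D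
      by (intro through_composition[where C = "{1..}" and D = D]) (simp_all add: path_in_unit path_out_unit g h)
    have sw: "small (snd x)" if "x \<in> set w" for x using su that u by simp
    have inA: "path_in k e Q s v = A Q s v"
      if "increasing (map fst v @ [Q])" "\<forall>i\<in>set (map fst v @ [Q]). 1 \<le> i" "small s" "\<And>x. x \<in> set v \<Longrightarrow> small (snd x)" for Q s v
      unfolding k_def A_def using that e by (intro path_in_convolution_INV g h)
    have inc: "sorted_wrt (<) (p # map fst w @ [P])" "\<forall>i\<in>set (p # map fst w @ [P]). 1 \<le> i"
      using ok by (auto simp: ok_word_def)
    have IH: "path_out k e p t v = B p t v" if "length v < length u" "increasing (p # map fst v)"
      "set (t # map snd v) \<subseteq> range tvar" "distinct (t # map snd v)" for v
      unfolding k_def B_def using that less.prems(2) e by (intro less.hyps)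
    have outB: "path_out k e p t u1 = B p t u1" if "w = u1 @ v" for u1 v
      using less.prems inc(1) that by (intro IH) (auto simp: u increasing_def sorted_wrt_append)
    have lastB: "last_coeff (path_out k e) e p t u1 q = last_coeff B e p t u1 q" if "w = u1 @ (q, s) # v" for u1 q s v
      unfolding last_coeff_def
      using less.prems inc(1) that by (intro IH) (auto simp: u increasing_def sorted_wrt_append)
    have headA: "head_coeff (path_in k e) e q s v P = head_coeff A e q s v P" if "p # map fst w = u1 @ q # map fst v" "s \<in> D" "set v \<subseteq> set w" for u1 q s v
    proof -
      have eq: "u1 @ q # map fst v @ [P] = p # map fst w @ [P]" using that(1) by simp
      have "sorted_wrt (<) (u1 @ q # map fst v @ [P])" "\<forall>i\<in>set (u1 @ q # map fst v @ [P]). 1 \<le> i"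
        unfolding eq by (fact inc)+
      then show ?thesis
        unfolding head_coeff_def using that(2,3) sD sw e
        by (intro inA) (auto simp: increasing_def sorted_wrt_append)
    qed
    have th: "through \<rho> (path_in k e) (path_out k e) p t w P = through \<rho> A B p t w P"
      unfolding through_def
    proof (intro conv_cong mult_cong refl)
      fix u1 v assume uv: "w = u1 @ v"
      then show "path_out k e p t u1 = B p t u1" by (rule outB)
      show "path_in k e P (end_slot t u1) v = A P (end_slot t u1) v"
        using inc uv e sw by (intro inA small_end_slot) (auto simp: increasing_def sorted_wrt_append)
    qed
    let ?R = "slot_weight \<rho>" and ?a = "head_coeff (path_in k e) e" and ?a' = "head_coeff A e"
      and ?d = "last_coeff (path_out k e) e" and ?d' = "last_coeff B e"
    have Ra: "letter_comp ?R ?a q s v P = letter_comp ?R ?a' q s v P" if "w = u1 @ v" "s \<in> D" for u1 q s v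
    proof (rule comp_cong_at)
      fix z q' s' v' assume v: "v = z @ (q', s') # v'"
      then have "s' \<in> D" using that by (auto simp: D_def)
      then have "?a q' s' v' P = ?a' q' s' v' P"
        using v that by (intro headA[of "p # map fst u1 @ map fst z"]) auto
      then show "?R q s z q' * ?a q' s' v' P = ?R q s z q' * ?a' q' s' v' P" by simp
    qed
    have dR: "letter_comp ?d ?R p t w P = letter_comp ?d' ?R p t w P"
      by (rule comp_cong_at) (simp add: lastB)
    have dRa: "letter_comp ?d (letter_comp ?R ?a) p t w P = letter_comp ?d' (letter_comp ?R ?a') p t w P"
    proof (rule comp_cong_at)
      fix z q' s' v' assume w: "w = z @ (q', s') # v'"
      then have "s' \<in> D" by (auto simp: D_def)
      then show "?d p t z q' * letter_comp ?R ?a q' s' v' P = ?d' p t z q' * letter_comp ?R ?a' q' s' v' P"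
        using Ra[of "z @ [(q', s')]" v' s' q'] lastB[OF w] w by simp
    qed
    have da: "letter_comp ?d ?a p t w P = letter_comp ?d' ?a' p t w P"
    proof (rule comp_cong_at)
      fix z q' s' v' assume w: "w = z @ (q', s') # v'"
      then have "s' \<in> D" by (auto simp: D_def)
      then show "?d p t z q' * ?a q' s' v' P = ?d' p t z q' * ?a' q' s' v' P"
      proof -
        have "?a q' s' v' P = ?a' q' s' v' P"
          using \<open>s' \<in> D\<close> by (intro headA[of "p # map fst z"]) (auto simp: w)
        then show ?thesis using lastB[OF w] by simp
      qed
    qed
    have a: "?a p t w P = ?a' p t w P" using headA[of "[]" p w t] D by simp
    have Rat: "letter_comp ?R ?a p t w P = letter_comp ?R ?a' p t w P" using Ra[of "[]" w t p] D by simp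
    \<comment> \<open>Here \<open>x\<close> and \<open>x'\<close> are the a-term and the da-term,
      and \<open>y\<close>, \<open>y'\<close> are the last coefficients still to be compared; every
      other term has been matched above.\<close>
    have cancel: "c * y = c * y'" if "z = z' - c * (x + y + x')" "z = z' - c * (x + y' + x')" for x x' y y' z z' :: "'k series"
      using that by (simp add: distrib_left)
    have "c * ?d p t w P = c * ?d' p t w P"
      by (rule cancel[OF 1[unfolded through_rhs_def Let_def th dR dRa da Rat a] 2[unfolded through_rhs_def Let_def]])
    then have "c * (?d p t w P - ?d' p t w P) = 0" by (simp add: right_diff_distrib)
    then have "(\<Prod>y\<in>D. y - tvar j) * (?d p t w P - ?d' p t w P) = 0" unfolding c_def j[symmetric] .
    then have "?d p t w P - ?d' p t w P = 0"
      by (rule prod_tvar_diff_cancel[OF D(1,2) D(3)[unfolded j]])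
    then show ?thesis by (simp add: last_coeff_def u)
  qed
  have "path_out k b p t u = exp_series (- k (log0 1 p)) (e - b) * path_out k e p t u"
    using e less.prems(5) by (intro path_out_rebase) (simp_all add: e_def)
  moreover have "k (log0 1 p) = g (log0 1 p) + h (log0 1 p)"
    using convolution_log0[OF g h less.prems(2)] less.prems(2) by (simp add: k_def INV_id log0_Hsymb)
  ultimately show ?case
    using path_out_convolution_rebase[OF less.prems(5) e(1,2) su, of u h p g] main
    by (simp add: k_def B_def)
qed

lemma coeff_monomial_value_tvar: "coeff (monomial_value tvar m) n = (if n = m then 1 else 0)"
proof -
  have times: "MSeries (\<lambda>n. if n = a then 1 else 0) * MSeries (\<lambda>n. if n = b then 1 else 0) =
      (MSeries (\<lambda>n. if n = a + b then 1 else 0) :: 'a mseries)" for a b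
  proof (rule mseries_eqI)
    fix n
    have "coeff (MSeries (\<lambda>n. if n = a then 1 else 0) * MSeries (\<lambda>n. if n = b then 1 else 0)) n =
        (\<Sum>z\<in>splits n. if z = (a, b) then 1 else (0 :: 'a))"
      unfolding times_mseries.rep_eq coeff_simps by (intro sum.cong) (auto split: if_splits)
    also have "\<dots> = (if n = a + b then 1 else 0)"
      by (subst sum.delta[OF finite_splits]) (auto simp: splits_def)
    finally show "coeff (MSeries (\<lambda>n. if n = a then 1 else 0) * MSeries (\<lambda>n. if n = b then 1 else 0)) n =
        coeff (MSeries (\<lambda>n. if n = a + b then 1 else (0 :: 'a))) n" by (simp add: coeff_simps)
  qed
  have "monomial_value tvar m = (MSeries (\<lambda>n. if n = m then 1 else 0) :: 'a mseries)"
  proof (induction m rule: poly_mapping_add_induct)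
    case (single i v)
    have "tvar i ^ v = (MSeries (\<lambda>n. if n = Poly_Mapping.single i v then 1 else 0) :: 'a mseries)"
    proof (induction v)
      case 0
      then show ?case by (simp add: one_mseries_def id_def)
    next
      case (Suc v)
      have "tvar i = (MSeries (\<lambda>n. if n = Poly_Mapping.single i 1 then 1 else 0) :: 'a mseries)"
        by (rule mseries_eqI) (simp add: coeff_simps)
      then show ?case unfolding power_Suc Suc.IH by (simp only: times single_add[symmetric] plus_1_eq_Suc)
    qed
    then show ?case by simp
  next
    case (sum f g)
    then show ?case by (simp add: monomial_value_add times)
  qed
  then show ?thesis by (simp add: coeff_simps)
qed

text \<open>Distinct variables are admissible slots for the uniqueness argument, and they are
  generic: every coefficient can be read back from the series.\<close>

lemma coeff_gen_series_tvar:
  assumes "ns \<in> gen_indices d"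
  shows "coeff (gen_series c (map tvar [1..<Suc d])) (t_exponent ns) = c ns"
proof -
  let ?Ls = "map tvar [1..<Suc d] :: 'a mseries list"
  have summand: "(\<Prod>(L, n)\<leftarrow>zip ?Ls ns'. L ^ (n - 1)) = monomial_value tvar (t_exponent ns')" if "length ns' = d" for ns'
  proof -
    have "monomial_value (\<lambda>i. ?Ls ! (i - 1)) (t_exponent ns') = monomial_value tvar (t_exponent ns')"
      unfolding monomial_value_def
      using that by (intro prod.cong) (auto simp: in_keys_iff lookup_t_exponent simp del: upt_Suc split: if_splits)
    then show ?thesis using monomial_value_t_exponent[of ns' ?Ls] that by simp
  qed
  have inj: "t_exponent ns = t_exponent ns' \<longleftrightarrow> ns' = ns" if "ns' \<in> gen_indices d" for ns'
    using bij_betw_t_exponent[of d] assms that by (auto simp: bij_betw_def inj_on_def)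
  have "coeff (gen_series c ?Ls) (t_exponent ns) =
      (\<Sum>ns'\<in>{ns' \<in> gen_indices d. (\<Sum>n\<leftarrow>ns'. n - 1) \<le> total_degree (t_exponent ns)}. if ns' = ns then c ns else 0)"
    unfolding gen_series_gsum gsum_def coeff_simps
  proof (intro sum.cong)
    fix ns' assume "ns' \<in> {ns' \<in> gen_indices d. (\<Sum>n\<leftarrow>ns'. n - 1) \<le> total_degree (t_exponent ns)}"
    then have len: "length ns' = d" and mem: "ns' \<in> gen_indices d" by (auto simp: gen_indices_def)
    show "coeff (const_series (c ns') * (\<Prod>(L, n)\<leftarrow>zip ?Ls ns'. L ^ (n - 1))) (t_exponent ns) = (if ns' = ns then c ns else 0)"
      unfolding summand[OF len] coeff_const_times coeff_monomial_value_tvar inj[OF mem] by simp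
  qed (simp del: upt_Suc)
  also have "\<dots> = c ns"
    using assms by (subst sum.delta[OF finite_gen_indices]) (auto simp: total_degree_t_exponent)
  finally show ?thesis .
qed

section \<open>Coassociativity\<close>

lemma symbol_series_tvar:
  assumes "ns \<in> gen_indices d"
  shows "coeff (symbol_series \<phi> ps (map tvar [1..<Suc d])) (t_exponent ns) = \<phi> (symbol ps ns)"
  unfolding symbol_series_def by (rule coeff_gen_series_tvar[OF assms])

lemma convolution_assoc_symbol:
  fixes g1 g2 g3 :: "'k::comm_monoid_add point"
  assumes p1: "is_INV_point g1" and p2: "is_INV_point g2" and p3: "is_INV_point g3"
    and ps: "increasing ps" "\<forall>i\<in>set ps. 1 \<le> i" "length ps = Suc d" and ns: "ns \<in> gen_indices d"
  shows "convolution (convolution g1 g2 \<circ> INV) g3 (symbol ps ns) = convolution g1 (convolution g2 g3 \<circ> INV) (symbol ps ns)"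
proof -
  have g: "alg_morphism g1" "alg_morphism g2" "alg_morphism g3"
    using p1 p2 p3 by (simp_all add: is_INV_point_def)
  define k12 k23 where "k12 = convolution g1 g2 \<circ> INV" and "k23 = convolution g2 g3 \<circ> INV"
  have k: "alg_morphism k12" "alg_morphism k23"
    unfolding k12_def k23_def by (intro alg_morphism_compose alg_morphism_convolution alg_morphism_INV g)+
  \<comment> \<open>The slots of the word are the variables themselves, while start and base slot
    are 0. Then A_P has trivial exponential and is the generating series of the values on
    symbols.\<close>
  define u P where "u = zip (butlast ps) (map tvar [1..<Suc d] :: 'k series list)" and "P = last ps"
  have u1: "map fst u = butlast ps" and u2: "map snd u = map tvar [1..<Suc d]"
    using ps(3) by (simp_all add: u_def del: upt_Suc)
  have psu: "map fst u @ [P] = ps" using ps(3) unfolding u1 P_def by (intro append_butlast_last_id) auto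
  have inc: "increasing (map fst u @ [P])" "\<forall>i\<in>set (map fst u @ [P]). 1 \<le> i" unfolding psu by (fact ps)+
  have tv: "snd ` set u \<subseteq> range tvar" using arg_cong[OF u2, of set] by (auto simp del: upt_Suc)
  have dist: "distinct (map snd u)"
  proof -
    have "inj (tvar :: nat \<Rightarrow> 'k series)"
    proof
      fix i j assume "(tvar i :: 'k series) = tvar j"
      then show "i = j" using tvar_diff_cancel[of i j "1 :: 'k series"] by auto
    qed
    then show ?thesis unfolding u2 by (auto simp: distinct_map inj_on_def simp del: upt_Suc)
  qed
  have small: "small (snd x)" if "x \<in> set u" for x using tv that by fastforce
  have expand: "\<phi> (symbol ps ns) = coeff (path_in \<phi> 0 P 0 u) (t_exponent ns)" for \<phi> :: "'k point"
  proof -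
    have "map (\<lambda>x. snd x - 0) u = map tvar [1..<Suc d]" using u2 by simp
    then have "path_in \<phi> 0 P 0 u = symbol_series \<phi> ps (map tvar [1..<Suc d])"
      unfolding path_in_def psu by (simp del: upt_Suc)
    then show ?thesis by (simp only: symbol_series_tvar[OF ns])
  qed
  let ?S2 = "sigma (path_in g2 0) (path_out g2 0)" and ?S3 = "sigma (path_in g3 0) (path_out g3 0)"
  define A where "A = (\<lambda>p t. conv (?S3 (path_in g2 0 p t) t) (path_in g3 0 p) t)"
  define B where "B = (\<lambda>p t. conv (path_out g3 0 p t) (\<lambda>s. ?S3 (path_out g2 0 p s) s) t)"
  have "path_in (convolution k12 g3) 0 P 0 u = conv (?S3 (path_in k12 0 P 0) 0) (path_in g3 0 P) 0 u"
    using small by (intro path_in_convolution[OF k(1) g(3) inc]) auto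
  also have "\<dots> = conv (?S3 (conv (?S2 (path_in g1 0 P 0) 0) (path_in g2 0 P) 0) 0) (path_in g3 0 P) 0 u"
  proof (intro conv_cong mult_cong refl)
    fix v v' assume v: "u = v @ v'"
    \<comment> \<open>The letter 0 serves as a left neighbour below all letters of the word; a word
      admissible behind it has letters at least 1.\<close>
    have "ok_word UNIV (snd ` set u) 0 v P"
      using inc by (auto simp: v ok_word_def increasing_def sorted_wrt_append Suc_le_eq)
    then show "?S3 (path_in k12 0 P 0) 0 v = ?S3 (conv (?S2 (path_in g1 0 P 0) 0) (path_in g2 0 P) 0) 0 v"
    proof (rule sigma_cong_fun)
      fix z assume "ok_word UNIV (snd ` set u) 0 z P"
      then have z: "sorted_wrt (<) (0 # map fst z @ [P])" "snd ` set z \<subseteq> snd ` set u"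
        by (simp_all add: ok_word_def)
      then have "increasing (map fst z @ [P])" "\<forall>i\<in>set (map fst z @ [P]). 1 \<le> i"
        by (auto simp: increasing_def Suc_le_eq)
      moreover have "\<forall>y\<in>snd ` set u. small y" using small by auto
      with z(2) have "\<forall>y\<in>snd ` set z. small y" by (meson subsetD)
      ultimately show "path_in k12 0 P 0 z = conv (?S2 (path_in g1 0 P 0) 0) (path_in g2 0 P) 0 z"
        unfolding k12_def by (intro path_in_convolution_INV g) auto
    qed
  qed
  also have "\<dots> = conv (?S3 (?S2 (path_in g1 0 P 0) 0) 0) (A P) 0 u"
    by (simp add: sigma_conv conv_assoc A_def)
  also have "\<dots> = conv (sigma A B (path_in g1 0 P 0) 0) (A P) 0 u"
    by (intro conv_cong mult_cong refl sigma_sigma) (simp_all add: A_def B_def)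
  also have "\<dots> = conv (sigma (path_in k23 0) (path_out k23 0) (path_in g1 0 P 0) 0) (path_in k23 0 P) 0 u"
  proof (intro conv_cong mult_cong)
    have inA: "A Q s z = path_in k23 0 Q s z"
      if "increasing (map fst z @ [Q])" "\<forall>i\<in>set (map fst z @ [Q]). 1 \<le> i" "small s" "set z \<subseteq> set u" for Q s z
      unfolding A_def k23_def using that small by (intro path_in_convolution_INV[symmetric] g) auto
    fix v v' assume v: "u = v @ v'"
    show "A P (end_slot 0 v) v' = path_in k23 0 P (end_slot 0 v) v'"
      using inc small by (intro inA small_end_slot) (auto simp: v increasing_def sorted_wrt_append)
    show "sigma A B (path_in g1 0 P 0) 0 v = sigma (path_in k23 0) (path_out k23 0) (path_in g1 0 P 0) 0 v"
    proof (rule sigma_cong)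
      fix z p s y x assume w: "v = x @ z @ (p, s) # y"
      show "A p (end_slot 0 x) z = path_in k23 0 p (end_slot 0 x) z"
        using inc small by (intro inA small_end_slot) (auto simp: v w increasing_def sorted_wrt_append)
    next
      \<comment> \<open>A B-factor always starts at the slot of a letter of \<open>u\<close>, hence
        at a variable different from the later slots; the start slot 0, which is no variable, is not
        among these.\<close>
      fix p s z y x assume w: "v = x @ (p, s) # z @ y"
      have "set (s # map snd z) \<subseteq> range tvar" using tv by (auto simp: v w)
      moreover have "distinct (s # map snd z)" using dist by (auto simp: v w)
      ultimately show "B p s z = path_out k23 0 p s z"
        unfolding B_def k23_def using inc
        by (intro path_out_convolution_INV[symmetric] p2 p3) (auto simp: v w increasing_def sorted_wrt_append)
    qed
  qed
  also have "\<dots> = path_in (convolution g1 k23) 0 P 0 u"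
    using small by (intro path_in_convolution[symmetric] g k inc) auto
  finally show ?thesis unfolding expand k12_def k23_def by simp
qed

lemma pairing_compose:
  assumes "alg_morphism \<phi>" "alg_morphism g" "alg_morphism h"
  shows "pairing (\<phi> \<circ> g) (\<phi> \<circ> h) = \<phi> \<circ> pairing g h"
proof (rule alg_morphism_eqI)
  show "pairing (\<phi> \<circ> g) (\<phi> \<circ> h) (Poly_Mapping.single k 1) = (\<phi> \<circ> pairing g h) (Poly_Mapping.single k 1)" for k
    by (cases k) (simp add: pairing_def linear_extension_single alg_morphism.times[OF assms(1)])
qed (intro alg_morphism_pairing alg_morphism_compose assms)+

lemma tensor_one: "left_factor a = a \<otimes> 1" "right_factor b = 1 \<otimes> b"
  by (simp_all add: tensor_eq alg_morphism.one[OF alg_morphism_left_factor] alg_morphism.one[OF alg_morphism_right_factor])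

text \<open>Any pair of points factors through the universal pair \<open>left_factor\<close>,
  \<open>right_factor\<close>, whose convolution after INV is the coproduct.\<close>

lemma convolution_INV:
  assumes g: "alg_morphism g" and h: "alg_morphism h"
  shows "convolution (g \<circ> INV) (h \<circ> INV) = pairing g h \<circ> coproduct"
proof -
  have "pairing g h \<circ> left_factor = g" "pairing g h \<circ> right_factor = h"
    by (auto simp: tensor_one pairing_tensor[OF g h] alg_morphism.one[OF g] alg_morphism.one[OF h])
  then have "pairing (g \<circ> INV) (h \<circ> INV) = pairing (pairing g h \<circ> (left_factor \<circ> INV)) (pairing g h \<circ> (right_factor \<circ> INV))"
    by (simp only: comp_assoc[symmetric])
  also have "\<dots> = pairing g h \<circ> pairing (left_factor \<circ> INV) (right_factor \<circ> INV)"
    by (intro pairing_compose alg_morphism_pairing alg_morphism_compose alg_morphism_left_factor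
        alg_morphism_right_factor alg_morphism_INV g h)
  finally show ?thesis unfolding convolution_def coproduct_eq by (simp only: comp_assoc)
qed

lemma alg_morphism_coproduct: "alg_morphism coproduct"
  unfolding coproduct_eq
  by (intro alg_morphism_convolution alg_morphism_compose alg_morphism_left_factor alg_morphism_right_factor alg_morphism_INV)

lemma index_symbol_cases:
  obtains "index_symbol v = 1"
  | ps ns where "index_symbol v = symbol ps ns" "increasing ps" "\<forall>i\<in>set ps. 1 \<le> i"
    "length ps = Suc (length ns)" "ns \<in> gen_indices (length ns)"
proof -
  obtain u where u: "v = abs_vindex u"
    using vindex.abs_induct[of "\<lambda>v. \<exists>u. v = abs_vindex u" v] by blast
  let ?p = "support_positions u @ [length u + 1]" and ?ns = "filter (\<lambda>n. n \<noteq> 0) u"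
  have v: "index_symbol v = symbol ?p ?ns"
    by (simp add: u index_symbol_def symbol_def index_monomial.abs_eq)
  show thesis
  proof (cases "?ns = []")
    case True
    then show thesis using v by (intro that(1)) (simp add: symbol_def symbol_monomial_def)
  next
    case False
    have "increasing ?p"
      by (auto simp: increasing_def support_positions_def sorted_wrt_append sorted_wrt_map intro!: sorted_wrt_filter)
    then show thesis
      using valid_index_generator[OF False] v by (intro that(2)[of ?p ?ns]) (simp_all add: gen_indices_def)
  qed
qed

text \<open>The left side applies id \<otimes> \<Delta> and the right side \<Delta> \<otimes> id.
  Both arise by convolving the three embeddings \<open>?l\<close>, \<open>?m\<close>,
  \<open>?r\<close> into the triple tensor product, bracketed in the two ways.\<close>

lemma coproduct_coassoc:
  fixes v :: vindex
  shows "pairing left_factor (right_factor \<circ> coproduct) (coproduct (index_symbol v)) =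
    pairing (pairing left_factor (right_factor \<circ> left_factor) \<circ> coproduct) (right_factor \<circ> right_factor) (coproduct (index_symbol v))"
proof -
  let ?l = "left_factor :: hbar \<Rightarrow> (monomial \<times> monomial \<times> monomial \<Rightarrow>\<^sub>0 rat)"
  let ?m = "right_factor \<circ> left_factor :: hbar \<Rightarrow> (monomial \<times> monomial \<times> monomial \<Rightarrow>\<^sub>0 rat)"
  let ?r = "right_factor \<circ> right_factor :: hbar \<Rightarrow> (monomial \<times> monomial \<times> monomial \<Rightarrow>\<^sub>0 rat)"
  note rules = alg_morphism_compose alg_morphism_left_factor alg_morphism_right_factor alg_morphism_INV
    alg_morphism_pairing alg_morphism_coproduct
  have "convolution (?m \<circ> INV) (?r \<circ> INV) = pairing (right_factor \<circ> left_factor) (right_factor \<circ> right_factor) \<circ> coproduct"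
    by (intro convolution_INV rules)
  also have "pairing (right_factor \<circ> left_factor) (right_factor \<circ> right_factor) = right_factor \<circ> pairing left_factor right_factor"
    by (intro pairing_compose rules)
  \<comment> \<open>Multiplying a \<otimes> 1 by 1 \<otimes> b gives back a \<otimes> b.\<close>
  also have "pairing left_factor right_factor = (\<lambda>T :: hbar2. T)"
  proof (rule alg_morphism_eqI)
    show "pairing left_factor right_factor (Poly_Mapping.single k 1) = Poly_Mapping.single k 1" for k :: "monomial \<times> monomial"
      by (cases k) (simp add: pairing_def linear_extension_single left_factor_def right_factor_def mult_single)
  qed (intro rules, simp add: alg_morphism_def)
  finally have mr: "convolution (?m \<circ> INV) (?r \<circ> INV) = right_factor \<circ> coproduct" by (simp add: o_def)
  have lm: "convolution (?l \<circ> INV) (?m \<circ> INV) = pairing ?l ?m \<circ> coproduct"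
    by (intro convolution_INV rules)
  have X: "convolution (?l \<circ> INV) (convolution (?m \<circ> INV) (?r \<circ> INV) \<circ> INV) = pairing ?l (right_factor \<circ> coproduct) \<circ> coproduct"
    unfolding mr by (intro convolution_INV rules)
  have Y: "convolution (convolution (?l \<circ> INV) (?m \<circ> INV) \<circ> INV) (?r \<circ> INV) = pairing (pairing ?l ?m \<circ> coproduct) ?r \<circ> coproduct"
    unfolding lm by (intro convolution_INV rules)
  have "convolution (convolution (?l \<circ> INV) (?m \<circ> INV) \<circ> INV) (?r \<circ> INV) (index_symbol v) =
      convolution (?l \<circ> INV) (convolution (?m \<circ> INV) (?r \<circ> INV) \<circ> INV) (index_symbol v)"
  proof (cases v rule: index_symbol_cases)
    case 1
    have "alg_morphism (convolution (convolution (?l \<circ> INV) (?m \<circ> INV) \<circ> INV) (?r \<circ> INV))"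
      "alg_morphism (convolution (?l \<circ> INV) (convolution (?m \<circ> INV) (?r \<circ> INV) \<circ> INV))"
      by (intro alg_morphism_convolution rules)+
    then show ?thesis unfolding 1 by (simp only: alg_morphism.one)
  next
    case (2 ps ns)
    then show ?thesis
      by (auto intro!: convolution_assoc_symbol is_INV_point_compose rules)
  qed
  then show ?thesis unfolding X Y by simp
qed

lemma coproduct_variation_matrix:
  "coproduct (variation_matrix v w) = Sum_any (\<lambda>u. variation_matrix u w \<otimes> variation_matrix v u)"
proof -
  let ?V = variation_matrix
  let ?W = "{w. ?V v w \<noteq> 0}"
  have row: "coproduct (index_symbol v) = (\<Sum>u\<in>{u. ?V v u \<noteq> 0}. index_symbol u \<otimes> ?V v u)" for v
    unfolding coproduct_index_symbol
    by (rule Sum_any.expand_superset[OF finite_variation_matrix_row]) (auto simp: tensor_def)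
  note rules = alg_morphism_compose alg_morphism_left_factor alg_morphism_right_factor
    alg_morphism_pairing alg_morphism_coproduct
  let ?l = "left_factor :: hbar \<Rightarrow> (monomial \<times> monomial \<times> monomial \<Rightarrow>\<^sub>0 rat)"
  let ?m = "right_factor \<circ> left_factor :: hbar \<Rightarrow> (monomial \<times> monomial \<times> monomial \<Rightarrow>\<^sub>0 rat)"
  let ?r = "right_factor \<circ> right_factor :: hbar \<Rightarrow> (monomial \<times> monomial \<times> monomial \<Rightarrow>\<^sub>0 rat)"
  have X: "pairing ?l (right_factor \<circ> coproduct) (coproduct (index_symbol v)) =
      (\<Sum>x\<in>?W. index_symbol x \<otimes> coproduct (?V v x))"
  proof -
    have m: "alg_morphism ?l" "alg_morphism (right_factor \<circ> coproduct :: hbar \<Rightarrow> (monomial \<times> monomial \<times> monomial \<Rightarrow>\<^sub>0 rat))"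
      by (intro rules)+
    show ?thesis
      unfolding row[of v] alg_morphism.sum[OF alg_morphism_pairing[OF m]] pairing_tensor[OF m]
      by (simp add: tensor_eq)
  qed
  have Y: "pairing (pairing ?l ?m \<circ> coproduct) ?r (coproduct (index_symbol v)) =
      (\<Sum>u\<in>?W. \<Sum>x\<in>{x. ?V u x \<noteq> 0}. index_symbol x \<otimes> (?V u x \<otimes> ?V v u))"
  proof -
    have m: "alg_morphism ?l" "alg_morphism ?m" "alg_morphism ?r" "alg_morphism (pairing ?l ?m \<circ> coproduct)"
      by (intro rules)+
    have "(pairing ?l ?m \<circ> coproduct) (index_symbol u) * ?r a = (\<Sum>x\<in>{x. ?V u x \<noteq> 0}. index_symbol x \<otimes> (?V u x \<otimes> a))" for u a
      unfolding comp_apply row[of u] alg_morphism.sum[OF alg_morphism_pairing[OF m(1,2)]] pairing_tensor[OF m(1,2)] sum_distrib_right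
      by (intro sum.cong refl) (simp add: tensor_eq alg_morphism.times[OF alg_morphism_right_factor] mult.assoc)
    then show ?thesis
      unfolding row[of v] alg_morphism.sum[OF alg_morphism_pairing[OF m(4,3)]] pairing_tensor[OF m(4,3)] by simp
  qed
  \<comment> \<open>Distinct indices have distinct monomials, so looking up
    \<open>index_monomial w\<close> in the first tensor factor isolates the component of
    \<open>w\<close>.\<close>
  have delta: "Poly_Mapping.lookup (index_symbol x) (index_monomial w) = (if x = w then 1 else 0)" for x
    using inj_index_monomial by (auto simp: index_symbol_def lookup_single when_def inj_eq)
  have "Sum_any (\<lambda>u. ?V u w \<otimes> ?V v u) = (\<Sum>u\<in>?W. ?V u w \<otimes> ?V v u)"
    by (rule Sum_any.expand_superset[OF finite_variation_matrix_row]) (auto simp: tensor_def)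
  moreover have "coproduct (?V v w) = (\<Sum>u\<in>?W. ?V u w \<otimes> ?V v u)"
  proof (rule poly_mapping_eqI)
    fix k
    have "Poly_Mapping.lookup (\<Sum>x\<in>?W. index_symbol x \<otimes> coproduct (?V v x)) (index_monomial w, k) =
        (\<Sum>x\<in>?W. if x = w then Poly_Mapping.lookup (coproduct (?V v w)) k else 0)"
      unfolding lookup_sum lookup_tensor delta by (intro sum.cong) auto
    also have "\<dots> = Poly_Mapping.lookup (coproduct (?V v w)) k"
      using finite_variation_matrix_row[of v] alg_morphism.zero[OF alg_morphism_coproduct] by (auto simp: sum.delta)
    finally have L: "Poly_Mapping.lookup (\<Sum>x\<in>?W. index_symbol x \<otimes> coproduct (?V v x)) (index_monomial w, k) =
      Poly_Mapping.lookup (coproduct (?V v w)) k" .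
    have "Poly_Mapping.lookup (\<Sum>x\<in>{x. ?V u x \<noteq> 0}. index_symbol x \<otimes> (?V u x \<otimes> ?V v u)) (index_monomial w, k) =
        Poly_Mapping.lookup (?V u w \<otimes> ?V v u) k" for u
    proof -
      have "Poly_Mapping.lookup (\<Sum>x\<in>{x. ?V u x \<noteq> 0}. index_symbol x \<otimes> (?V u x \<otimes> ?V v u)) (index_monomial w, k) =
        (\<Sum>x\<in>{x. ?V u x \<noteq> 0}. if x = w then Poly_Mapping.lookup (?V u w \<otimes> ?V v u) k else 0)"
        unfolding lookup_sum lookup_tensor delta by (intro sum.cong) auto
      also have "\<dots> = Poly_Mapping.lookup (?V u w \<otimes> ?V v u) k"
        using finite_variation_matrix_row[of u] by (auto simp: sum.delta tensor_def)
      finally show ?thesis .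
    qed
    then have "Poly_Mapping.lookup (\<Sum>u\<in>?W. \<Sum>x\<in>{x. ?V u x \<noteq> 0}. index_symbol x \<otimes> (?V u x \<otimes> ?V v u)) (index_monomial w, k) =
        Poly_Mapping.lookup (\<Sum>u\<in>?W. ?V u w \<otimes> ?V v u) k"
      by (simp add: lookup_sum)
    then show "Poly_Mapping.lookup (coproduct (?V v w)) k = Poly_Mapping.lookup (\<Sum>u\<in>?W. ?V u w \<otimes> ?V v u) k"
      using coproduct_coassoc[of v] L unfolding X Y by simp
  qed
  ultimately show ?thesis by simp
qed

theorem theorem2p24:
  shows "coproduct_matrix (transpose_matrix variation_matrix) =
           tensor_matrix (transpose_matrix variation_matrix) (transpose_matrix variation_matrix)
       \<and> (\<forall>v w. coproduct (variation_matrix v w) = Sum_any (\<lambda>u. variation_matrix u w \<otimes> variation_matrix v u))"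
  unfolding coproduct_matrix_def tensor_matrix_def transpose_matrix_def
  by (simp add: coproduct_variation_matrix)

end
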